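(* Let $d\in\{1,2,\dots\}$, $p\in[1,\infty)$, and let $w$ be a weight on $\mathbb{R}^d$ with $\mu(dx)=w\,dx$ and $\varphi=w^{1/p}$. Assume conditions (Reg) and (Diff), and if $p=1$ assume also that $\nabla\varphi\in L^\infty_{\mathrm{loc}}(dx;\mathbb{R}^d)$. Then \[H^{1,p}(\mu)=V^{1,p}(\mu)=W^{1,p}(\mu).\]
   Context: A weight is a measurable function $w\in L^1_{\mathrm{loc}}(\mathbb{R}^d)$ with $w\ge 0$ a.e.; $\mu(dx):=w\,dx$, $\varphi:=w^{1/p}$, $q:=p/(p-1)$ ($q=\infty$ if $p=1$). $C_0^\infty(\mathbb{R}^d)$ denotes smooth functions with compact support. Condition (Reg): $\varphi^{-q}\in L^1_{\mathrm{loc}}(dx)$ if $p\in(1,\infty)$; $\varphi^{-1}\in L^\infty_{\mathrm{loc}}(dx)$ if $p=1$. (Under (Reg), $\mu$ and $dx$ are equivalent measures and $L^p(\mu)\subset L^1_{\mathrm{loc}}(dx)$.) Condition (Diff): $\varphi\in W^{1,p}_{\mathrm{loc}}(dx)$ and $\beta:=p\,\frac{\nabla\varphi}{\varphi}\in L^q_{\mathrm{loc}}(\mu;\mathbb{R}^d)$, where $\nabla$ is the weak gradient and $\beta:=0$ on $\{\varphi=0\}$. $V^{1,p}(\mu)$ (defined under (Diff)) is the set of all $\mu$-classes of functions $f\in L^p(\mu)$ for which there is a (necessarily unique) gradient $\nabla^\mu f=(\partial_1^\mu f,\dots,\partial_d^\mu f)\in L^p(\mu;\mathbb{R}^d)$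 such that \[\int\partial_i^\mu f\,\eta\,d\mu=-\int f\,\partial_i\eta\,d\mu-\int f\,\eta\,\beta_i\,d\mu\] for all $i\in\{1,\dots,d\}$ and all $\eta\in C_0^\infty(\mathbb{R}^d)$. $W^{1,p}(\mu):=\{u\in L^p(\mu)\mid \mathrm{D}u\in L^p(\mu;\mathbb{R}^d)\}$ (defined under (Reg)), where $\mathrm{D}$ is the gradient in the sense of Schwartz distributions. $H^{1,p}(\mu)$ is the completion of $C_0^\infty(\mathbb{R}^d)$ with respect to $\big(\|\nabla\cdot\|_{L^p(\mu;\mathbb{R}^d)}^p+\|\cdot\|_{L^p(\mu)}^p\big)^{1/p}$. Under (Diff) it is a space of $\mu$-classes: it is identified with the set of $u\in L^p(\mu)$ for which there are $u_n\in C_0^\infty(\mathbb{R}^d)$ with $u_n\to u$ in $L^p(\mu)$ and $(\nabla u_n)$ Cauchy in $L^p(\mu;\mathbb{R}^d)$. *)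

theory Defs
  imports "HOL-Analysis.Analysis"
begin

section \<open>Test functions\<close>

definition partial_deriv :: "'n::finite \<Rightarrow> (real ^ 'n \<Rightarrow> real) \<Rightarrow> real ^ 'n \<Rightarrow> real" where
  "partial_deriv i f x = frechet_derivative f (at x) (axis i 1)"

definition grad :: "(real ^ 'n::finite \<Rightarrow> real) \<Rightarrow> real ^ 'n \<Rightarrow> real ^ 'n" where
  "grad f x = (\<chi> i. partial_deriv i f x)"

primrec Ck :: "nat \<Rightarrow> (real ^ 'n::finite \<Rightarrow> real) \<Rightarrow> bool" where
  "Ck 0 f \<longleftrightarrow> continuous_on UNIV f"
| "Ck (Suc k) f \<longleftrightarrow> (\<forall>x. f differentiable (at x)) \<and> (\<forall>i. Ck k (partial_deriv i f))"

definition test_functions :: "(real ^ 'n::finite \<Rightarrow> real) set" where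
  "test_functions = {\<eta>. (\<forall>k. Ck k \<eta>) \<and> compact (closure {x. \<eta> x \<noteq> 0})}"

section \<open>Lebesgue spaces\<close>

text \<open>The elements of these spaces are functions; passing to classes of almost everywhere equal
  functions is done explicitly with \<open>ae_class\<close> below. The exponent may be infinite.\<close>

definition L_space :: "ereal \<Rightarrow> 'a measure \<Rightarrow> ('a \<Rightarrow> 'b::euclidean_space) set" where
  "L_space p M = {f \<in> borel_measurable M.
     if p = \<infinity> then \<exists>C. AE x in M. norm (f x) \<le> C
     else integrable M (\<lambda>x. norm (f x) powr real_of_ereal p)}"

definition L_loc :: "ereal \<Rightarrow> 'a::topological_space measure \<Rightarrow> ('a \<Rightarrow> 'b::euclidean_space) set" where
  "L_loc p M = {f. \<forall>K. compact K \<longrightarrow> (\<lambda>x. indicator K x *\<^sub>R f x) \<in> L_space p M}"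

definition L_norm :: "real \<Rightarrow> 'a measure \<Rightarrow> ('a \<Rightarrow> 'b::euclidean_space) \<Rightarrow> real" where
  "L_norm p M f = (\<integral>x. norm (f x) powr p \<partial>M) powr (1 / p)"

definition ae_class :: "'a measure \<Rightarrow> ('a \<Rightarrow> real) \<Rightarrow> ('a \<Rightarrow> real) set" where
  "ae_class M f = {g \<in> borel_measurable M. AE x in M. g x = f x}"

definition conj_exponent :: "real \<Rightarrow> ereal" where
  "conj_exponent p = (if p = 1 then \<infinity> else ereal (p / (p - 1)))"

section \<open>Weak gradients\<close>

definition has_weak_gradient ::
    "(real ^ 'n::finite \<Rightarrow> real) \<Rightarrow> (real ^ 'n \<Rightarrow> real ^ 'n) \<Rightarrow> bool" where
  "has_weak_gradient u G \<longleftrightarrow> u \<in> L_loc 1 lebesgue \<and> G \<in> L_loc 1 lebesgue \<and>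
     (\<forall>i. \<forall>\<eta>\<in>test_functions.
        (\<integral>x. G x $ i * \<eta> x \<partial>lebesgue) = - (\<integral>x. u x * partial_deriv i \<eta> x \<partial>lebesgue))"

text \<open>A weak gradient is unique only up to Lebesgue null sets; \<open>weak_gradient u\<close> is some version of
  it, and unspecified if \<open>u\<close> has none.\<close>

definition weak_gradient :: "(real ^ 'n::finite \<Rightarrow> real) \<Rightarrow> real ^ 'n \<Rightarrow> real ^ 'n" where
  "weak_gradient u = (SOME G. has_weak_gradient u G)"

definition W_loc :: "real \<Rightarrow> (real ^ 'n::finite \<Rightarrow> real) set" where
  "W_loc p = {u \<in> L_loc p lebesgue.
     (\<exists>G. has_weak_gradient u G) \<and> weak_gradient u \<in> L_loc p lebesgue}"

section \<open>Weights and the conditions on them\<close>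

definition weight :: "(real ^ 'n::finite \<Rightarrow> real) \<Rightarrow> bool" where
  "weight w \<longleftrightarrow> w \<in> borel_measurable lebesgue \<and> w \<in> L_loc 1 lebesgue \<and> (AE x in lebesgue. 0 \<le> w x)"

definition weighted :: "(real ^ 'n::finite \<Rightarrow> real) \<Rightarrow> (real ^ 'n) measure" where
  "weighted w = density lebesgue (\<lambda>x. ennreal (w x))"

definition phi :: "real \<Rightarrow> (real ^ 'n::finite \<Rightarrow> real) \<Rightarrow> real ^ 'n \<Rightarrow> real" where
  "phi p w x = w x powr (1 / p)"

text \<open>Negative powers of \<open>phi\<close> are taken in \<^typ>\<open>ennreal\<close>, with value \<open>\<infinity>\<close> where \<open>phi\<close> vanishes (on the
  reals, \<open>0 powr (- q) = 0\<close> and \<open>inverse 0 = 0\<close>). In particular \<open>Reg\<close> forces \<open>phi > 0\<close> a.e.\<close>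

definition Reg :: "real \<Rightarrow> (real ^ 'n::finite \<Rightarrow> real) \<Rightarrow> bool" where
  "Reg p w \<longleftrightarrow> (\<forall>K. compact K \<longrightarrow>
     (if p = 1 then \<exists>C::real. AE x in lebesgue. x \<in> K \<longrightarrow> inverse (ennreal (phi p w x)) \<le> ennreal C
      else (\<integral>\<^sup>+x\<in>K. (if phi p w x = 0 then \<infinity>
                      else ennreal (phi p w x powr - (p / (p - 1)))) \<partial>lebesgue) < \<infinity>))"

definition beta :: "real \<Rightarrow> (real ^ 'n::finite \<Rightarrow> real) \<Rightarrow> real ^ 'n \<Rightarrow> real ^ 'n" where
  "beta p w x = (if phi p w x = 0 then 0 else (p / phi p w x) *\<^sub>R weak_gradient (phi p w) x)"

definition Diff :: "real \<Rightarrow> (real ^ 'n::finite \<Rightarrow> real) \<Rightarrow> bool" where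
  "Diff p w \<longleftrightarrow> phi p w \<in> W_loc p \<and> beta p w \<in> L_loc (conj_exponent p) (weighted w)"

section \<open>The three weighted Sobolev spaces\<close>

definition V_space :: "real \<Rightarrow> (real ^ 'n::finite \<Rightarrow> real) \<Rightarrow> (real ^ 'n \<Rightarrow> real) set set" where
  "V_space p w = ae_class (weighted w) ` {f \<in> L_space p (weighted w).
     \<exists>G :: real ^ 'n \<Rightarrow> real ^ 'n. G \<in> L_space p (weighted w) \<and>
       (\<forall>i. \<forall>\<eta>\<in>test_functions.
          (\<integral>x. G x $ i * \<eta> x \<partial>weighted w) =
            - (\<integral>x. f x * partial_deriv i \<eta> x \<partial>weighted w)
            - (\<integral>x. f x * \<eta> x * beta p w x $ i \<partial>weighted w))}"

text \<open>\<open>has_weak_gradient\<close> requires local Lebesgue integrability, which under \<open>Reg\<close> is automatic for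
  functions in \<open>L_space p (weighted w)\<close>.\<close>

definition W_space :: "real \<Rightarrow> (real ^ 'n::finite \<Rightarrow> real) \<Rightarrow> (real ^ 'n \<Rightarrow> real) set set" where
  "W_space p w = ae_class (weighted w) ` {u \<in> L_space p (weighted w).
     \<exists>G :: real ^ 'n \<Rightarrow> real ^ 'n. has_weak_gradient u G \<and> G \<in> L_space p (weighted w)}"

text \<open>The completion of the test functions, realised inside \<open>L\<^sup>p(\<mu>)\<close> as the classes that are limits
  of sequences of test functions whose gradients are Cauchy. This is the completion when the
  gradient is closable on test functions, as it is under \<open>Diff\<close>.\<close>

definition H_space :: "real \<Rightarrow> (real ^ 'n::finite \<Rightarrow> real) \<Rightarrow> (real ^ 'n \<Rightarrow> real) set set" where
  "H_space p w = ae_class (weighted w) ` {u \<in> L_space p (weighted w).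
     \<exists>U :: nat \<Rightarrow> real ^ 'n \<Rightarrow> real. (\<forall>n. U n \<in> test_functions) \<and>
       (\<lambda>n. L_norm p (weighted w) (\<lambda>x. U n x - u x)) \<longlonglongrightarrow> 0 \<and>
       (\<forall>\<epsilon>>0. \<exists>N. \<forall>m\<ge>N. \<forall>n\<ge>N.
          L_norm p (weighted w) (\<lambda>x. grad (U m) x - grad (U n) x) < \<epsilon>)}"

end

theory Submission
  imports Defs
begin

text \<open>
  Write \<open>\<phi> = w powr (1 / p)\<close>, so that \<open>f\<close> lies in \<open>L\<^sup>p(\<mu>)\<close> iff \<open>\<phi> f\<close> lies in \<open>L\<^sup>p(dx)\<close>.
  The regularity condition gives \<open>\<phi> > 0\<close> a.e. and, by Young's inequality, \<open>L\<^sup>p(\<mu>) \<subseteq> L\<^sup>1\<^sub>l\<^sub>o\<^sub>c(dx)\<close>. All three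
  spaces are shown to consist of the functions \<open>u\<close> such that \<open>\<phi> u\<close> and \<open>\<phi> \<nabla>u\<close> lie in \<open>L\<^sup>p(dx)\<close>, with
  the weak gradient taken with respect to Lebesgue measure.

  \<^emph>\<open>V and W.\<close> The weight \<open>w = \<phi>\<^sup>p\<close> is weakly differentiable with gradient \<open>\<beta> w\<close>. The identity defining
  V says that \<open>f w\<close> has weak gradient \<open>(G + f \<beta>) w\<close>, which for \<open>f\<close> in W is the product rule for
  \<open>f \<sqdot> w\<close> (lemma \<open>weakd_imp_weighted\<close>). Conversely, \<open>f\<close> is recovered from the pair \<open>(f w, w)\<close> by
  applying the chain rule to \<open>s = f w / sqrt (w\<^sup>2 + \<epsilon>\<^sup>2)\<close>. The error term is
  \<open>s \<beta> \<epsilon>\<^sup>2 / (w\<^sup>2 + \<epsilon>\<^sup>2)\<close>, and since \<open>f \<beta>\<close> need not be locally integrable with respect to \<open>dx\<close>, \<open>s\<close> is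
  first truncated by \<open>T\<^sub>k(s) = k arctan(s / k)\<close>: the factor \<open>T\<^sub>k'(s) s\<close> is bounded and \<open>\<beta>\<close> itself is
  locally integrable (lemma \<open>weighted_imp_weakd\<close>).

  \<^emph>\<open>W in H.\<close> By truncation and cutoff it suffices to approximate a bounded \<open>u\<close> with compact support. Let
  \<open>\<rho>\<^sub>\<epsilon>\<close> be a mollifier. Since \<open>(\<phi> \<nabla>u) * \<rho>\<^sub>\<epsilon>\<close> converges to \<open>\<phi> \<nabla>u\<close> in \<open>L\<^sup>p\<close>, everything depends on the commutator
  \<open>\<phi> (\<nabla>u * \<rho>\<^sub>\<epsilon>) - (\<phi> \<nabla>u) * \<rho>\<^sub>\<epsilon>\<close>. An integration by parts, as in the work of DiPerna and Lions, moves the derivative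
  from \<open>u\<close> to the other factors: the commutator at \<open>x\<close> equals
  \<open>((u \<nabla>\<phi>) * \<rho>\<^sub>\<epsilon>)(x) + \<integral> (\<phi>(x) - \<phi>(z)) u(z) (\<nabla>\<rho>\<^sub>\<epsilon>)(x - z) dz\<close>. The norm of \<open>\<nabla>\<rho>\<^sub>\<epsilon>\<close> in \<open>L\<^sup>1\<close> is of order \<open>1 / \<epsilon>\<close>, which is compensated by
  the translation estimate \<open>\<parallel>\<phi> - \<phi>(\<sqdot> - y)\<parallel>\<^sub>p \<le> |y| \<parallel>\<nabla>\<phi>\<parallel>\<^sub>p\<close>, so the commutator is bounded in \<open>L\<^sup>p\<close> by a multiple of
  \<open>sup |u| \<parallel>\<nabla>\<phi>\<parallel>\<^sub>p\<close>, uniformly in \<open>\<epsilon>\<close> (lemma \<open>pint_commut_le\<close>). If \<open>\<phi>\<close> is replaced by a test function \<open>\<Phi>\<close>, then the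
  commutator is uniformly bounded and tends to zero in \<open>L\<^sup>1\<close>, hence also in \<open>L\<^sup>p\<close> (lemma
  \<open>pint_commut_test_tendsto_0\<close>). Choosing \<open>\<Phi>\<close> close to \<open>\<phi>\<close> in the Sobolev norm gives convergence to zero for \<open>\<phi>\<close>
  itself (lemma \<open>weighted_mollify\<close>). This works for every \<open>p \<ge> 1\<close>.

  \<^emph>\<open>H in W.\<close> A sequence that is Cauchy in \<open>L\<^sup>p(\<mu>)\<close> has a subsequence that converges a.e. below a majorant in
  \<open>L\<^sup>p(\<mu>)\<close>. The majorant is locally integrable with respect to \<open>dx\<close>, so weak gradients pass to the limit by
  dominated convergence.

  Up to the last two sections all functions are Borel measurable and all integrals are taken with respect to
  \<^term>\<open>lborel\<close>; this makes Fubini's theorem for convolutions available. Functions that are only Lebesgue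
  measurable are replaced by Borel versions at the end.
\<close>

section \<open>Smooth functions with compact support\<close>

lemma partial_deriv_eq:
  "(f has_derivative D) (at x) \<Longrightarrow> partial_deriv i f x = D (axis i 1)"
  unfolding partial_deriv_def using frechet_derivative_at by metis

lemma has_derivative_partial_deriv:
  fixes f :: "real ^ 'n::finite \<Rightarrow> real"
  assumes "f differentiable (at x)"
  shows "(f has_derivative (\<lambda>h. \<Sum>i\<in>UNIV. h $ i * partial_deriv i f x)) (at x)"
proof -
  have d: "(f has_derivative frechet_derivative f (at x)) (at x)"
    using assms frechet_derivative_works by blast
  have "frechet_derivative f (at x) h = (\<Sum>i\<in>UNIV. h $ i * partial_deriv i f x)" for h
  proof -
    interpret L: linear "frechet_derivative f (at x)"
      using d has_derivative_linear by blast
    have "frechet_derivative f (at x) h = frechet_derivative f (at x) (\<Sum>i\<in>UNIV. h $ i *\<^sub>R axis i 1)"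
      using basis_expansion[of h] by (simp add: scalar_mult_eq_scaleR)
    then show ?thesis
      by (simp add: L.sum L.scaleR partial_deriv_def)
  qed
  then have "frechet_derivative f (at x) = (\<lambda>h. \<Sum>i\<in>UNIV. h $ i * partial_deriv i f x)" by blast
  with d show ?thesis by metis
qed

lemma Ck_SucD: "Ck (Suc k) f \<Longrightarrow> Ck k f"
proof (induction k arbitrary: f)
  case 0
  then show ?case
    by (auto intro: differentiable_imp_continuous_on simp: differentiable_on_def)
next
  case (Suc k)
  then show ?case by simp
qed

lemma Ck_mono: "Ck k f \<Longrightarrow> l \<le> k \<Longrightarrow> Ck l f"
  by (induction k) (auto simp: le_Suc_eq dest: Ck_SucD simp del: Ck.simps(2))

lemma Ck_continuous: "Ck k f \<Longrightarrow> continuous_on UNIV f"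
  using Ck_mono[of k f 0] by simp

lemma Ck_const: "Ck k (\<lambda>x::real ^ 'n::finite. c)"
proof (induction k arbitrary: c)
  case (Suc k)
  have "partial_deriv i (\<lambda>x::real ^ 'n. c) = (\<lambda>x. 0)" for i
    by (rule ext) (auto intro!: partial_deriv_eq[THEN trans] derivative_eq_intros)
  then show ?case using Suc by simp
qed simp

lemma Ck_component: "Ck k (\<lambda>x::real ^ 'n::finite. x $ j)"
proof (cases k)
  case (Suc l)
  have "partial_deriv i (\<lambda>x::real ^ 'n. x $ j) = (\<lambda>x. axis i 1 $ j)" for i
    by (rule ext, rule partial_deriv_eq) (rule bounded_linear_imp_has_derivative[OF bounded_linear_vec_nth])
  moreover have "(\<lambda>x. x $ j) differentiable (at x)" for x :: "real ^ 'n"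
    by (rule bounded_linear_imp_differentiable) (rule bounded_linear_vec_nth)
  ultimately show ?thesis using Suc by (simp add: Ck_const)
qed (auto intro!: continuous_intros)

lemma Ck_add: "Ck k f \<Longrightarrow> Ck k g \<Longrightarrow> Ck k (\<lambda>x. f x + g x)"
proof (induction k arbitrary: f g)
  case 0 then show ?case by (auto intro!: continuous_intros)
next
  case (Suc k)
  have "partial_deriv i (\<lambda>x. f x + g x) = (\<lambda>x. partial_deriv i f x + partial_deriv i g x)" for i
    by (rule ext, rule partial_deriv_eq[THEN trans], rule has_derivative_add;
        (rule has_derivative_partial_deriv)?)
       (use Suc.prems in \<open>auto simp: axis_def if_distrib if_distribR cong: if_cong\<close>)
  then show ?case using Suc by auto
qed

lemma partial_deriv_mult:
  assumes "f differentiable (at x)" "g differentiable (at x)"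
  shows "partial_deriv i (\<lambda>x. f x * g x) x = f x * partial_deriv i g x + partial_deriv i f x * g x"
  using assms unfolding frechet_derivative_works
  by (intro partial_deriv_eq[THEN trans], rule has_derivative_mult) (auto simp: partial_deriv_def)

lemma Ck_mult: "Ck k f \<Longrightarrow> Ck k g \<Longrightarrow> Ck k (\<lambda>x. f x * g x)"
proof (induction k arbitrary: f g)
  case 0 then show ?case by (auto intro!: continuous_intros)
next
  case (Suc k)
  have "partial_deriv i (\<lambda>x. f x * g x) = (\<lambda>x. f x * partial_deriv i g x + partial_deriv i f x * g x)" for i
    using Suc.prems by (auto simp: partial_deriv_mult)
  then show ?case using Suc Ck_SucD[OF Suc.prems(1)] Ck_SucD[OF Suc.prems(2)]
    by (auto intro!: Ck_add)
qed

lemma partial_deriv_affine: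
  assumes "f differentiable (at (a + c *\<^sub>R x))"
  shows "partial_deriv i (\<lambda>x. f (a + c *\<^sub>R x)) x = c * partial_deriv i f (a + c *\<^sub>R x)"
proof -
  have d: "(f has_derivative frechet_derivative f (at (a + c *\<^sub>R x))) (at (a + c *\<^sub>R x))"
    using assms frechet_derivative_works by blast
  have "((\<lambda>x. f (a + c *\<^sub>R x)) has_derivative (\<lambda>h. frechet_derivative f (at (a + c *\<^sub>R x)) (c *\<^sub>R h))) (at x)"
    by (rule has_derivative_compose[where f = "\<lambda>x. a + c *\<^sub>R x" and g = f, OF _ d])
      (auto intro!: derivative_eq_intros)
  from partial_deriv_eq[OF this] show ?thesis
    using linear_cmul[OF has_derivative_linear[OF d]] by (simp add: partial_deriv_def)
qed

lemma differentiable_affine: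
  assumes "f differentiable (at (a + c *\<^sub>R x))"
  shows "(\<lambda>x. f (a + c *\<^sub>R x)) differentiable (at x)"
  using differentiable_chain_at[of "\<lambda>x. a + c *\<^sub>R x" x f] assms by (simp add: o_def)

lemma Ck_affine: "Ck k f \<Longrightarrow> Ck k (\<lambda>x. f (a + c *\<^sub>R x))"
proof (induction k arbitrary: f)
  case 0
  then show ?case by (auto intro!: continuous_intros continuous_on_compose2[of UNIV f])
next
  case (Suc k)
  have "partial_deriv i (\<lambda>x. f (a + c *\<^sub>R x)) = (\<lambda>x. c * partial_deriv i f (a + c *\<^sub>R x))" for i
    using Suc.prems by (auto intro!: partial_deriv_affine)
  then show ?case using Suc by (auto intro!: Ck_mult Ck_const differentiable_affine)
qed

text \<open>\<open>f\<close> vanishes outside the closed ball of radius \<open>R\<close> about the origin (everywhere, not just almost everywhere).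
  This is the form in which compact support is used.\<close>

definition supp_ball :: "real \<Rightarrow> ('a::real_normed_vector \<Rightarrow> 'b::zero) \<Rightarrow> bool" where
  "supp_ball R f \<longleftrightarrow> (\<forall>x. R < norm x \<longrightarrow> f x = 0)"

lemma supp_ballD: "supp_ball R f \<Longrightarrow> R < norm x \<Longrightarrow> f x = 0"
  by (simp add: supp_ball_def)

lemma supp_ball_mono: "supp_ball R f \<Longrightarrow> R \<le> S \<Longrightarrow> supp_ball S f"
  by (auto simp: supp_ball_def)

lemma test_functions_iff: "f \<in> test_functions \<longleftrightarrow> (\<forall>k. Ck k f) \<and> (\<exists>R. supp_ball R f)"
proof -
  have "compact (closure {x. f x \<noteq> 0}) \<longleftrightarrow> (\<exists>R. supp_ball R f)"
    unfolding compact_closure bounded_iff supp_ball_def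
    by (auto simp: not_less[symmetric])
  then show ?thesis by (simp add: test_functions_def)
qed

lemma test_functionsD:
  assumes "f \<in> test_functions"
  shows "Ck k f" "continuous_on UNIV f" "f differentiable (at x)" "\<exists>R>0. supp_ball R f"
proof -
  show "Ck k f" "continuous_on UNIV f" using assms by (auto simp: test_functions_iff intro: Ck_continuous)
  have "Ck (Suc 0) f" using assms by (simp only: test_functions_iff)
  then show "f differentiable (at x)" by simp
  obtain R where "supp_ball R f" using assms by (auto simp: test_functions_iff)
  then show "\<exists>R>0. supp_ball R f"
    by (intro exI[of _ "max 1 R"]) (auto simp: supp_ball_def)
qed

lemma supp_ball_partial_deriv:
  assumes "supp_ball R f"
  shows "supp_ball R (partial_deriv i f)"
  unfolding supp_ball_def
proof safe
  fix x :: "real ^ 'a" assume x: "R < norm x"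
  have "((\<lambda>x. 0) has_derivative (\<lambda>h. 0)) (at x)" by auto
  moreover have "open {x::real ^ 'a. R < norm x}"
    by (intro open_Collect_less continuous_intros)
  ultimately have "(f has_derivative (\<lambda>h. 0)) (at x)"
    by (rule has_derivative_transform_within_open) (use assms x in \<open>auto simp: supp_ball_def\<close>)
  then show "partial_deriv i f x = 0" by (rule partial_deriv_eq)
qed

lemma test_functions_partial_deriv: "f \<in> test_functions \<Longrightarrow> partial_deriv i f \<in> test_functions"
  unfolding test_functions_iff using supp_ball_partial_deriv by (metis Ck.simps(2))

lemma test_functions_mult:
  "f \<in> test_functions \<Longrightarrow> (\<And>k. Ck k g) \<Longrightarrow> (\<lambda>x. f x * g x) \<in> test_functions"
  unfolding test_functions_iff supp_ball_def using Ck_mult by (metis mult_zero_left)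

lemma test_functions_affine:
  assumes "f \<in> test_functions" "c \<noteq> 0"
  shows "(\<lambda>x. f (a + c *\<^sub>R x)) \<in> test_functions"
proof -
  obtain R where R: "supp_ball R f" using assms by (auto simp: test_functions_iff)
  have "f (a + c *\<^sub>R x) = 0" if "(R + norm a) / \<bar>c\<bar> < norm x" for x
  proof -
    have "R + norm a < norm (c *\<^sub>R x)" using that assms(2) by (simp add: field_simps)
    also have "\<dots> \<le> norm (a + c *\<^sub>R x) + norm a"
      using norm_triangle_ineq4[of "a + c *\<^sub>R x" a] by simp
    finally show ?thesis using R by (auto simp: supp_ball_def)
  qed
  then show ?thesis using assms by (auto simp: test_functions_iff supp_ball_def intro!: Ck_affine)
qed

lemma test_functions_reflect: "f \<in> test_functions \<Longrightarrow> (\<lambda>z. f (x - z)) \<in> test_functions"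
  using test_functions_affine[of f "-1" x] by simp

lemma partial_deriv_reflect:
  "f differentiable (at (x - z)) \<Longrightarrow> partial_deriv i (\<lambda>z. f (x - z)) z = - partial_deriv i f (x - z)"
  using partial_deriv_affine[of f x "-1" z i] by simp

text \<open>The functions \<open>exp(-1/t) / t\<^sup>n\<close>, extended by zero to \<open>t \<le> 0\<close>. The family over all \<open>n\<close> is closed under
  differentiation up to linear combinations, which makes smoothness of the bump function an induction.\<close>

definition expinv :: "nat \<Rightarrow> real \<Rightarrow> real" where
  "expinv n t = (if 0 < t then exp (- (1 / t)) / t ^ n else 0)"

lemma tendsto_expinv_0: "(expinv n \<longlongrightarrow> 0) (at 0)"
proof -
  have "((\<lambda>s::real. s ^ n / exp s) \<longlongrightarrow> 0) at_top" by (rule tendsto_power_div_exp_0)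
  then have "((\<lambda>t::real. (inverse t) ^ n / exp (inverse t)) \<longlongrightarrow> 0) (at_right 0)"
    by (rule filterlim_compose[OF _ filterlim_inverse_at_top_right])
  then have 1: "(expinv n \<longlongrightarrow> 0) (at_right 0)"
    by (rule Lim_transform_eventually)
      (auto simp: expinv_def eventually_at_filter exp_minus field_simps)
  have "((\<lambda>t. 0) \<longlongrightarrow> (0::real)) (at_left (0::real))" by simp
  then have 2: "(expinv n \<longlongrightarrow> 0) (at_left 0)"
    by (rule Lim_transform_eventually) (auto simp: expinv_def eventually_at_filter)
  from 1 2 show ?thesis using filterlim_split_at by blast
qed

lemma DERIV_expinv:
  "(expinv n has_real_derivative (expinv (n + 2) t - real n * expinv (n + 1) t)) (at t)"
proof (cases t "0::real" rule: linorder_cases)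
  case less
  have "((\<lambda>t. 0) has_real_derivative 0) (at t)" by simp
  then have "(expinv n has_real_derivative 0) (at t)"
    by (rule has_field_derivative_transform_within_open[where S = "{..<0}"])
      (use less in \<open>auto simp: expinv_def\<close>)
  then show ?thesis using less by (simp add: expinv_def)
next
  case equal
  have "((\<lambda>h. (expinv n (0 + h) - expinv n 0) / h) \<longlongrightarrow> 0) (at 0)"
    by (rule Lim_transform_eventually[OF tendsto_expinv_0[of "Suc n"]])
       (auto simp: expinv_def eventually_at_filter field_simps)
  then show ?thesis using equal by (simp add: DERIV_def expinv_def)
next
  case greater
  have "((\<lambda>t. exp (- (1 / t)) / t ^ n) has_real_derivative (expinv (n + 2) t - real n * expinv (n + 1) t)) (at t)"
  proof (cases n)
    case (Suc m)
    have "((\<lambda>t. exp (- (1 / t)) / t ^ n) has_real_derivative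
       ((exp (- (1 / t)) * (1 / t\<^sup>2)) * t ^ n - exp (- (1 / t)) * (real n * t ^ (n - 1))) / (t ^ n * t ^ n)) (at t)"
      using greater by (auto intro!: derivative_eq_intros simp: power2_eq_square)
    then show ?thesis using greater Suc
      by (auto simp: expinv_def diff_divide_distrib power2_eq_square elim!: DERIV_cong)
  qed (use greater in \<open>auto intro!: derivative_eq_intros simp: expinv_def field_simps power2_eq_square\<close>)
  then show ?thesis
    by (rule has_field_derivative_transform_within_open[where S = "{0<..}"])
      (use greater in \<open>auto simp: expinv_def\<close>)
qed

text \<open>The standard bump function \<open>exp(-1 / (1 - |x|\<^sup>2))\<close>, supported in the closed unit ball. The coordinates of \<open>x\<close> are
  written out so that iterated partial derivatives can be computed.\<close>

definition bump :: "real ^ 'n::finite \<Rightarrow> real" where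
  "bump x = expinv 0 (1 - (\<Sum>j\<in>UNIV. x $ j * x $ j))"

lemma Ck_expinv_sphere: "Ck k (\<lambda>x::real ^ 'n::finite. expinv n (1 - (\<Sum>j\<in>UNIV. x $ j * x $ j)))"
proof (induction k arbitrary: n)
  have d: "((\<lambda>x::real ^ 'n::finite. expinv n (1 - (\<Sum>j\<in>UNIV. x $ j * x $ j))) has_derivative
     (\<lambda>h. (expinv (n + 2) (1 - (\<Sum>j\<in>UNIV. x $ j * x $ j)) -
       real n * expinv (n + 1) (1 - (\<Sum>j\<in>UNIV. x $ j * x $ j))) * - (\<Sum>j\<in>UNIV. x $ j * h $ j + h $ j * x $ j))) (at x)"
    for x n
    by (rule has_derivative_compose[OF _ DERIV_expinv[unfolded has_field_derivative_def]])
      (auto intro!: derivative_eq_intros bounded_linear_imp_has_derivative bounded_linear_vec_nth simp: sum_negf algebra_simps)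
  {
    case 0
    show ?case using has_derivative_continuous[OF d] by (simp add: continuous_at_imp_continuous_on)
  next
    case (Suc k)
    have e: "partial_deriv i (\<lambda>x::real ^ 'n::finite. expinv n (1 - (\<Sum>j\<in>UNIV. x $ j * x $ j))) =
      (\<lambda>x. (expinv (n + 2) (1 - (\<Sum>j\<in>UNIV. x $ j * x $ j)) +
       (- real n) * expinv (n + 1) (1 - (\<Sum>j\<in>UNIV. x $ j * x $ j))) * (- 2 * x $ i))" for i
      by (rule ext, rule partial_deriv_eq[THEN trans, OF d])
        (auto simp: axis_def if_distrib if_distribR sum.distrib cong: if_cong)
    have "\<forall>x. (\<lambda>x::real ^ 'n::finite. expinv n (1 - (\<Sum>j\<in>UNIV. x $ j * x $ j))) differentiable (at x)"
      using d differentiableI by blast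
    then show ?case unfolding Ck.simps e
      using Suc by (intro conjI allI Ck_mult Ck_add Ck_const Ck_component) auto
  }
qed

lemma bump_eq: "bump x = expinv 0 (1 - norm x ^ 2)"
  unfolding bump_def by (simp add: power2_norm_eq_inner inner_vec_def)

lemma bump_test: "(bump :: real ^ 'n::finite \<Rightarrow> real) \<in> test_functions"
proof -
  have "supp_ball 1 (bump :: real ^ 'n::finite \<Rightarrow> real)"
    by (auto simp: supp_ball_def bump_eq expinv_def abs_square_less_1 dest: less_imp_le)
  then show ?thesis by (auto simp: test_functions_iff bump_def[abs_def] Ck_expinv_sphere)
qed

lemma bump_nonneg: "0 \<le> bump x" by (auto simp: bump_eq expinv_def)
lemma supp_ball_bump: "supp_ball 1 bump"
  by (auto simp: supp_ball_def bump_eq expinv_def abs_square_less_1 dest: less_imp_le)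
section \<open>Integration by parts and convolution\<close>

lemma nn_integral_lborel_affine:
  fixes f :: "'a::euclidean_space \<Rightarrow> ennreal"
  assumes [measurable]: "f \<in> borel_measurable borel" and "c \<noteq> 0"
  shows "(\<integral>\<^sup>+x. f (t + c *\<^sub>R x) \<partial>lborel) = ennreal (1 / \<bar>c\<bar> ^ DIM('a)) * (\<integral>\<^sup>+x. f x \<partial>lborel)"
proof -
  have "(\<integral>\<^sup>+x. f x \<partial>lborel) = ennreal (\<bar>c\<bar> ^ DIM('a)) * (\<integral>\<^sup>+x. f (t + c *\<^sub>R x) \<partial>lborel)"
    by (subst lborel_affine[OF assms(2), of t])
       (simp add: nn_integral_density nn_integral_distr nn_integral_cmult)
  then have "ennreal (1 / \<bar>c\<bar> ^ DIM('a)) * (\<integral>\<^sup>+x. f x \<partial>lborel) =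
     (ennreal (1 / \<bar>c\<bar> ^ DIM('a)) * ennreal (\<bar>c\<bar> ^ DIM('a))) * (\<integral>\<^sup>+x. f (t + c *\<^sub>R x) \<partial>lborel)"
    by (simp add: mult.assoc)
  also have "ennreal (1 / \<bar>c\<bar> ^ DIM('a)) * ennreal (\<bar>c\<bar> ^ DIM('a)) = 1"
    using assms(2) by (subst ennreal_mult[symmetric]) auto
  finally show ?thesis by simp
qed

lemma nn_integral_lborel_reflect:
  fixes f :: "'a::euclidean_space \<Rightarrow> ennreal"
  assumes "f \<in> borel_measurable borel"
  shows "(\<integral>\<^sup>+z. f (x - z) \<partial>lborel) = (\<integral>\<^sup>+x. f x \<partial>lborel)"
  using nn_integral_lborel_affine[OF assms, of "-1" x] by simp

lemma nn_integral_lborel_shift: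
  fixes f :: "'a::euclidean_space \<Rightarrow> ennreal"
  assumes "f \<in> borel_measurable borel"
  shows "(\<integral>\<^sup>+x. f (x - z) \<partial>lborel) = (\<integral>\<^sup>+x. f x \<partial>lborel)"
  using nn_integral_lborel_affine[OF assms, of 1 "-z"] by simp

lemma integral_lborel_affine:
  fixes f :: "'a::euclidean_space \<Rightarrow> real"
  assumes [measurable]: "f \<in> borel_measurable borel" and "c \<noteq> 0"
  shows "(\<integral>x. f (t + c *\<^sub>R x) \<partial>lborel) = (\<integral>x. f x \<partial>lborel) / \<bar>c\<bar> ^ DIM('a)"
proof -
  have "(\<integral>x. f x \<partial>lborel) = \<bar>c\<bar> ^ DIM('a) * (\<integral>x. f (t + c *\<^sub>R x) \<partial>lborel)"
    by (subst lborel_affine[OF assms(2), of t])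
       (simp add: integral_density integral_distr)
  then show ?thesis using assms(2) by (simp add: field_simps)
qed

lemma integral_lborel_reflect:
  fixes f :: "'a::euclidean_space \<Rightarrow> real"
  assumes "f \<in> borel_measurable borel"
  shows "(\<integral>z. f (x - z) \<partial>lborel) = (\<integral>x. f x \<partial>lborel)"
  using integral_lborel_affine[OF assms, of "-1" x] by simp

lemma borel_measurable_continuous: "continuous_on UNIV f \<Longrightarrow> f \<in> borel_measurable borel"
  by (rule borel_measurable_continuous_onI)

lemma supp_ball_bounded:
  fixes f :: "'a::euclidean_space \<Rightarrow> real"
  assumes "continuous_on UNIV f" "supp_ball R f"
  shows "\<exists>M>0. \<forall>x. \<bar>f x\<bar> \<le> M"
proof -
  have "compact (f ` cball 0 R)"
    using assms(1) by (intro compact_continuous_image) (auto intro: continuous_on_subset)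
  then obtain M where M: "M > 0" "\<And>x. x \<in> cball 0 R \<Longrightarrow> \<bar>f x\<bar> \<le> M"
    by (auto dest!: compact_imp_bounded simp: bounded_pos)
  have "\<bar>f x\<bar> \<le> M" for x
    using M(2)[of x] M(1) supp_ballD[OF assms(2), of x] by (cases "norm x \<le> R") auto
  with M(1) show ?thesis by blast
qed

lemma cball_sets_borel [measurable, simp]: "cball (x::'a::euclidean_space) r \<in> sets borel"
  by (rule borel_closed) simp

lemma pred_cball [measurable]: "Measurable.pred borel (\<lambda>y. y \<in> cball (x::'a::euclidean_space) r)"
  by (rule pred_sets2[where N = borel]) auto

lemma integrable_indicator_cball:
  "integrable lborel (indicator (cball 0 R) :: 'a::euclidean_space \<Rightarrow> real)"
  by (intro integrable_real_indicator emeasure_bounded_finite) auto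

lemma integrable_bounded_supp:
  fixes f :: "'a::euclidean_space \<Rightarrow> real"
  assumes [measurable]: "f \<in> borel_measurable borel" and "\<And>x. \<bar>f x\<bar> \<le> M" "supp_ball R f"
  shows "integrable lborel f"
proof (rule Bochner_Integration.integrable_bound)
  show "integrable lborel (\<lambda>x::'a. M * indicator (cball 0 R) x)"
    by (intro integrable_mult_right integrable_indicator_cball)
  show "AE x in lborel. norm (f x) \<le> norm (M * indicator (cball 0 R) x)"
    using assms(2,3) by (intro AE_I2)
      (auto simp: supp_ball_def indicator_def not_le intro: order_trans[OF assms(2) abs_ge_self])
qed auto

lemma integrable_continuous_supp:
  fixes f :: "'a::euclidean_space \<Rightarrow> real"
  assumes "continuous_on UNIV f" "supp_ball R f"
  shows "integrable lborel f"
  using supp_ball_bounded[OF assms] assms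
  by (auto intro: integrable_bounded_supp borel_measurable_continuous)

lemma uniformly_continuous_supp:
  fixes f :: "'a::euclidean_space \<Rightarrow> real"
  assumes "continuous_on UNIV f" "supp_ball R f" "e > 0"
  shows "\<exists>d>0. d \<le> 1 \<and> (\<forall>x y. norm (x - y) < d \<longrightarrow> \<bar>f x - f y\<bar> < e)"
proof -
  have "uniformly_continuous_on (cball 0 (R + 1)) f"
    using assms(1) by (intro compact_uniformly_continuous) (auto intro: continuous_on_subset)
  then obtain d where d: "d > 0" "\<And>x y. x \<in> cball 0 (R + 1) \<Longrightarrow> y \<in> cball 0 (R + 1) \<Longrightarrow> dist x y < d \<Longrightarrow> dist (f x) (f y) < e"
    using assms(3) unfolding uniformly_continuous_on_def by metis
  have "\<bar>f x - f y\<bar> < e" if xy: "norm (x - y) < min 1 d" for x y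
  proof (cases "norm x \<le> R + 1 \<and> norm y \<le> R + 1")
    case True
    then show ?thesis using d(2)[of x y] xy by (auto simp: dist_norm)
  next
    case False
    then have "R < norm x" "R < norm y"
      using xy norm_triangle_ineq3[of x y] by auto
    then show ?thesis using assms(2,3) by (simp add: supp_ball_def)
  qed
  then show ?thesis using d(1) by (intro exI[of _ "min 1 d"]) auto
qed

lemma C1_line_derivative:
  fixes f :: "real ^ 'n::finite \<Rightarrow> real"
  assumes "\<And>x. f differentiable (at x)"
  shows "((\<lambda>t. f (x + t *\<^sub>R h)) has_real_derivative
     (\<Sum>i\<in>UNIV. h $ i * partial_deriv i f (x + t *\<^sub>R h))) (at t)"
proof -
  have "((\<lambda>t. f (x + t *\<^sub>R h)) has_derivative (\<lambda>s. \<Sum>i\<in>UNIV. (s *\<^sub>R h) $ i * partial_deriv i f (x + t *\<^sub>R h))) (at t)"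
    by (rule has_derivative_compose[where f = "\<lambda>t. x + t *\<^sub>R h" and g = f, OF _ has_derivative_partial_deriv[OF assms]])
      (auto intro!: derivative_eq_intros)
  moreover have "(\<lambda>s. \<Sum>i\<in>UNIV. (s *\<^sub>R h) $ i * partial_deriv i f (x + t *\<^sub>R h)) =
     (*) (\<Sum>i\<in>UNIV. h $ i * partial_deriv i f (x + t *\<^sub>R h))"
    by (auto simp: fun_eq_iff sum_distrib_left mult_ac)
  ultimately show ?thesis
    by (simp only: has_field_derivative_def)
qed

lemma C1_mvt:
  fixes f :: "real ^ 'n::finite \<Rightarrow> real"
  assumes "\<And>x. f differentiable (at x)"
  shows "\<exists>t. 0 < t \<and> t < 1 \<and> f (x + h) - f x = (\<Sum>i\<in>UNIV. h $ i * partial_deriv i f (x + t *\<^sub>R h))"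
  using MVT2[of 0 1 "\<lambda>t. f (x + t *\<^sub>R h)" "\<lambda>t. \<Sum>i\<in>UNIV. h $ i * partial_deriv i f (x + t *\<^sub>R h)"]
    C1_line_derivative[OF assms] by auto

text \<open>Integration by parts reduces to this statement. It follows from translation invariance of the
  integral: the integral of every difference quotient vanishes.\<close>

lemma integral_partial_deriv_eq_0:
  fixes f :: "real ^ 'n::finite \<Rightarrow> real"
  assumes f: "Ck (Suc 0) f" and R: "supp_ball R f"
  shows "(\<integral>x. partial_deriv i f x \<partial>lborel) = 0"
proof -
  have diff: "\<And>x. f differentiable (at x)" and cont: "continuous_on UNIV (partial_deriv i f)"
    using f by auto
  have cf: "continuous_on UNIV f" using Ck_continuous[OF f] .
  note [measurable] = borel_measurable_continuous[OF cf] borel_measurable_continuous[OF cont]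
  obtain M where M: "\<And>x. \<bar>partial_deriv i f x\<bar> \<le> M"
    using supp_ball_bounded[OF cont supp_ball_partial_deriv[OF R]] by blast
  \<comment> \<open>The difference quotients \<open>q n\<close> of step \<open>a n\<close> are bounded by the mean value theorem.\<close>
  define a where "a n = inverse (real (Suc n))" for n
  define q where "q n x = (f (x + a n *\<^sub>R axis i 1) - f x) / a n" for n x
  have a: "a n > 0" "a n \<le> 1" for n by (auto simp: a_def field_simps)
  have [measurable]: "q n \<in> borel_measurable borel" for n
    unfolding q_def by measurable
  have bd: "\<bar>q n x\<bar> \<le> M * indicator (cball 0 (R + 1)) x" for n x
  proof (cases "norm x \<le> R + 1")
    case True
    obtain t where "f (x + a n *\<^sub>R axis i 1) - f x = (\<Sum>j\<in>UNIV. (a n *\<^sub>R axis i 1) $ j * partial_deriv j f (x + t *\<^sub>R (a n *\<^sub>R axis i 1)))"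
      using C1_mvt[OF diff] by blast
    then have "q n x = partial_deriv i f (x + t *\<^sub>R (a n *\<^sub>R axis i 1))"
      using a[of n] by (simp add: q_def axis_def if_distrib if_distribR cong: if_cong)
    then show ?thesis using M True by simp
  next
    case False
    have "norm x \<le> norm (x + a n *\<^sub>R axis i 1) + norm (a n *\<^sub>R axis i (1::real))"
      by (metis add_diff_cancel_right' norm_triangle_ineq4)
    then have "R < norm (x + a n *\<^sub>R axis i 1)" using False a[of n] by (auto simp: norm_axis_1)
    then show ?thesis using False R by (simp add: q_def supp_ball_def)
  qed
  have lim: "(\<lambda>n. q n x) \<longlonglongrightarrow> partial_deriv i f x" for x
  proof -
    have "((\<lambda>t. f (x + t *\<^sub>R axis i 1)) has_real_derivative partial_deriv i f x) (at 0)"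
      using C1_line_derivative[OF diff, of x "axis i 1" 0]
      by (simp add: axis_def if_distrib if_distribR cong: if_cong)
    then have "((\<lambda>h. (f (x + h *\<^sub>R axis i 1) - f x) / h) \<longlongrightarrow> partial_deriv i f x) (at 0)"
      by (simp add: DERIV_def)
    moreover have "filterlim a (at 0) sequentially"
      unfolding filterlim_at using a LIMSEQ_inverse_real_of_nat by (auto simp: a_def[abs_def] less_imp_neq[symmetric])
    ultimately show ?thesis unfolding q_def by (rule filterlim_compose)
  qed
  have int: "integrable lborel (\<lambda>x. M * indicator (cball 0 (R + 1)) x :: real)"
    by (intro integrable_mult_right integrable_indicator_cball)
  have "(\<lambda>n. \<integral>x. q n x \<partial>lborel) \<longlonglongrightarrow> (\<integral>x. partial_deriv i f x \<partial>lborel)"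
    by (rule integral_dominated_convergence[OF _ _ int]) (use lim bd in auto)
  moreover have "(\<integral>x. q n x \<partial>lborel) = 0" for n
  proof -
    have i: "integrable lborel f" by (rule integrable_continuous_supp[OF cf R])
    have "integrable lborel (\<lambda>x. f (x + a n *\<^sub>R axis i 1))"
      using i lborel_integrable_real_affine
      by (subst (asm) lborel_distr_plus[of "a n *\<^sub>R axis i 1", symmetric])
         (auto simp: integrable_distr_eq add.commute)
    moreover have "(\<integral>x. f (x + a n *\<^sub>R axis i 1) \<partial>lborel) = (\<integral>x. f x \<partial>lborel)"
      using integral_lborel_affine[of f 1 "a n *\<^sub>R axis i 1"] by (simp add: add.commute)
    ultimately show ?thesis using i by (simp add: q_def)
  qed
  ultimately show ?thesis by (simp add: LIMSEQ_const_iff)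
qed

text \<open>Borel functions that are integrable over every ball.\<close>

definition locint :: "('a::euclidean_space \<Rightarrow> real) \<Rightarrow> bool" where
  "locint f \<longleftrightarrow> f \<in> borel_measurable borel \<and> (\<forall>R. integrable lborel (\<lambda>x. indicator (cball 0 R) x * f x))"

lemma locint_measurable: "locint f \<Longrightarrow> f \<in> borel_measurable borel"
  by (simp add: locint_def)

lemma locint_bound:
  fixes f g :: "'a::euclidean_space \<Rightarrow> real"
  assumes "locint f" and g: "g \<in> borel_measurable borel"
    and le: "AE x in lborel. \<bar>g x\<bar> \<le> \<bar>f x\<bar>"
  shows "locint g"
  unfolding locint_def
proof safe
  fix R
  note [measurable] = locint_measurable[OF assms(1)] g
  have "integrable lborel (\<lambda>x. indicator (cball 0 R) x * f x)" using assms(1) by (simp add: locint_def)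
  then show "integrable lborel (\<lambda>x. indicator (cball 0 R) x * g x)"
  proof (rule Bochner_Integration.integrable_bound)
    show "AE x in lborel. norm (indicator (cball 0 R) x * g x) \<le> norm (indicator (cball 0 R) x * f x)"
      using le by eventually_elim (auto simp: indicator_def)
    show "(\<lambda>x. indicator (cball 0 R) x * g x) \<in> borel_measurable lborel"
      by (intro borel_measurable_times borel_measurable_indicator) (use g in auto)
  qed
qed (rule assms(2))

lemma locint_add: "locint f \<Longrightarrow> locint g \<Longrightarrow> locint (\<lambda>x. f x + g x)"
  by (auto simp: locint_def distrib_left)

lemma locint_abs: "locint f \<Longrightarrow> locint (\<lambda>x. \<bar>f x\<bar>)"
  by (rule locint_bound) (auto simp: locint_def)

lemma locint_cmult: "locint f \<Longrightarrow> locint (\<lambda>x. c * f x)"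
  by (auto simp: locint_def mult.left_commute)

lemma locint_diff: "locint f \<Longrightarrow> locint g \<Longrightarrow> locint (\<lambda>x. f x - g x)"
  using locint_add[of f "\<lambda>x. (-1) * g x"] locint_cmult[of g "-1"] by simp

lemma locint_continuous:
  fixes f :: "'a::euclidean_space \<Rightarrow> real"
  assumes "continuous_on UNIV f" shows "locint f"
  unfolding locint_def
proof safe
  show "f \<in> borel_measurable borel" by (rule borel_measurable_continuous[OF assms])
  fix R show "integrable lborel (\<lambda>x. indicator (cball 0 R) x * f x)"
    using borel_integrable_compact[of "cball 0 R" f] assms by (auto intro: continuous_on_subset)
qed

lemma locint_mult_bounded:
  assumes "locint f" and [measurable]: "g \<in> borel_measurable borel" and "AE x in lborel. \<bar>g x\<bar> \<le> M"
  shows "locint (\<lambda>x. g x * f x)"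
proof (rule locint_bound[OF locint_cmult[OF assms(1), of M]])
  note [measurable] = locint_measurable[OF assms(1)]
  show "(\<lambda>x. g x * f x) \<in> borel_measurable borel" by measurable
  show "AE x in lborel. \<bar>g x * f x\<bar> \<le> \<bar>M * f x\<bar>"
    using assms(3) by eventually_elim (auto simp: abs_mult intro!: mult_right_mono)
qed

lemma locint_integrable_mult:
  assumes f: "locint f" and [measurable]: "\<sigma> \<in> borel_measurable borel"
    and M: "\<And>x. \<bar>\<sigma> x\<bar> \<le> M" and R: "supp_ball R \<sigma>"
  shows "integrable lborel (\<lambda>x. f x * \<sigma> x)"
proof (rule Bochner_Integration.integrable_bound)
  note [measurable] = locint_measurable[OF f]
  show "(\<lambda>x. f x * \<sigma> x) \<in> borel_measurable lborel" by measurable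
  show "integrable lborel (\<lambda>x. M * (indicator (cball 0 R) x * f x))"
    using f by (simp add: locint_def)
  show "AE x in lborel. norm (f x * \<sigma> x) \<le> norm (M * (indicator (cball 0 R) x * f x))"
    using M R by (intro AE_I2)
      (auto simp: indicator_def supp_ball_def abs_mult not_le mult.commute[of "\<bar>f _\<bar>"] intro!: mult_right_mono order_trans[OF M])
qed

lemma locint_integrable_mult_cont:
  assumes f: "locint f" and "continuous_on UNIV \<sigma>" "supp_ball R \<sigma>"
  shows "integrable lborel (\<lambda>x. f x * \<sigma> x)"
  using supp_ball_bounded[OF assms(2,3)] assms
  by (auto intro: locint_integrable_mult borel_measurable_continuous)

lemma locint_integrable_supp:
  assumes "locint f" "supp_ball R f" shows "integrable lborel f"
proof -
  have "integrable lborel (\<lambda>x. indicator (cball 0 R) x * f x)" using assms(1) by (simp add: locint_def)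
  also have "(\<lambda>x. indicator (cball 0 R) x * f x) = f"
    using assms(2) by (auto simp: supp_ball_def indicator_def fun_eq_iff)
  finally show ?thesis .
qed

lemma integrable_imp_locint:
  fixes f :: "'a::euclidean_space \<Rightarrow> real"
  assumes "integrable lborel f" shows "locint f"
proof -
  have [measurable]: "f \<in> borel_measurable borel" using borel_measurable_integrable[OF assms] by simp
  show ?thesis unfolding locint_def
    by (auto intro!: Bochner_Integration.integrable_bound[OF assms] simp: indicator_def)
qed

lemma supp_ball_reflect:
  fixes x :: "'a::real_normed_vector"
  shows "supp_ball r \<sigma> \<Longrightarrow> supp_ball (norm x + r) (\<lambda>z. \<sigma> (x - z))"
  unfolding supp_ball_def
proof safe
  fix z :: 'a assume *: "\<forall>x. r < norm x \<longrightarrow> \<sigma> x = 0" "norm x + r < norm z"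
  have "norm z \<le> norm x + norm (x - z)" using norm_triangle_sub[of z x] by (simp add: norm_minus_commute)
  then show "\<sigma> (x - z) = 0" using * by auto
qed

text \<open>Convolution of a locally integrable function with a continuous function of compact support.\<close>

definition conv :: "('a::euclidean_space \<Rightarrow> real) \<Rightarrow> ('a \<Rightarrow> real) \<Rightarrow> 'a \<Rightarrow> real" where
  "conv f \<sigma> x = (\<integral>z. f z * \<sigma> (x - z) \<partial>lborel)"

lemma continuous_reflect: "continuous_on UNIV \<sigma> \<Longrightarrow> continuous_on UNIV (\<lambda>z. \<sigma> (x - z :: 'a::real_normed_vector))"
  by (rule continuous_on_compose2[of UNIV \<sigma>]) (auto intro!: continuous_intros)

lemma conv_integrable:
  assumes "locint f" "continuous_on UNIV \<sigma>" "supp_ball r \<sigma>"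
  shows "integrable lborel (\<lambda>z. f z * \<sigma> (x - z))"
  using assms by (intro locint_integrable_mult_cont[OF assms(1) continuous_reflect supp_ball_reflect])

lemma conv_continuous:
  assumes f: "locint f" and c: "continuous_on UNIV \<sigma>" and r: "supp_ball r \<sigma>"
  shows "continuous_on UNIV (conv f \<sigma>)"
proof (rule continuous_at_imp_continuous_on, rule ballI, rule continuous_at_sequentiallyI)
  fix x :: 'a and u assume u: "u \<longlonglongrightarrow> x"
  note [measurable] = locint_measurable[OF f] borel_measurable_continuous[OF c]
  obtain B where B: "\<And>n. norm (u n) \<le> B"
    using convergent_imp_bounded[OF u] by (auto simp: bounded_iff)
  obtain M where M: "\<And>x. \<bar>\<sigma> x\<bar> \<le> M" using supp_ball_bounded[OF c r] by blast
  have sup: "supp_ball (B + r) (\<lambda>z. \<sigma> (u n - z))" for n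
    by (rule supp_ball_mono[OF supp_ball_reflect[OF r]]) (use B in auto)
  show "(\<lambda>n. conv f \<sigma> (u n)) \<longlonglongrightarrow> conv f \<sigma> x"
    unfolding conv_def
  proof (rule integral_dominated_convergence)
    show "integrable lborel (\<lambda>z. M * \<bar>indicator (cball 0 (B + r)) z * f z\<bar>)"
      using f by (simp add: locint_def)
    show "AE z in lborel. (\<lambda>n. f z * \<sigma> (u n - z)) \<longlonglongrightarrow> f z * \<sigma> (x - z)"
      using c u by (intro AE_I2 tendsto_mult_left continuous_on_tendsto_compose[of UNIV \<sigma>] tendsto_intros) auto
    fix n show "AE z in lborel. norm (f z * \<sigma> (u n - z)) \<le> M * \<bar>indicator (cball 0 (B + r)) z * f z\<bar>"
    proof (rule AE_I2)
      fix z show "norm (f z * \<sigma> (u n - z)) \<le> M * \<bar>indicator (cball 0 (B + r)) z * f z\<bar>"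
        using M[of "u n - z"] supp_ballD[OF sup, of z n]
        by (cases "norm z \<le> B + r") (auto simp: abs_mult mult.commute[of M] intro!: mult_left_mono)
    qed
  qed measurable
qed

lemma conv_has_derivative:
  fixes f :: "real ^ 'n::finite \<Rightarrow> real"
  assumes f: "locint f" and s: "Ck (Suc 0) \<sigma>" and r: "supp_ball r \<sigma>"
  shows "(conv f \<sigma> has_derivative (\<lambda>h. \<Sum>i\<in>UNIV. h $ i * conv f (partial_deriv i \<sigma>) x)) (at x)"
  unfolding has_derivative_at_alt
proof (intro conjI allI impI)
  show "bounded_linear (\<lambda>h. \<Sum>i\<in>UNIV. h $ i * conv f (partial_deriv i \<sigma>) x)"
    by (intro bounded_linear_sum bounded_linear_mult_const[OF bounded_linear_vec_nth])
  fix e :: real assume e: "e > 0"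
  note [measurable] = locint_measurable[OF f]
  have cs: "continuous_on UNIV \<sigma>" using Ck_continuous[OF s] .
  have cp: "continuous_on UNIV (partial_deriv i \<sigma>)" for i using s by simp
  have rp: "supp_ball r (partial_deriv i \<sigma>)" for i by (rule supp_ball_partial_deriv[OF r])
  have diff: "\<And>x. \<sigma> differentiable (at x)" using s by simp
  define C where "C = (\<integral>z. \<bar>indicator (cball 0 (norm x + 1 + r)) z * f z\<bar> \<partial>lborel)"
  have C: "C \<ge> 0" unfolding C_def by (rule integral_nonneg_AE) auto
  define e' where "e' = e / (C + 1) / real CARD('n)"
  have e': "e' > 0" using e C by (simp add: e'_def)
  have "\<forall>i. \<exists>d>0. d \<le> 1 \<and> (\<forall>x y. norm (x - y) < d \<longrightarrow> \<bar>partial_deriv i \<sigma> x - partial_deriv i \<sigma> y\<bar> < e')"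
    using uniformly_continuous_supp[OF cp rp e'] by blast
  then obtain d where d: "\<And>i. d i > 0" "\<And>i. d i \<le> 1"
    "\<And>i x y. norm (x - y) < d i \<Longrightarrow> \<bar>partial_deriv i \<sigma> x - partial_deriv i \<sigma> y\<bar> < e'"
    by metis
  define D where "D = Min (range d)"
  have D: "D > 0" "\<And>i. D \<le> d i" by (auto simp: D_def d(1))
  then have D1: "D \<le> 1" using d(2) order_trans by blast
  have U: "\<bar>\<sigma> (y + h) - \<sigma> y - (\<Sum>i\<in>UNIV. h $ i * partial_deriv i \<sigma> y)\<bar> \<le> e / (C + 1) * norm h"
    if h: "norm h < D" for y h
  proof -
    obtain t where t: "0 < t" "t < 1" "\<sigma> (y + h) - \<sigma> y = (\<Sum>i\<in>UNIV. h $ i * partial_deriv i \<sigma> (y + t *\<^sub>R h))"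
      using C1_mvt[OF diff] by blast
    have "norm (t *\<^sub>R h) \<le> norm h" using t by (simp add: mult_left_le_one_le)
    then have n: "norm (y + t *\<^sub>R h - y) < d i" for i using D(2)[of i] h by simp
    have "\<bar>\<sigma> (y + h) - \<sigma> y - (\<Sum>i\<in>UNIV. h $ i * partial_deriv i \<sigma> y)\<bar> =
      \<bar>\<Sum>i\<in>UNIV. h $ i * (partial_deriv i \<sigma> (y + t *\<^sub>R h) - partial_deriv i \<sigma> y)\<bar>"
      by (simp add: t(3) sum_subtractf right_diff_distrib)
    also have "\<dots> \<le> (\<Sum>i\<in>(UNIV::'n set). norm h * e')"
      by (rule order_trans[OF sum_abs], rule sum_mono)
        (auto simp: abs_mult intro!: mult_mono component_le_norm_cart less_imp_le[OF d(3)[OF n]])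
    also have "\<dots> = e / (C + 1) * norm h" by (simp add: e'_def)
    finally show ?thesis .
  qed
  show "\<exists>d>0. \<forall>y. norm (y - x) < d \<longrightarrow>
     norm (conv f \<sigma> y - conv f \<sigma> x - (\<Sum>i\<in>UNIV. (y - x) $ i * conv f (partial_deriv i \<sigma>) x)) \<le> e * norm (y - x)"
  proof (intro exI[of _ D] conjI allI impI D(1))
    fix y assume y: "norm (y - x) < D"
    define h where "h = y - x"
    let ?r = "\<lambda>z. \<sigma> (y - z) - \<sigma> (x - z) - (\<Sum>i\<in>UNIV. h $ i * partial_deriv i \<sigma> (x - z))"
    have "norm y \<le> norm x + norm (y - x)" by (rule norm_triangle_sub)
    then have ny: "norm y \<le> norm x + 1" using y D1 by simp
    have int: "integrable lborel (\<lambda>z. f z * \<sigma> (y - z))" "integrable lborel (\<lambda>z. f z * \<sigma> (x - z))"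
      "\<And>i. integrable lborel (\<lambda>z. f z * partial_deriv i \<sigma> (x - z))"
      using conv_integrable[OF f cs r] conv_integrable[OF f cp rp] by auto
    have "conv f \<sigma> y - conv f \<sigma> x - (\<Sum>i\<in>UNIV. h $ i * conv f (partial_deriv i \<sigma>) x) =
       (\<integral>z. f z * \<sigma> (y - z) - f z * \<sigma> (x - z) - (\<Sum>i\<in>UNIV. h $ i * (f z * partial_deriv i \<sigma> (x - z))) \<partial>lborel)"
      unfolding conv_def using int by (simp add: Bochner_Integration.integral_sum)
    also have "\<dots> = (\<integral>z. f z * ?r z \<partial>lborel)"
      by (simp add: right_diff_distrib sum_distrib_left mult_ac)
    also have "norm \<dots> \<le> (\<integral>z. e / (C + 1) * norm h * \<bar>indicator (cball 0 (norm x + 1 + r)) z * f z\<bar> \<partial>lborel)"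
    proof (rule Bochner_Integration.integral_norm_bound_integral)
      have "integrable lborel (\<lambda>z. f z * \<sigma> (y - z) - f z * \<sigma> (x - z) - (\<Sum>i\<in>UNIV. h $ i * (f z * partial_deriv i \<sigma> (x - z))))"
        using int by auto
      then show "integrable lborel (\<lambda>z. f z * ?r z)"
        by (simp add: right_diff_distrib sum_distrib_left mult_ac)
      show "integrable lborel (\<lambda>z. e / (C + 1) * norm h * \<bar>indicator (cball 0 (norm x + 1 + r)) z * f z\<bar>)"
        using f by (simp add: locint_def)
      fix z
      show "norm (f z * ?r z) \<le> e / (C + 1) * norm h * \<bar>indicator (cball 0 (norm x + 1 + r)) z * f z\<bar>"
      proof (cases "norm z \<le> norm x + 1 + r")
        case True
        have "\<bar>?r z\<bar> \<le> e / (C + 1) * norm h"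
          using U[of h "x - z"] y by (simp add: h_def algebra_simps)
        then have "\<bar>f z\<bar> * \<bar>?r z\<bar> \<le> \<bar>f z\<bar> * (e / (C + 1) * norm h)"
          by (rule mult_left_mono) simp
        then show ?thesis using True by (simp add: abs_mult mult_ac)
      next
        case False
        then have "?r z = 0"
          using supp_ballD[OF supp_ball_reflect[OF r], of y z] supp_ballD[OF supp_ball_reflect[OF r], of x z]
            supp_ballD[OF supp_ball_reflect[OF rp], of x z] ny by simp
        then show ?thesis using e C by simp
      qed
    qed
    also have "\<dots> = e * norm h * (C / (C + 1))" by (simp add: C_def)
    also have "\<dots> \<le> e * norm h * 1"
      using C e by (intro mult_left_mono) (auto simp: field_simps)
    finally show "norm (conv f \<sigma> y - conv f \<sigma> x - (\<Sum>i\<in>UNIV. (y - x) $ i * conv f (partial_deriv i \<sigma>) x)) \<le> e * norm (y - x)"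
      by (simp add: h_def)
  qed
qed

lemma partial_deriv_conv:
  fixes f :: "real ^ 'n::finite \<Rightarrow> real"
  assumes "locint f" "Ck (Suc 0) \<sigma>" "supp_ball r \<sigma>"
  shows "partial_deriv i (conv f \<sigma>) = conv f (partial_deriv i \<sigma>)"
  by (rule ext, rule partial_deriv_eq[THEN trans, OF conv_has_derivative[OF assms]])
    (auto simp: axis_def if_distrib if_distribR cong: if_cong)

lemma Ck_conv:
  fixes f :: "real ^ 'n::finite \<Rightarrow> real"
  assumes "locint f"
  shows "Ck k \<sigma> \<Longrightarrow> supp_ball r \<sigma> \<Longrightarrow> Ck k (conv f \<sigma>)"
proof (induction k arbitrary: \<sigma>)
  case 0 then show ?case using conv_continuous[OF assms] by simp
next
  case (Suc k)
  have 1: "Ck (Suc 0) \<sigma>" by (rule Ck_mono[OF Suc.prems(1)]) simp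
  have "conv f \<sigma> differentiable (at x)" for x
    using conv_has_derivative[OF assms 1 Suc.prems(2)] by (rule differentiableI)
  moreover have "Ck k (partial_deriv i (conv f \<sigma>))" for i
    unfolding partial_deriv_conv[OF assms 1 Suc.prems(2)]
    using Suc by (auto intro!: Suc.IH supp_ball_partial_deriv)
  ultimately show ?case by simp
qed

lemma supp_ball_conv:
  assumes "supp_ball R f" "supp_ball r \<sigma>"
  shows "supp_ball (R + r) (conv f \<sigma>)"
  unfolding supp_ball_def
proof safe
  fix x :: 'a assume x: "R + r < norm x"
  have "f z * \<sigma> (x - z) = 0" for z
  proof (cases "R < norm z")
    case True then show ?thesis using assms by (simp add: supp_ball_def)
  next
    case False
    have "norm x \<le> norm z + norm (x - z)" by (rule norm_triangle_sub)
    then have "r < norm (x - z)" using x False by simp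
    then show ?thesis using assms by (simp add: supp_ball_def)
  qed
  then have "(\<lambda>z. f z * \<sigma> (x - z)) = (\<lambda>z. 0)" by blast
  then show "conv f \<sigma> x = 0" unfolding conv_def by simp
qed

lemma conv_test:
  assumes "locint f" "supp_ball R f" "\<sigma> \<in> test_functions"
  shows "conv f \<sigma> \<in> test_functions"
proof -
  obtain r where "supp_ball r \<sigma>" using test_functionsD(4)[OF assms(3)] by blast
  then show ?thesis
    using assms supp_ball_conv[of R f r \<sigma>]
    by (auto simp: test_functions_iff intro!: Ck_conv[OF assms(1)])
qed

text \<open>\<open>g\<close> is the weak \<open>i\<close>-th partial derivative of \<open>u\<close> with respect to Lebesgue measure. Single directions are considered
  because the chain and product rules hold in each direction separately.\<close>

definition weakd :: "'n::finite \<Rightarrow> (real ^ 'n \<Rightarrow> real) \<Rightarrow> (real ^ 'n \<Rightarrow> real) \<Rightarrow> bool" where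
  "weakd i u g \<longleftrightarrow> locint u \<and> locint g \<and>
     (\<forall>\<eta>\<in>test_functions. (\<integral>x. g x * \<eta> x \<partial>lborel) = - (\<integral>x. u x * partial_deriv i \<eta> x \<partial>lborel))"

lemma partial_deriv_conv_weakd:
  assumes "weakd i u g" "\<sigma> \<in> test_functions"
  shows "partial_deriv i (conv u \<sigma>) = conv g \<sigma>"
proof
  fix x
  obtain r where r: "supp_ball r \<sigma>" using test_functionsD(4)[OF assms(2)] by blast
  have "partial_deriv i (conv u \<sigma>) x = (\<integral>z. u z * partial_deriv i \<sigma> (x - z) \<partial>lborel)"
    using assms by (subst partial_deriv_conv[OF _ test_functionsD(1)[OF assms(2)] r]) (auto simp: weakd_def conv_def)
  also have "\<dots> = - (\<integral>z. u z * partial_deriv i (\<lambda>z. \<sigma> (x - z)) z \<partial>lborel)"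
    using test_functionsD(3)[OF assms(2)] by (simp add: partial_deriv_reflect)
  also have "\<dots> = (\<integral>z. g z * \<sigma> (x - z) \<partial>lborel)"
    using assms(1) test_functions_reflect[OF assms(2), of x] by (simp add: weakd_def)
  finally show "partial_deriv i (conv u \<sigma>) x = conv g \<sigma> x" by (simp add: conv_def)
qed

section \<open>Integrals of p-th powers and mollification\<close>

text \<open>The integral of \<open>|f|\<^sup>p\<close>, as an extended nonnegative real. Its quasi-triangle inequality with
  constant \<open>2\<^sup>p\<close> takes the place of Minkowski's inequality.\<close>

definition pint :: "real \<Rightarrow> ('a::euclidean_space \<Rightarrow> real) \<Rightarrow> ennreal" where
  "pint p f = (\<integral>\<^sup>+x. ennreal (\<bar>f x\<bar> powr p) \<partial>lborel)"

lemma pint_mono: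
  assumes "0 \<le> p" "AE x in lborel. \<bar>f x\<bar> \<le> \<bar>g x\<bar>"
  shows "pint p f \<le> pint p g"
  unfolding pint_def
  by (rule nn_integral_mono_AE) (use assms in \<open>auto intro!: ennreal_leI powr_mono2 elim!: eventually_mono\<close>)

lemma pint_cmult:
  assumes [measurable]: "f \<in> borel_measurable borel" and "0 \<le> c"
  shows "pint p (\<lambda>x. c * f x) = ennreal (c powr p) * pint p f"
  unfolding pint_def using assms(2)
  by (simp add: abs_mult powr_mult ennreal_mult nn_integral_cmult)

lemma powr_add_le:
  fixes a b p :: real
  assumes "0 \<le> a" "0 \<le> b" "0 \<le> p"
  shows "(a + b) powr p \<le> 2 powr p * (a powr p + b powr p)"
proof -
  have "(a + b) powr p \<le> (2 * max a b) powr p" using assms by (intro powr_mono2) auto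
  also have "\<dots> = 2 powr p * max a b powr p" using assms by (simp add: powr_mult)
  also have "\<dots> \<le> 2 powr p * (a powr p + b powr p)"
    by (intro mult_left_mono) (auto simp: max_def)
  finally show ?thesis .
qed

lemma pint_add:
  assumes [measurable]: "f \<in> borel_measurable borel" "g \<in> borel_measurable borel" and "0 \<le> p"
  shows "pint p (\<lambda>x. f x + g x) \<le> ennreal (2 powr p) * (pint p f + pint p g)"
proof -
  have "\<bar>f x + g x\<bar> powr p \<le> 2 powr p * (\<bar>f x\<bar> powr p + \<bar>g x\<bar> powr p)" for x
    using powr_add_le[of "\<bar>f x\<bar>" "\<bar>g x\<bar>" p] assms(3)
    by (intro order_trans[OF powr_mono2[of p "\<bar>f x + g x\<bar>" "\<bar>f x\<bar> + \<bar>g x\<bar>"]]) auto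
  then have "pint p (\<lambda>x. f x + g x) \<le> (\<integral>\<^sup>+x. ennreal (2 powr p * (\<bar>f x\<bar> powr p + \<bar>g x\<bar> powr p)) \<partial>lborel)"
    unfolding pint_def by (intro nn_integral_mono ennreal_leI)
  also have "\<dots> = ennreal (2 powr p) * (pint p f + pint p g)"
    unfolding pint_def
    by (simp add: ennreal_mult nn_integral_cmult nn_integral_add distrib_left)
  finally show ?thesis .
qed

lemma pint_minus: "pint p (\<lambda>x. - f x) = pint p f"
  by (simp add: pint_def)

lemma pint_diff:
  assumes [measurable]: "f \<in> borel_measurable borel" "g \<in> borel_measurable borel" and "0 \<le> p"
  shows "pint p (\<lambda>x. f x - g x) \<le> ennreal (2 powr p) * (pint p f + pint p g)"
  using pint_add[of f "\<lambda>x. - g x" p] assms by (simp add: pint_minus)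

lemma pint_triangle3:
  assumes [measurable]: "f \<in> borel_measurable borel" "g \<in> borel_measurable borel" "h \<in> borel_measurable borel"
    and "0 \<le> p"
  shows "pint p (\<lambda>x. f x + g x + h x) \<le> ennreal (4 powr p) * (pint p f + pint p g + pint p h)"
proof -
  have "pint p (\<lambda>x. f x + g x + h x) \<le> ennreal (2 powr p) * (pint p (\<lambda>x. f x + g x) + pint p h)"
    using pint_add[of "\<lambda>x. f x + g x" h p] assms(4) by simp
  also have "\<dots> \<le> ennreal (2 powr p) * (ennreal (2 powr p) * (pint p f + pint p g) + ennreal (2 powr p) * pint p h)"
  proof (intro mult_left_mono add_mono)
    have "1 * pint p h \<le> ennreal (2 powr p) * pint p h"
      using assms(4) by (intro mult_right_mono) (auto simp: ge_one_powr_ge_zero)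
    then show "pint p h \<le> ennreal (2 powr p) * pint p h" by simp
  qed (use pint_add[of f g p] assms(4) in auto)
  also have "\<dots> = (ennreal (2 powr p) * ennreal (2 powr p)) * (pint p f + pint p g + pint p h)"
    by (simp add: distrib_left mult.assoc)
  also have "ennreal (2 powr p) * ennreal (2 powr p) = ennreal (4 powr p)"
    by (simp add: ennreal_mult[symmetric] powr_mult[symmetric])
  finally show ?thesis .
qed

lemma tendsto_0_ennreal_cmult:
  assumes "(f \<longlongrightarrow> 0) F" "c < (\<infinity>::ennreal)"
  shows "((\<lambda>x. c * f x) \<longlongrightarrow> 0) F"
  using ennreal_tendsto_cmult[OF _ assms(1), of c] assms(2) by simp

lemma pint_tendsto_0_add:
  fixes f g :: "nat \<Rightarrow> 'a::euclidean_space \<Rightarrow> real"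
  assumes [measurable]: "\<And>n. f n \<in> borel_measurable borel" "\<And>n. g n \<in> borel_measurable borel" and "0 \<le> p"
    and "(\<lambda>n. pint p (f n)) \<longlonglongrightarrow> 0" "(\<lambda>n. pint p (g n)) \<longlonglongrightarrow> 0"
  shows "(\<lambda>n. pint p (\<lambda>x. f n x + g n x)) \<longlonglongrightarrow> 0"
proof (rule tendsto_sandwich[OF _ _ tendsto_const])
  have "(\<lambda>n. pint p (f n) + pint p (g n)) \<longlonglongrightarrow> 0 + 0"
    by (intro tendsto_add assms)
  then show "(\<lambda>n. ennreal (2 powr p) * (pint p (f n) + pint p (g n))) \<longlonglongrightarrow> 0"
    by (intro tendsto_0_ennreal_cmult) auto
qed (use pint_add[OF assms(1,2,3)] in auto)

lemma pint_tendsto_0_bound: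
  fixes f g :: "nat \<Rightarrow> 'a::euclidean_space \<Rightarrow> real"
  assumes p: "0 \<le> p" and c: "0 \<le> c" and g: "\<And>n. g n \<in> borel_measurable borel"
    and le: "\<And>n x. \<bar>f n x\<bar> \<le> c * \<bar>g n x\<bar>" and lim: "(\<lambda>n. pint p (g n)) \<longlonglongrightarrow> 0"
  shows "(\<lambda>n. pint p (f n)) \<longlonglongrightarrow> 0"
proof (rule tendsto_sandwich[OF _ _ tendsto_const])
  show "(\<lambda>n. ennreal (c powr p) * pint p (g n)) \<longlonglongrightarrow> 0" by (rule tendsto_0_ennreal_cmult[OF lim]) auto
  have "pint p (f n) \<le> ennreal (c powr p) * pint p (g n)" for n
  proof -
    have "pint p (f n) \<le> pint p (\<lambda>x. c * g n x)"
      by (rule pint_mono[OF p]) (use le c in \<open>simp add: abs_mult\<close>)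
    also have "\<dots> = ennreal (c powr p) * pint p (g n)" by (rule pint_cmult[OF g c])
    finally show ?thesis .
  qed
  then show "\<forall>\<^sub>F n in sequentially. pint p (f n) \<le> ennreal (c powr p) * pint p (g n)" by simp
qed auto

lemma pint_tendsto_0_dominated:
  fixes f :: "nat \<Rightarrow> 'a::euclidean_space \<Rightarrow> real"
  assumes [measurable]: "\<And>n. f n \<in> borel_measurable borel" "W \<in> borel_measurable borel"
    and p: "0 < p"
    and lim: "AE x in lborel. (\<lambda>n. f n x) \<longlonglongrightarrow> 0"
    and bd: "\<And>n. AE x in lborel. \<bar>f n x\<bar> \<le> \<bar>W x\<bar>" and W: "pint p W < \<infinity>"
  shows "(\<lambda>n. pint p (f n)) \<longlonglongrightarrow> 0"
proof -
  have "(\<lambda>n. \<integral>\<^sup>+x. ennreal (\<bar>f n x\<bar> powr p) \<partial>lborel) \<longlonglongrightarrow> (\<integral>\<^sup>+x. 0 \<partial>(lborel :: 'a measure))"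
  proof (rule nn_integral_dominated_convergence[where w = "\<lambda>x. ennreal (\<bar>W x\<bar> powr p)"])
    show "AE x in lborel. ennreal (\<bar>f n x\<bar> powr p) \<le> ennreal (\<bar>W x\<bar> powr p)" for n
      using bd[of n] p by (auto intro!: ennreal_leI powr_mono2 elim!: eventually_mono)
    show "AE x in lborel. (\<lambda>n. ennreal (\<bar>f n x\<bar> powr p)) \<longlonglongrightarrow> 0"
      using lim
    proof eventually_elim
      case (elim x)
      have "(\<lambda>n. \<bar>f n x\<bar> powr p) \<longlonglongrightarrow> \<bar>0\<bar> powr p"
        using elim p by (intro tendsto_powr' tendsto_rabs tendsto_const) auto
      then have "(\<lambda>n. ennreal (\<bar>f n x\<bar> powr p)) \<longlonglongrightarrow> ennreal (\<bar>0\<bar> powr p)" by (rule tendsto_ennrealI)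
      then show ?case by simp
    qed
  qed (use W in \<open>auto simp: pint_def\<close>)
  then show ?thesis by (simp add: pint_def)
qed

lemma pint_finite_imp_locint:
  fixes f :: "'a::euclidean_space \<Rightarrow> real"
  assumes [measurable]: "f \<in> borel_measurable borel" and "1 \<le> p"
    and "\<And>R. (\<integral>\<^sup>+x. indicator (cball 0 R) x * ennreal (\<bar>f x\<bar> powr p) \<partial>lborel) < \<infinity>"
  shows "locint f"
  unfolding locint_def
proof safe
  fix R
  have le: "t \<le> 1 + t powr p" if "0 \<le> t" for t :: real
  proof (cases "t \<le> 1")
    case False
    then have "t powr 1 \<le> t powr p" using assms(2) by (intro powr_mono) auto
    then show ?thesis using False by simp
  qed (simp add: add_increasing2)
  have "(\<integral>\<^sup>+x. ennreal (norm (indicator (cball 0 R) x * f x)) \<partial>lborel) \<le>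
     (\<integral>\<^sup>+x. indicator (cball 0 R) x + indicator (cball 0 R) x * ennreal (\<bar>f x\<bar> powr p) \<partial>lborel)"
    using ennreal_leI[OF le[of "\<bar>f _\<bar>"]]
    by (intro nn_integral_mono) (auto simp: indicator_def ennreal_plus)
  also have "\<dots> = emeasure lborel (cball 0 R :: 'a set) + (\<integral>\<^sup>+x. indicator (cball 0 R) x * ennreal (\<bar>f x\<bar> powr p) \<partial>lborel)"
    by (subst nn_integral_add) auto
  also have "\<dots> < \<infinity>"
    using assms(3)[of R] emeasure_bounded_finite[of "cball 0 R :: 'a set"] by (simp add: ennreal_add_less_top)
  finally show "integrable lborel (\<lambda>x. indicator (cball 0 R) x * f x)"
    by (intro integrableI_bounded) auto
qed (rule assms(1))

lemma pint_finite_locint: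
  fixes f :: "'a::euclidean_space \<Rightarrow> real"
  assumes [measurable]: "f \<in> borel_measurable borel" and "1 \<le> p" "pint p f < \<infinity>"
  shows "locint f"
proof (rule pint_finite_imp_locint[OF assms(1,2)])
  fix R
  have "(\<integral>\<^sup>+x. indicator (cball 0 R) x * ennreal (\<bar>f x\<bar> powr p) \<partial>lborel) \<le> pint p f"
    unfolding pint_def by (intro nn_integral_mono) (auto simp: indicator_def)
  then show "(\<integral>\<^sup>+x. indicator (cball 0 R) x * ennreal (\<bar>f x\<bar> powr p) \<partial>lborel) < \<infinity>"
    using assms(3) by (rule le_less_trans)
qed

text \<open>The tangent inequality for \<open>t\<^sup>p\<close>, valid up to the boundary point zero. (For \<open>a = 0\<close> it holds because the factor
  \<open>0 powr (p - 1)\<close> is zero, also for \<open>p = 1\<close>.)\<close>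

lemma powr_tangent:
  fixes a t p :: real
  assumes "1 \<le> p" "0 \<le> a" "0 \<le> t"
  shows "a powr p + p * a powr (p - 1) * (t - a) \<le> t powr p"
proof (cases "a = 0 \<or> t = 0")
  case True
  have "a powr p = a powr (p - 1) * a" if "a > 0" using that powr_mult_base[of a "p - 1"] by (simp add: mult.commute)
  then have "a powr p - p * (a powr (p - 1) * a) \<le> 0" if "a > 0"
    using that assms(1) mult_right_mono[of 1 p "a powr (p - 1) * a"] by simp
  then show ?thesis using True assms by (cases "a = 0"; cases "t = 0") (auto simp: mult.assoc)
next
  case False
  then have a: "a > 0" "t > 0" using assms by auto
  have "p * a powr (p - 1) * (t - a) \<le> t powr p - a powr p"
  proof (rule convex_on_imp_above_tangent[where A = "{0<..}" and f = "\<lambda>x. x powr p"])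
    show "convex_on {0<..} (\<lambda>x. x powr p)" using powr_convex[OF assms(1)] by (rule convex_on_subset) auto
    show "((\<lambda>x. x powr p) has_real_derivative p * a powr (p - 1)) (at a within {0<..})"
      using a by (auto intro!: derivative_eq_intros)
  qed (use a in \<open>auto simp: interior_open\<close>)
  then show ?thesis by simp
qed

text \<open>Jensen's inequality for \<open>t\<^sup>p\<close>, with respect to a finite measure with density \<open>\<kappa>\<close>, which need not have mass one.
  The tangent at the mean value is integrated.\<close>

lemma jensen_kernel:
  fixes h \<kappa> :: "'a \<Rightarrow> real"
  assumes p: "1 \<le> p" and h: "\<And>x. 0 \<le> h x" and k: "\<And>x. 0 \<le> \<kappa> x"
    and [measurable]: "h \<in> borel_measurable M"
    and ik: "integrable M \<kappa>" and ihk: "integrable M (\<lambda>x. h x * \<kappa> x)"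
  shows "ennreal ((\<integral>x. h x * \<kappa> x \<partial>M) powr p) \<le>
     ennreal ((\<integral>x. \<kappa> x \<partial>M) powr (p - 1)) * (\<integral>\<^sup>+x. ennreal (h x powr p * \<kappa> x) \<partial>M)"
proof -
  define m where "m = (\<integral>x. \<kappa> x \<partial>M)"
  define H where "H = (\<integral>x. h x * \<kappa> x \<partial>M)"
  have [measurable]: "\<kappa> \<in> borel_measurable M" using ik by auto
  have m0: "m \<ge> 0" unfolding m_def using k by simp
  have H0: "H \<ge> 0" unfolding H_def using h k by simp
  show ?thesis
  proof (cases "m = 0")
    case True
    then have "AE x in M. \<kappa> x = 0"
      using integral_nonneg_eq_0_iff_AE[OF ik] k by (simp add: m_def)
    then have "AE x in M. h x * \<kappa> x = 0" by eventually_elim simp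
    then have "H = 0" unfolding H_def by (simp cong: integral_cong_AE add: integral_eq_zero_AE)
    then show ?thesis using p by (simp add: H_def[symmetric])
  next
    case False
    then have m: "m > 0" using m0 by simp
    show ?thesis
    proof (cases "(\<integral>\<^sup>+x. ennreal (h x powr p * \<kappa> x) \<partial>M) = \<infinity>")
      case True
      then show ?thesis using m by (simp add: m_def[symmetric] ennreal_mult_top)
    next
      case False
      have int: "integrable M (\<lambda>x. h x powr p * \<kappa> x)"
        using False k by (intro integrableI_nonneg) (auto simp: less_top)
      define a where "a = H / m"
      have a0: "a \<ge> 0" using H0 m by (simp add: a_def)
      have i2: "integrable M (\<lambda>x. (a powr p - p * a powr (p - 1) * a) * \<kappa> x + p * a powr (p - 1) * (h x * \<kappa> x))"
        using ik ihk by auto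
      have "a powr p * m = (a powr p - p * a powr (p - 1) * a) * m + p * a powr (p - 1) * H"
        using m by (simp add: a_def field_simps)
      also have "\<dots> = (\<integral>x. (a powr p - p * a powr (p - 1) * a) * \<kappa> x + p * a powr (p - 1) * (h x * \<kappa> x) \<partial>M)"
        using ik ihk by (simp add: m_def H_def)
      also have "\<dots> \<le> (\<integral>x. h x powr p * \<kappa> x \<partial>M)"
      proof (rule integral_mono[OF i2 int])
        fix x show "(a powr p - p * a powr (p - 1) * a) * \<kappa> x + p * a powr (p - 1) * (h x * \<kappa> x) \<le> h x powr p * \<kappa> x"
          using mult_right_mono[OF powr_tangent[OF p a0 h[of x]] k[of x]] by (simp add: algebra_simps)
      qed
      finally have le: "a powr p * m \<le> (\<integral>x. h x powr p * \<kappa> x \<partial>M)" .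
      have "H powr p = (a * m) powr p" using m by (simp add: a_def)
      also have "\<dots> = a powr p * (m powr (p - 1) * m)"
        using m a0 powr_mult_base[of m "p - 1"] by (simp add: powr_mult mult.commute)
      also have "\<dots> \<le> m powr (p - 1) * (\<integral>x. h x powr p * \<kappa> x \<partial>M)"
        using mult_left_mono[OF le, of "m powr (p - 1)"] by (simp add: mult_ac)
      finally have "ennreal (H powr p) \<le> ennreal (m powr (p - 1) * (\<integral>x. h x powr p * \<kappa> x \<partial>M))"
        by (rule ennreal_leI)
      also have "\<dots> = ennreal (m powr (p - 1)) * (\<integral>\<^sup>+x. ennreal (h x powr p * \<kappa> x) \<partial>M)"
        using int k by (subst nn_integral_eq_integral) (auto intro!: ennreal_mult integral_nonneg_AE)
      finally show ?thesis by (simp add: m_def H_def)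
    qed
  qed
qed

lemma sigma_finite_lborel_pair [simp]: "pair_sigma_finite lborel lborel"
  by (simp add: pair_sigma_finite.intro lborel.sigma_finite_measure_axioms)

text \<open>The basic estimate for integral operators: a two-point function \<open>H x z\<close> is averaged against the kernel
  \<open>\<kappa> (x - z)\<close>. Convolutions are the case in which \<open>H\<close> depends on \<open>z\<close> only; the commutator below needs a multiple of
  \<open>|\<psi> x - \<psi> z|\<close>.\<close>

lemma pint_kernel:
  fixes H :: "'a::euclidean_space \<Rightarrow> 'a \<Rightarrow> real"
  assumes p: "1 \<le> p" and H0: "\<And>x z. 0 \<le> H x z"
    and [measurable]: "(\<lambda>(x, z). H x z) \<in> borel_measurable (borel \<Otimes>\<^sub>M borel)"
    and c: "continuous_on UNIV \<kappa>" and r: "supp_ball r \<kappa>" and k: "\<And>x. 0 \<le> \<kappa> x"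
    and i: "\<And>x. integrable lborel (\<lambda>z. H x z * \<kappa> (x - z))"
    and B: "\<And>y. norm y \<le> r \<Longrightarrow> (\<integral>\<^sup>+x. ennreal (H x (x - y) powr p) \<partial>lborel) \<le> B"
  shows "pint p (\<lambda>x. \<integral>z. H x z * \<kappa> (x - z) \<partial>lborel) \<le> ennreal ((\<integral>x. \<kappa> x \<partial>lborel) powr p) * B"
proof -
  note [measurable] = borel_measurable_continuous[OF c]
  have [measurable]: "(\<lambda>z. H x z) \<in> borel_measurable borel" for x
    using measurable_compose[OF measurable_Pair1'[of x borel borel] assms(3)] by simp
  define m where "m = (\<integral>x. \<kappa> x \<partial>lborel)"
  have m0: "m \<ge> 0" unfolding m_def using k by simp
  have ik: "integrable lborel \<kappa>" by (rule integrable_continuous_supp[OF c r])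
  have ikr: "integrable lborel (\<lambda>z. \<kappa> (x - z))" for x
    by (rule integrable_continuous_supp[OF continuous_reflect[OF c] supp_ball_reflect[OF r]])
  have mr: "(\<integral>z. \<kappa> (x - z) \<partial>lborel) = m" for x unfolding m_def by (rule integral_lborel_reflect) simp
  have "pint p (\<lambda>x. \<integral>z. H x z * \<kappa> (x - z) \<partial>lborel) \<le>
     (\<integral>\<^sup>+x. ennreal (m powr (p - 1)) * (\<integral>\<^sup>+z. ennreal (H x z powr p * \<kappa> (x - z)) \<partial>lborel) \<partial>lborel)"
    unfolding pint_def
  proof (rule nn_integral_mono)
    fix x
    have "0 \<le> (\<integral>z. H x z * \<kappa> (x - z) \<partial>lborel)" using H0 k by (simp add: integral_nonneg_AE)
    then show "ennreal (\<bar>\<integral>z. H x z * \<kappa> (x - z) \<partial>lborel\<bar> powr p) \<le>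
       ennreal (m powr (p - 1)) * (\<integral>\<^sup>+z. ennreal (H x z powr p * \<kappa> (x - z)) \<partial>lborel)"
      using jensen_kernel[OF p, of "H x" "\<lambda>z. \<kappa> (x - z)" lborel] H0 k ikr i mr by simp
  qed
  also have "\<dots> = ennreal (m powr (p - 1)) * (\<integral>\<^sup>+x. (\<integral>\<^sup>+z. ennreal (H x z powr p * \<kappa> (x - z)) \<partial>lborel) \<partial>lborel)"
    by (rule nn_integral_cmult) measurable
  also have "(\<integral>\<^sup>+x. (\<integral>\<^sup>+z. ennreal (H x z powr p * \<kappa> (x - z)) \<partial>lborel) \<partial>lborel) =
     (\<integral>\<^sup>+x. (\<integral>\<^sup>+y. ennreal (H x (x - y) powr p * \<kappa> y) \<partial>lborel) \<partial>lborel)"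
  proof (rule nn_integral_cong)
    fix x
    show "(\<integral>\<^sup>+z. ennreal (H x z powr p * \<kappa> (x - z)) \<partial>lborel) = (\<integral>\<^sup>+y. ennreal (H x (x - y) powr p * \<kappa> y) \<partial>lborel)"
      using nn_integral_lborel_reflect[of "\<lambda>z. ennreal (H x z powr p * \<kappa> (x - z))" x] by simp
  qed
  also have "\<dots> = (\<integral>\<^sup>+y. (\<integral>\<^sup>+x. ennreal (H x (x - y) powr p * \<kappa> y) \<partial>lborel) \<partial>lborel)"
    by (rule pair_sigma_finite.Fubini'[OF sigma_finite_lborel_pair, symmetric]) measurable
  also have "\<dots> \<le> (\<integral>\<^sup>+y. B * ennreal (\<kappa> y) \<partial>lborel)"
  proof (rule nn_integral_mono)
    fix y
    have "(\<integral>\<^sup>+x. ennreal (H x (x - y) powr p * \<kappa> y) \<partial>lborel) = (\<integral>\<^sup>+x. ennreal (H x (x - y) powr p) \<partial>lborel) * ennreal (\<kappa> y)"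
      using k[of y] by (simp add: ennreal_mult nn_integral_multc)
    also have "\<dots> \<le> B * ennreal (\<kappa> y)"
      using B[of y] r by (cases "norm y \<le> r") (auto simp: supp_ball_def intro: mult_right_mono)
    finally show "(\<integral>\<^sup>+x. ennreal (H x (x - y) powr p * \<kappa> y) \<partial>lborel) \<le> B * ennreal (\<kappa> y)" .
  qed
  also have "\<dots> = B * ennreal m"
    using ik k by (subst nn_integral_cmult) (auto simp: nn_integral_eq_integral m_def)
  finally have "pint p (\<lambda>x. \<integral>z. H x z * \<kappa> (x - z) \<partial>lborel) \<le> ennreal (m powr (p - 1)) * (B * ennreal m)"
    by (simp add: mult_left_mono)
  also have "\<dots> = ennreal (m powr (p - 1) * m) * B" using m0 by (simp add: ennreal_mult mult_ac)
  also have "m powr (p - 1) * m = m powr p"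
    using m0 p powr_mult_base[of m "p - 1"] by (cases "m = 0") (auto simp: mult.commute)
  finally show ?thesis by (simp add: m_def)
qed

lemma pint_conv_abs:
  fixes f :: "'a::euclidean_space \<Rightarrow> real"
  assumes p: "1 \<le> p" and f: "locint f" and c: "continuous_on UNIV \<sigma>" and r: "supp_ball r \<sigma>"
  shows "pint p (\<lambda>x. \<integral>z. \<bar>f z\<bar> * \<bar>\<sigma> (x - z)\<bar> \<partial>lborel) \<le> ennreal ((\<integral>x. \<bar>\<sigma> x\<bar> \<partial>lborel) powr p) * pint p f"
proof (rule pint_kernel[OF p, where H = "\<lambda>x z. \<bar>f z\<bar>" and r = r])
  note [measurable] = locint_measurable[OF f]
  show "(\<lambda>(x::'a, z). \<bar>f z\<bar>) \<in> borel_measurable (borel \<Otimes>\<^sub>M borel)" by measurable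
  show "continuous_on UNIV (\<lambda>x. \<bar>\<sigma> x\<bar>)" "supp_ball r (\<lambda>x. \<bar>\<sigma> x\<bar>)"
    using c r by (auto intro!: continuous_intros simp: supp_ball_def)
  show "integrable lborel (\<lambda>z. \<bar>f z\<bar> * \<bar>\<sigma> (x - z)\<bar>)" for x
    using integrable_abs[OF conv_integrable[OF f c r, of x]] by (simp add: abs_mult)
  show "(\<integral>\<^sup>+x. ennreal (\<bar>f (x - y)\<bar> powr p) \<partial>lborel) \<le> pint p f" for y
    unfolding pint_def using nn_integral_lborel_shift[of "\<lambda>x. ennreal (\<bar>f x\<bar> powr p)" y] by simp
qed auto

lemma conv_abs_le:
  assumes "locint f" "continuous_on UNIV \<sigma>" "supp_ball r \<sigma>"
  shows "\<bar>conv f \<sigma> x\<bar> \<le> (\<integral>z. \<bar>f z\<bar> * \<bar>\<sigma> (x - z)\<bar> \<partial>lborel)"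
  unfolding conv_def using integral_abs_bound[of lborel "\<lambda>z. f z * \<sigma> (x - z)"] by (simp add: abs_mult)

lemma pint_conv:
  fixes f :: "'a::euclidean_space \<Rightarrow> real"
  assumes p: "1 \<le> p" and f: "locint f" and c: "continuous_on UNIV \<sigma>" and r: "supp_ball r \<sigma>"
  shows "pint p (conv f \<sigma>) \<le> ennreal ((\<integral>x. \<bar>\<sigma> x\<bar> \<partial>lborel) powr p) * pint p f"
  by (rule order_trans[OF pint_mono pint_conv_abs[OF p f c r]])
    (use conv_abs_le[OF f c r] p in \<open>auto intro!: AE_I2 intro: order_trans[OF _ abs_ge_self]\<close>)

text \<open>The rescaled bump function, normalised to have integral one.\<close>

definition molf :: "real \<Rightarrow> real ^ 'n::finite \<Rightarrow> real" where
  "molf \<epsilon> x = bump ((1 / \<epsilon>) *\<^sub>R x) / ((\<integral>y. bump (y :: real ^ 'n) \<partial>lborel) * \<epsilon> ^ CARD('n))"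

lemma integral_bump_pos: "0 < (\<integral>x. bump (x :: real ^ 'n::finite) \<partial>lborel)"
proof -
  let ?B = "ball (0::real ^ 'n) (1/2)"
  have c: "continuous_on UNIV (bump :: real ^ 'n \<Rightarrow> real)" using test_functionsD(2)[OF bump_test] .
  have i: "integrable lborel (bump :: real ^ 'n \<Rightarrow> real)"
    by (rule integrable_continuous_supp[OF c supp_ball_bump])
  have "(\<integral>x. bump (x :: real ^ 'n) \<partial>lborel) \<noteq> 0"
  proof
    assume "(\<integral>x. bump (x :: real ^ 'n) \<partial>lborel) = 0"
    then have "AE x in lborel. bump (x::real ^ 'n) = 0"
      using integral_nonneg_eq_0_iff_AE[OF i] bump_nonneg by auto
    then have "AE x in lborel. x \<notin> ?B"
    proof eventually_elim
      case (elim x)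
      have "bump x > 0" if "norm x < 1/2"
      proof -
        have "norm x ^ 2 < 1 ^ 2" using that by (intro power_strict_mono) auto
        then show ?thesis by (simp add: bump_eq expinv_def)
      qed
      then show ?case using elim by force
    qed
    then have "emeasure lborel ?B = 0"
      by (subst (asm) AE_iff_measurable[where N = ?B]) auto
    then show False using content_ball_pos[of "1/2" "0::real ^ 'n"] by (simp add: measure_def)
  qed
  moreover have "0 \<le> (\<integral>x. bump (x :: real ^ 'n) \<partial>lborel)"
    by (rule integral_nonneg_AE) (simp add: bump_nonneg)
  ultimately show ?thesis by simp
qed

lemma molf_test:
  assumes "0 < \<epsilon>" shows "(molf \<epsilon> :: real ^ 'n::finite \<Rightarrow> real) \<in> test_functions"
proof -
  have "(\<lambda>x. bump (0 + (1 / \<epsilon>) *\<^sub>R x) * (1 / ((\<integral>y. bump (y :: real ^ 'n) \<partial>lborel) * \<epsilon> ^ CARD('n)))) \<in> test_functions"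
    using assms by (intro test_functions_mult test_functions_affine bump_test Ck_const) auto
  then show ?thesis by (simp add: molf_def[abs_def])
qed

lemma molf_nonneg: "0 < \<epsilon> \<Longrightarrow> 0 \<le> molf \<epsilon> x"
  unfolding molf_def using integral_bump_pos bump_nonneg
  by (intro divide_nonneg_pos mult_pos_pos) auto

lemma supp_ball_molf: "0 < \<epsilon> \<Longrightarrow> supp_ball \<epsilon> (molf \<epsilon>)"
  unfolding supp_ball_def molf_def
proof safe
  fix x :: "real ^ 'a" assume "0 < \<epsilon>" "\<epsilon> < norm x"
  then have "1 < norm ((1 / \<epsilon>) *\<^sub>R x)" by simp
  then have "bump ((1 / \<epsilon>) *\<^sub>R x) = 0" by (rule supp_ballD[OF supp_ball_bump])
  then show "bump ((1 / \<epsilon>) *\<^sub>R x) / ((\<integral>y. bump (y :: real ^ 'a) \<partial>lborel) * \<epsilon> ^ CARD('a)) = 0" by simp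
qed

lemma molf_continuous: "0 < \<epsilon> \<Longrightarrow> continuous_on UNIV (molf \<epsilon>)"
  using test_functionsD(2)[OF molf_test] .

lemma integral_molf:
  assumes "0 < \<epsilon>" shows "(\<integral>x. molf \<epsilon> (x :: real ^ 'n::finite) \<partial>lborel) = 1"
proof -
  have [measurable]: "(bump :: real ^ 'n \<Rightarrow> real) \<in> borel_measurable borel"
    using borel_measurable_continuous[OF test_functionsD(2)[OF bump_test]] .
  have "(\<integral>x. bump (0 + (1 / \<epsilon>) *\<^sub>R (x :: real ^ 'n)) \<partial>lborel) = (\<integral>x. bump (x :: real ^ 'n) \<partial>lborel) * \<epsilon> ^ CARD('n)"
    using assms by (subst integral_lborel_affine) (auto simp: power_one_over)
  then show ?thesis using assms integral_bump_pos[where 'n='n]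
    unfolding molf_def by simp
qed

lemma integral_abs_molf: "0 < \<epsilon> \<Longrightarrow> (\<integral>x. \<bar>molf \<epsilon> (x :: real ^ 'n::finite)\<bar> \<partial>lborel) = 1"
  using integral_molf[of \<epsilon>, where 'n='n] molf_nonneg[of \<epsilon>, where 'a='n] by simp

text \<open>The \<open>L\<^sup>1\<close> norm of the derivative of the mollifier is a constant divided by \<open>\<epsilon>\<close>.\<close>

lemma integral_abs_partial_deriv_molf:
  assumes "0 < \<epsilon>"
  shows "(\<integral>x. \<bar>partial_deriv i (molf \<epsilon>) (x :: real ^ 'n::finite)\<bar> \<partial>lborel) =
     ((\<integral>x. \<bar>partial_deriv i bump (x :: real ^ 'n)\<bar> \<partial>lborel) / (\<integral>x. bump (x :: real ^ 'n) \<partial>lborel)) / \<epsilon>"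
proof -
  let ?C = "(\<integral>y. bump (y :: real ^ 'n) \<partial>lborel)"
  have C: "?C > 0" by (rule integral_bump_pos)
  have d: "bump differentiable (at x)" for x :: "real ^ 'n" using test_functionsD(3)[OF bump_test] .
  have [measurable]: "partial_deriv i (bump :: real ^ 'n \<Rightarrow> real) \<in> borel_measurable borel"
    using borel_measurable_continuous[OF test_functionsD(2)[OF test_functions_partial_deriv[OF bump_test]]] .
  have "partial_deriv i (molf \<epsilon>) x = (1 / \<epsilon>) * partial_deriv i bump (0 + (1 / \<epsilon>) *\<^sub>R x) / (?C * \<epsilon> ^ CARD('n))" for x :: "real ^ 'n"
  proof -
    have e: "molf \<epsilon> = (\<lambda>x :: real ^ 'n. bump (0 + (1 / \<epsilon>) *\<^sub>R x) * (1 / (?C * \<epsilon> ^ CARD('n))))"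
      by (simp add: molf_def[abs_def])
    have c0: "partial_deriv i (\<lambda>x :: real ^ 'n. c) x = 0" for c :: real
      by (rule partial_deriv_eq[THEN trans]) (auto intro!: derivative_eq_intros)
    show ?thesis unfolding e
      by (subst partial_deriv_mult) (use d c0 in \<open>auto intro!: differentiable_affine simp: partial_deriv_affine[OF d] simp del: add_0 add_0_left\<close>)
  qed
  then have "(\<integral>x. \<bar>partial_deriv i (molf \<epsilon>) (x :: real ^ 'n)\<bar> \<partial>lborel) =
     (\<integral>x. \<bar>partial_deriv i bump (0 + (1 / \<epsilon>) *\<^sub>R (x :: real ^ 'n))\<bar> * (1 / (\<epsilon> * (?C * \<epsilon> ^ CARD('n)))) \<partial>lborel)"
    using assms C by (simp add: abs_mult)
  also have "\<dots> = (\<integral>x. \<bar>partial_deriv i bump (0 + (1 / \<epsilon>) *\<^sub>R (x :: real ^ 'n))\<bar> \<partial>lborel) * (1 / (\<epsilon> * (?C * \<epsilon> ^ CARD('n))))"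
    by simp
  also have "(\<integral>x. \<bar>partial_deriv i bump (0 + (1 / \<epsilon>) *\<^sub>R (x :: real ^ 'n))\<bar> \<partial>lborel) =
     (\<integral>x. \<bar>partial_deriv i bump (x :: real ^ 'n)\<bar> \<partial>lborel) * \<epsilon> ^ CARD('n)"
    using assms integral_lborel_affine[of "\<lambda>x::real ^ 'n. \<bar>partial_deriv i bump x\<bar>" "1/\<epsilon>" 0] by (simp add: power_one_over)
  finally show ?thesis using assms by simp
qed

lemma pint_conv_molf:
  fixes f :: "real ^ 'n::finite \<Rightarrow> real"
  assumes "1 \<le> p" "locint f" "0 < \<epsilon>"
  shows "pint p (conv f (molf \<epsilon>)) \<le> pint p f"
  using pint_conv[OF assms(1,2) molf_continuous supp_ball_molf, OF assms(3) assms(3)]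
    integral_abs_molf[OF assms(3), where 'n='n] by simp

lemma ennreal_tendsto_0I:
  fixes X :: "'b \<Rightarrow> ennreal"
  assumes "\<And>e::real. 0 < e \<Longrightarrow> eventually (\<lambda>n. X n \<le> ennreal e) F"
  shows "(X \<longlongrightarrow> 0) F"
proof (rule order_tendstoI)
  fix a :: ennreal assume "0 < a"
  then obtain b where b: "0 < b" "b < a" using dense by blast
  then have "b < top" using less_le_trans[of b a top] by simp
  then obtain e where e: "b = ennreal e" "0 < e" using b(1) by (cases b) auto
  show "eventually (\<lambda>n. X n < a) F"
    using assms[OF e(2)] by eventually_elim (use b e in auto)
qed auto

lemma ennreal_tendsto_0D:
  fixes X :: "'b \<Rightarrow> ennreal" and e :: real
  assumes "(X \<longlongrightarrow> 0) F" "0 < e"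
  shows "eventually (\<lambda>n. X n \<le> ennreal e) F"
  using assms order_tendstoD(2)[of X 0 F "ennreal e"] by (auto elim!: eventually_mono)

lemma pint_indicator_finite:
  assumes "0 < p"
  shows "pint p (\<lambda>x::'a::euclidean_space. c * indicator (cball 0 R) x) < top"
proof -
  have "pint p (\<lambda>x::'a. c * indicator (cball 0 R) x) =
     (\<integral>\<^sup>+x. ennreal (\<bar>c\<bar> powr p) * indicator (cball 0 R) x \<partial>(lborel :: 'a measure))"
    unfolding pint_def using assms by (intro nn_integral_cong) (auto simp: indicator_def)
  also have "\<dots> < top"
    using emeasure_bounded_finite[of "cball 0 R :: 'a set"]
    by (simp add: nn_integral_cmult_indicator ennreal_mult_less_top)
  finally show ?thesis .
qed

text \<open>Continuous functions of compact support are dense in \<open>L\<^sup>p\<close>: truncate the values, then multiply continuous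
  functions converging almost everywhere (which exist by measurability) by a cutoff and use dominated convergence.\<close>

lemma pint_dense_continuous:
  fixes f :: "'a::euclidean_space \<Rightarrow> real"
  assumes f[measurable]: "f \<in> borel_measurable borel" and p: "1 \<le> p" and fin: "pint p f < \<infinity>"
    and R: "supp_ball R f" and e: "0 < (e::real)"
  shows "\<exists>g. continuous_on UNIV g \<and> supp_ball (R + 1) g \<and> pint p (\<lambda>x. f x - g x) \<le> ennreal e"
proof -
  define e' where "e' = e / (2 * 2 powr p)"
  have e': "e' > 0" using e by (simp add: e'_def)
  define cl where "cl M t = max (- real M) (min (real M) t)" for M t
  have "(\<lambda>n. pint p (\<lambda>x. f x - cl n (f x))) \<longlonglongrightarrow> 0"
  proof (rule pint_tendsto_0_dominated[OF _ f _ _ _ fin])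
    show "(\<lambda>x. f x - cl n (f x)) \<in> borel_measurable borel" for n unfolding cl_def by measurable
    have "\<forall>\<^sub>F n in sequentially. f x - cl n (f x) = 0" for x
      using eventually_ge_at_top[of "nat \<lceil>\<bar>f x\<bar>\<rceil>"]
    proof eventually_elim
      case (elim n) then have "\<bar>f x\<bar> \<le> real n" by linarith
      then show ?case by (auto simp: cl_def)
    qed
    then show "AE x in lborel. (\<lambda>n. f x - cl n (f x)) \<longlonglongrightarrow> 0"
      by (intro AE_I2 tendsto_eventually)
    show "AE x in lborel. \<bar>f x - cl n (f x)\<bar> \<le> \<bar>f x\<bar>" for n by (auto simp: cl_def)
  qed (use p in auto)
  from eventually_happens[OF ennreal_tendsto_0D[OF this e']]
  obtain M where M: "pint p (\<lambda>x. f x - cl M (f x)) \<le> ennreal e'" by auto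
  have "f measurable_on UNIV"
    by (rule lebesgue_measurable_imp_measurable_on) (auto intro: measurable_completion)
  then obtain N g where N: "negligible N" and g: "\<And>n. continuous_on UNIV (g n)"
    and lim: "\<And>x. x \<notin> N \<Longrightarrow> (\<lambda>n. g n x) \<longlonglongrightarrow> f x"
    unfolding measurable_on_def by auto
  have "AE x in lebesgue. x \<notin> N" using N by (simp add: negligible_iff_null_sets AE_not_in)
  then have "AE x in lebesgue. (\<lambda>n. g n x) \<longlonglongrightarrow> f x" by eventually_elim (rule lim)
  then have ae: "AE x in lborel. (\<lambda>n. g n x) \<longlonglongrightarrow> f x" by (simp only: AE_completion_iff)
  define \<theta> where "\<theta> x = max 0 (min 1 (R + 1 - norm x))" for x :: 'a
  define h where "h n x = \<theta> x * cl M (g n x)" for n x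
  have ch: "continuous_on UNIV (h n)" for n
    unfolding h_def \<theta>_def cl_def by (intro continuous_intros g)
  have sh: "supp_ball (R + 1) (h n)" for n by (auto simp: supp_ball_def h_def \<theta>_def)
  note [measurable] = borel_measurable_continuous[OF ch]
  have [measurable]: "(\<lambda>x. cl M (f x)) \<in> borel_measurable borel" unfolding cl_def by measurable
  have bcl: "\<bar>cl M t\<bar> \<le> real M" for t by (auto simp: cl_def)
  have "(\<lambda>n. pint p (\<lambda>x. cl M (f x) - h n x)) \<longlonglongrightarrow> 0"
  proof (rule pint_tendsto_0_dominated[where W = "\<lambda>x. (2 * real M) * indicator (cball 0 (R + 1)) x"])
    show "AE x in lborel. (\<lambda>n. cl M (f x) - h n x) \<longlonglongrightarrow> 0"
      using ae
    proof eventually_elim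
      case (elim x)
      have "(\<lambda>n. cl M (f x) - h n x) \<longlonglongrightarrow> cl M (f x) - \<theta> x * cl M (f x)"
        unfolding h_def cl_def by (intro tendsto_intros elim)
      also have "cl M (f x) - \<theta> x * cl M (f x) = 0"
        using R by (cases "norm x \<le> R") (auto simp: \<theta>_def supp_ball_def cl_def)
      finally show ?case .
    qed
    show "AE x in lborel. \<bar>cl M (f x) - h n x\<bar> \<le> \<bar>(2 * real M) * indicator (cball 0 (R + 1)) x\<bar>" for n
    proof (rule AE_I2)
      fix x
      show "\<bar>cl M (f x) - h n x\<bar> \<le> \<bar>(2 * real M) * indicator (cball 0 (R + 1)) x\<bar>"
      proof (cases "norm x \<le> R + 1")
        case True
        have "\<bar>\<theta> x * cl M (g n x)\<bar> \<le> 1 * real M"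
          unfolding abs_mult by (intro mult_mono bcl) (auto simp: \<theta>_def)
        then show ?thesis using True bcl[of "f x"] abs_triangle_ineq4[of "cl M (f x)" "h n x"] by (simp add: h_def)
      next
        case False
        then show ?thesis using supp_ballD[OF sh, of x n] supp_ballD[OF R, of x] by (simp add: cl_def)
      qed
    qed
  qed (use p in \<open>auto intro!: pint_indicator_finite\<close>)
  from eventually_happens[OF ennreal_tendsto_0D[OF this e']]
  obtain n where n: "pint p (\<lambda>x. cl M (f x) - h n x) \<le> ennreal e'" by auto
  have "pint p (\<lambda>x. f x - h n x) = pint p (\<lambda>x. (f x - cl M (f x)) + (cl M (f x) - h n x))" by simp
  also have "\<dots> \<le> ennreal (2 powr p) * (pint p (\<lambda>x. f x - cl M (f x)) + pint p (\<lambda>x. cl M (f x) - h n x))"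
    by (rule pint_add) (use p in auto)
  also have "\<dots> \<le> ennreal (2 powr p) * (ennreal e' + ennreal e')"
    by (intro mult_left_mono add_mono M n) auto
  also have "\<dots> = ennreal e"
    using e' by (subst ennreal_plus[symmetric]) (auto simp: ennreal_mult[symmetric] e'_def)
  finally show ?thesis using ch sh by blast
qed

text \<open>A mollified value is an average. With \<open>c = 0\<close> this says that mollification preserves bounds.\<close>

lemma conv_molf_close:
  fixes f :: "real ^ 'n::finite \<Rightarrow> real"
  assumes f: "locint f" and \<epsilon>: "0 < \<epsilon>" and cl: "\<And>z. norm (x - z) \<le> \<epsilon> \<Longrightarrow> \<bar>f z - c\<bar> \<le> e"
  shows "\<bar>conv f (molf \<epsilon>) x - c\<bar> \<le> e"
proof -
  let ?m = "\<lambda>z. molf \<epsilon> (x - z)"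
  have i1: "integrable lborel (\<lambda>z. f z * ?m z)"
    by (rule conv_integrable[OF f molf_continuous supp_ball_molf]) fact+
  have i2: "integrable lborel ?m"
    by (rule integrable_continuous_supp[OF continuous_reflect[OF molf_continuous] supp_ball_reflect[OF supp_ball_molf]]) fact+
  have one: "(\<integral>z. ?m z \<partial>lborel) = 1"
    using integral_lborel_reflect[of "molf \<epsilon>" x] integral_molf[OF \<epsilon>, where 'n='n]
      borel_measurable_continuous[OF molf_continuous[OF \<epsilon>]] by simp
  have "conv f (molf \<epsilon>) x - c = (\<integral>z. f z * ?m z - c * ?m z \<partial>lborel)"
    using i1 i2 one by (simp add: conv_def)
  also have "\<bar>\<dots>\<bar> \<le> (\<integral>z. e * ?m z \<partial>lborel)"
  proof (rule integral_abs_bound_integral)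
    fix z
    have "\<bar>f z * ?m z - c * ?m z\<bar> = \<bar>f z - c\<bar> * ?m z"
      using molf_nonneg[OF \<epsilon>, of "x - z"] by (simp add: abs_mult flip: left_diff_distrib)
    also have "\<dots> \<le> e * ?m z"
      using cl[of z] molf_nonneg[OF \<epsilon>, of "x - z"] supp_ballD[OF supp_ball_molf[OF \<epsilon>], of "x - z"]
      by (cases "norm (x - z) \<le> \<epsilon>") (auto intro: mult_right_mono)
    finally show "\<bar>f z * ?m z - c * ?m z\<bar> \<le> e * ?m z" .
  qed (use i1 i2 in auto)
  also have "\<dots> = e" using one by simp
  finally show ?thesis .
qed

text \<open>The sequence of mollifiers with radii \<open>1 / (n + 1)\<close>.\<close>

abbreviation mo :: "nat \<Rightarrow> real ^ 'n::finite \<Rightarrow> real" where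
  "mo n \<equiv> molf (inverse (real (Suc n)))"

lemma Lp_mollify:
  fixes f :: "real ^ 'n::finite \<Rightarrow> real"
  assumes f[measurable]: "f \<in> borel_measurable borel" and p: "1 \<le> p" and fin: "pint p f < \<infinity>"
    and R: "supp_ball R f"
  shows "(\<lambda>n. pint p (\<lambda>x. conv f (mo n) x - f x)) \<longlonglongrightarrow> 0"
proof (rule ennreal_tendsto_0I)
  fix e :: real assume e: "0 < e"
  have lf: "locint f" by (rule pint_finite_locint[OF f p fin])
  define e' where "e' = e / (3 * 4 powr p)"
  have e': "e' > 0" using e by (simp add: e'_def)
  obtain g where g: "continuous_on UNIV g" "supp_ball (R + 1) g" "pint p (\<lambda>x. f x - g x) \<le> ennreal e'"
    using pint_dense_continuous[OF f p fin R e'] by blast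
  have lg: "locint g" by (rule locint_continuous[OF g(1)])
  note [measurable] = borel_measurable_continuous[OF g(1)]
  obtain M where M: "\<And>x. \<bar>g x\<bar> \<le> M" using supp_ball_bounded[OF g(1,2)] by blast
  have pos: "0 < inverse (real (Suc n))" for n by simp
  have cg: "continuous_on UNIV (conv h (mo n))" if "locint h" for h n
    by (rule conv_continuous[OF that molf_continuous supp_ball_molf]) auto
  note [measurable] = borel_measurable_continuous[OF cg]
  have "(\<lambda>n. pint p (\<lambda>x. conv g (mo n) x - g x)) \<longlonglongrightarrow> 0"
  proof (rule pint_tendsto_0_dominated[where W = "\<lambda>x. (2 * M) * indicator (cball 0 (R + 2)) x"])
    show "AE x in lborel. (\<lambda>n. conv g (mo n) x - g x) \<longlonglongrightarrow> 0"
    proof (rule AE_I2, rule LIMSEQ_I)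
      fix x and r :: real assume r: "0 < r"
      obtain d where d: "d > 0" "\<And>x y. norm (x - y) < d \<Longrightarrow> \<bar>g x - g y\<bar> < r / 2"
        using uniformly_continuous_supp[OF g(1,2), of "r/2"] r by auto
      obtain N where N: "inverse (real (Suc N)) < d" using reals_Archimedean[OF d(1)] by blast
      have "norm (conv g (mo n) x - g x - 0) < r" if "N \<le> n" for n
      proof -
        have "inverse (real (Suc n)) \<le> inverse (real (Suc N))" using that by (intro le_imp_inverse_le) auto
        then have "\<bar>g z - g x\<bar> \<le> r / 2" if "norm (x - z) \<le> inverse (real (Suc n))" for z
          using N d(2)[of z x] that norm_minus_commute[of x z] by linarith
        then have "\<bar>conv g (mo n) x - g x\<bar> \<le> r / 2"
          by (rule conv_molf_close[OF lg pos])
        then show ?thesis using r by simp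
      qed
      then show "\<exists>no. \<forall>n\<ge>no. norm (conv g (mo n) x - g x - 0) < r" by blast
    qed
    show "AE x in lborel. \<bar>conv g (mo n) x - g x\<bar> \<le> \<bar>(2 * M) * indicator (cball 0 (R + 2)) x\<bar>" for n
    proof (rule AE_I2)
      fix x
      have s: "supp_ball (R + 2) (conv g (mo n))"
        by (rule supp_ball_mono[OF supp_ball_conv[OF g(2) supp_ball_molf[OF pos]]]) (simp add: field_simps)
      have "\<bar>conv g (mo n) x - 0\<bar> \<le> M"
        using M by (intro conv_molf_close[OF lg pos]) auto
      then show "\<bar>conv g (mo n) x - g x\<bar> \<le> \<bar>(2 * M) * indicator (cball 0 (R + 2)) x\<bar>"
        using M[of x] supp_ballD[OF s, of x] supp_ballD[OF g(2), of x] by (cases "norm x \<le> R + 2") auto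
    qed
    show "(\<lambda>x. conv g (mo n) x - g x) \<in> borel_measurable borel" for n
      using lg by measurable
  qed (use p in \<open>auto intro!: pint_indicator_finite\<close>)
  from ennreal_tendsto_0D[OF this e']
  show "\<forall>\<^sub>F n in sequentially. pint p (\<lambda>x. conv f (mo n) x - f x) \<le> ennreal e"
  proof eventually_elim
    case (elim n)
    have lfg: "locint (\<lambda>x. f x - g x)" by (rule locint_diff[OF lf lg])
    have "conv (\<lambda>x. f x - g x) (mo n) x = conv f (mo n) x - conv g (mo n) x" for x
      unfolding conv_def using conv_integrable[OF lf molf_continuous supp_ball_molf, OF pos pos]
        conv_integrable[OF lg molf_continuous supp_ball_molf, OF pos pos]
      by (simp add: left_diff_distrib)
    then have "pint p (\<lambda>x. conv f (mo n) x - f x) =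
       pint p (\<lambda>x. conv (\<lambda>x. f x - g x) (mo n) x + (conv g (mo n) x - g x) + (g x - f x))" by simp
    also have "\<dots> \<le> ennreal (4 powr p) * (pint p (conv (\<lambda>x. f x - g x) (mo n)) +
        pint p (\<lambda>x. conv g (mo n) x - g x) + pint p (\<lambda>x. g x - f x))"
    proof (rule pint_triangle3)
      show "conv (\<lambda>x. f x - g x) (mo n) \<in> borel_measurable borel" using lfg by measurable
      show "(\<lambda>x. conv g (mo n) x - g x) \<in> borel_measurable borel" using lg by measurable
    qed (use p in auto)
    also have "\<dots> \<le> ennreal (4 powr p) * (ennreal e' + ennreal e' + ennreal e')"
    proof (intro mult_left_mono add_mono)
      show "pint p (conv (\<lambda>x. f x - g x) (mo n)) \<le> ennreal e'"
        using pint_conv_molf[OF p lfg pos] g(3) by (rule order_trans)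
      show "pint p (\<lambda>x. g x - f x) \<le> ennreal e'"
        using g(3) pint_minus[of p "\<lambda>x. f x - g x"] by simp
    qed (use elim in auto)
    also have "ennreal e' + ennreal e' + ennreal e' = ennreal (3 * e')"
      using e' by (simp flip: ennreal_plus)
    also have "ennreal (4 powr p) * \<dots> = ennreal e"
      using e' by (auto simp: ennreal_mult[symmetric] e'_def)
    finally show ?case .
  qed
qed

lemma conv_cong_local:
  assumes "\<And>z. norm z \<le> norm x + r \<Longrightarrow> f z = g z" "supp_ball r \<sigma>"
  shows "conv f \<sigma> x = conv g \<sigma> x"
proof -
  have "f z * \<sigma> (x - z) = g z * \<sigma> (x - z)" for z
    using assms(1)[of z] supp_ballD[OF supp_ball_reflect[OF assms(2)], of x z]
    by (cases "norm z \<le> norm x + r") auto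
  then have "(\<lambda>z. f z * \<sigma> (x - z)) = (\<lambda>z. g z * \<sigma> (x - z))" by blast
  then show ?thesis unfolding conv_def by (simp only:)
qed

lemma Lp_mollify_local:
  fixes f :: "real ^ 'n::finite \<Rightarrow> real"
  assumes f[measurable]: "f \<in> borel_measurable borel" and p: "1 \<le> p"
    and fin: "pint p (\<lambda>x. indicator (cball 0 (R + 1)) x * f x) < \<infinity>"
  shows "(\<lambda>n. pint p (\<lambda>x. indicator (cball 0 R) x * (conv f (mo n) x - f x))) \<longlonglongrightarrow> 0"
proof (rule tendsto_sandwich[OF _ _ tendsto_const])
  let ?g = "\<lambda>x. indicator (cball 0 (R + 1)) x * f x"
  show "(\<lambda>n. pint p (\<lambda>x. conv ?g (mo n) x - ?g x)) \<longlonglongrightarrow> 0"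
    by (rule Lp_mollify[OF _ p fin, where R = "R + 1"]) (auto simp: supp_ball_def)
  have "conv f (mo n) x = conv ?g (mo n) x" if "norm x \<le> R" for n x
  proof (rule conv_cong_local[OF _ supp_ball_molf])
    fix z :: "real ^ 'n" assume "norm z \<le> norm x + inverse (real (Suc n))"
    moreover have "inverse (real (Suc n)) \<le> 1" by (simp add: field_simps)
    ultimately show "f z = ?g z" using that by (simp add: indicator_def)
  qed simp
  then have "\<bar>indicator (cball 0 R) x * (conv f (mo n) x - f x)\<bar> \<le> \<bar>conv ?g (mo n) x - ?g x\<bar>" for n x
    by (auto simp: indicator_def)
  then show "\<forall>\<^sub>F n in sequentially. pint p (\<lambda>x. indicator (cball 0 R) x * (conv f (mo n) x - f x)) \<le>
      pint p (\<lambda>x. conv ?g (mo n) x - ?g x)"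
    using p by (intro always_eventually allI pint_mono) auto
qed auto

lemma pint_1: "pint 1 f = (\<integral>\<^sup>+x. ennreal \<bar>f x\<bar> \<partial>lborel)"
  by (simp add: pint_def)

lemma integrable_iff_pint_1:
  "f \<in> borel_measurable borel \<Longrightarrow> integrable lborel f \<longleftrightarrow> pint 1 f < \<infinity>"
  by (simp add: integrable_iff_bounded pint_1)

lemma pint_1_tendsto_integral:
  fixes f :: "nat \<Rightarrow> 'a::euclidean_space \<Rightarrow> real"
  assumes [measurable]: "\<And>n. f n \<in> borel_measurable borel" "g \<in> borel_measurable borel"
    and fi: "\<And>n. integrable lborel (f n)" and gi: "integrable lborel g"
    and lim: "(\<lambda>n. pint 1 (\<lambda>x. f n x - g x)) \<longlonglongrightarrow> 0"
  shows "(\<lambda>n. \<integral>x. f n x \<partial>lborel) \<longlonglongrightarrow> (\<integral>x. g x \<partial>lborel)"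
proof (rule tendsto_L1_int[OF fi gi])
  show "(\<lambda>n. \<integral>\<^sup>+x. ennreal (norm (f n x - g x)) \<partial>lborel) \<longlonglongrightarrow> 0"
    using lim by (simp add: pint_1)
qed

lemma pint_AE_subseq:
  fixes f :: "nat \<Rightarrow> 'a::euclidean_space \<Rightarrow> real"
  assumes [measurable]: "\<And>n. f n \<in> borel_measurable borel" and p: "0 < p"
    and lim: "(\<lambda>n. pint p (f n)) \<longlonglongrightarrow> 0"
  shows "\<exists>r. strict_mono r \<and> (AE x in lborel. (\<lambda>n. f (r n) x) \<longlonglongrightarrow> 0)"
proof -
  obtain N where N: "\<And>n. n \<ge> N \<Longrightarrow> pint p (f n) < 1"
    using order_tendstoD(2)[OF lim, of 1] by (auto simp: eventually_sequentially)
  define u where "u n x = \<bar>f (n + N) x\<bar> powr p" for n x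
  have [measurable]: "u n \<in> borel_measurable borel" for n unfolding u_def by measurable
  have pu: "(\<integral>\<^sup>+x. ennreal (u n x) \<partial>lborel) = pint p (f (n + N))" for n by (simp add: u_def pint_def)
  have int: "integrable lborel (u n)" for n
  proof (rule integrableI_nonneg)
    show "(\<integral>\<^sup>+x. ennreal (u n x) \<partial>lborel) < \<infinity>" unfolding pu using N[of "n + N"] by (auto intro: less_le_trans)
  qed (auto simp: u_def)
  have "(\<lambda>n. \<integral>x. norm (u n x) \<partial>lborel) \<longlonglongrightarrow> 0"
  proof -
    have "ennreal (\<integral>x. norm (u n x) \<partial>lborel) = pint p (f (n + N))" for n
      using nn_integral_eq_integral[OF int, of n] pu[of n] by (simp add: u_def[abs_def])
    moreover have "(\<lambda>n. pint p (f (n + N))) \<longlonglongrightarrow> 0" using lim by (rule LIMSEQ_ignore_initial_segment)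
    ultimately show ?thesis by (subst ennreal_tendsto_0_iff[symmetric]) auto
  qed
  from tendsto_L1_AE_subseq[OF int this]
  obtain r where r: "strict_mono r" "AE x in lborel. (\<lambda>n. u (r n) x) \<longlonglongrightarrow> 0" by blast
  have "AE x in lborel. (\<lambda>n. f (r n + N) x) \<longlonglongrightarrow> 0"
    using r(2)
  proof eventually_elim
    case (elim x)
    have "(\<lambda>n. u (r n) x powr (1 / p)) \<longlonglongrightarrow> 0 powr (1 / p)"
      using elim p by (intro tendsto_powr' tendsto_const) (auto simp: u_def)
    then show ?case using p by (simp add: u_def powr_powr tendsto_rabs_zero_iff)
  qed
  moreover have "strict_mono (\<lambda>n. r n + N)" using r(1) by (auto simp: strict_mono_def)
  ultimately show ?thesis by blast
qed

section \<open>Weak partial derivatives: chain and product rule\<close>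

lemma mo_pos: "0 < inverse (real (Suc n))" by simp

lemma weakd_locint: "weakd i u g \<Longrightarrow> locint u" "weakd i u g \<Longrightarrow> locint g"
  by (auto simp: weakd_def)

lemma weakd_measurable:
  "weakd i u g \<Longrightarrow> u \<in> borel_measurable borel" "weakd i u g \<Longrightarrow> g \<in> borel_measurable borel"
  by (auto simp: weakd_def locint_def)

lemma locint_pint_finite: "locint f \<Longrightarrow> pint 1 (\<lambda>x. indicator (cball 0 R) x * f x) < \<infinity>"
  by (subst integrable_iff_pint_1[symmetric]) (auto simp: locint_def)

lemma Ck_mollify: "locint u \<Longrightarrow> Ck k (conv u (mo n))"
  by (rule Ck_conv[OF _ test_functionsD(1)[OF molf_test] supp_ball_molf]) auto

lemma weakd_C1:
  assumes "Ck (Suc 0) f"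
  shows "weakd i f (partial_deriv i f)"
proof -
  have cf: "continuous_on UNIV f" using Ck_continuous[OF assms] .
  have cp: "continuous_on UNIV (partial_deriv i f)" and d: "\<And>x. f differentiable (at x)" using assms by auto
  have "(\<integral>x. partial_deriv i f x * \<eta> x \<partial>lborel) = - (\<integral>x. f x * partial_deriv i \<eta> x \<partial>lborel)"
    if \<eta>: "\<eta> \<in> test_functions" for \<eta>
  proof -
    obtain R where R: "supp_ball R \<eta>" using test_functionsD(4)[OF \<eta>] by blast
    note \<eta>' = test_functionsD[OF \<eta>] test_functionsD(2)[OF test_functions_partial_deriv[OF \<eta>]]
    have i1: "integrable lborel (\<lambda>x. partial_deriv i f x * \<eta> x)"
      by (rule locint_integrable_mult_cont[OF locint_continuous[OF cp] \<eta>'(2) R])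
    have i2: "integrable lborel (\<lambda>x. f x * partial_deriv i \<eta> x)"
      by (rule locint_integrable_mult_cont[OF locint_continuous[OF cf] \<eta>'(5) supp_ball_partial_deriv[OF R]])
    have "(\<integral>x. partial_deriv i (\<lambda>x. f x * \<eta> x) x \<partial>lborel) = 0"
      by (rule integral_partial_deriv_eq_0[OF Ck_mult[OF assms \<eta>'(1)], of R]) (use R in \<open>auto simp: supp_ball_def\<close>)
    then show ?thesis using i1 i2 d \<eta>'(3) by (simp add: partial_deriv_mult add_eq_0_iff)
  qed
  then show ?thesis using locint_continuous[OF cf] locint_continuous[OF cp] by (auto simp: weakd_def)
qed

lemma integral_mult_tendsto:
  fixes f :: "nat \<Rightarrow> real ^ 'n::finite \<Rightarrow> real"
  assumes f: "\<And>n. locint (f n)" and g: "locint g" and c: "continuous_on UNIV \<sigma>" and R: "supp_ball R \<sigma>"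
    and lim: "(\<lambda>n. pint 1 (\<lambda>x. indicator (cball 0 R) x * (f n x - g x))) \<longlonglongrightarrow> 0"
  shows "(\<lambda>n. \<integral>x. f n x * \<sigma> x \<partial>lborel) \<longlonglongrightarrow> (\<integral>x. g x * \<sigma> x \<partial>lborel)"
proof (rule pint_1_tendsto_integral)
  note [measurable] = locint_measurable[OF f] locint_measurable[OF g] borel_measurable_continuous[OF c]
  show "(\<lambda>x. f n x * \<sigma> x) \<in> borel_measurable borel" "(\<lambda>x. g x * \<sigma> x) \<in> borel_measurable borel" for n
    by measurable
  show "integrable lborel (\<lambda>x. f n x * \<sigma> x)" "integrable lborel (\<lambda>x. g x * \<sigma> x)" for n
    using f g c R by (auto intro: locint_integrable_mult_cont)
  obtain M where M: "M > 0" "\<And>x. \<bar>\<sigma> x\<bar> \<le> M" using supp_ball_bounded[OF c R] by blast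
  show "(\<lambda>n. pint 1 (\<lambda>x. f n x * \<sigma> x - g x * \<sigma> x)) \<longlonglongrightarrow> 0"
  proof (rule pint_tendsto_0_bound[where c = M, OF _ _ _ _ lim])
    fix n x
    have "\<bar>f n x * \<sigma> x - g x * \<sigma> x\<bar> = \<bar>f n x - g x\<bar> * \<bar>\<sigma> x\<bar>" by (simp add: abs_mult flip: left_diff_distrib)
    also have "\<dots> \<le> M * \<bar>indicator (cball 0 R) x * (f n x - g x)\<bar>"
    proof (cases "norm x \<le> R")
      case True
      then show ?thesis using mult_left_mono[OF M(2)[of x], of "\<bar>f n x - g x\<bar>"] by (simp add: mult.commute)
    next
      case False
      then show ?thesis using supp_ballD[OF R, of x] by simp
    qed
    finally show "\<bar>f n x * \<sigma> x - g x * \<sigma> x\<bar> \<le> M * \<bar>indicator (cball 0 R) x * (f n x - g x)\<bar>" .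
  qed (use M in auto)
qed

text \<open>Weak derivatives are stable under local \<open>L\<^sup>1\<close> convergence. The approximating sequences may depend on the ball.\<close>

lemma weakd_limitI:
  fixes u g :: "real ^ 'n::finite \<Rightarrow> real"
  assumes u: "locint u" and g: "locint g"
    and ex: "\<And>R. 0 < R \<Longrightarrow> \<exists>U G. (\<forall>n::nat. weakd i (U n) (G n)) \<and>
       (\<lambda>n. pint 1 (\<lambda>x. indicator (cball 0 R) x * (U n x - u x))) \<longlonglongrightarrow> 0 \<and>
       (\<lambda>n. pint 1 (\<lambda>x. indicator (cball 0 R) x * (G n x - g x))) \<longlonglongrightarrow> 0"
  shows "weakd i u g"
  unfolding weakd_def
proof (intro conjI ballI u g)
  fix \<eta> :: "real ^ 'n \<Rightarrow> real" assume \<eta>: "\<eta> \<in> test_functions"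
  obtain R where R: "R > 0" "supp_ball R \<eta>" using test_functionsD(4)[OF \<eta>] by blast
  obtain U G where UG: "\<And>n::nat. weakd i (U n) (G n)"
    and U: "(\<lambda>n. pint 1 (\<lambda>x. indicator (cball 0 R) x * (U n x - u x))) \<longlonglongrightarrow> 0"
    and G: "(\<lambda>n. pint 1 (\<lambda>x. indicator (cball 0 R) x * (G n x - g x))) \<longlonglongrightarrow> 0"
    using ex[OF R(1)] by blast
  have 1: "(\<lambda>n. \<integral>x. G n x * \<eta> x \<partial>lborel) \<longlonglongrightarrow> (\<integral>x. g x * \<eta> x \<partial>lborel)"
    by (rule integral_mult_tendsto[OF weakd_locint(2)[OF UG] g test_functionsD(2)[OF \<eta>] R(2) G])
  have 2: "(\<lambda>n. \<integral>x. U n x * partial_deriv i \<eta> x \<partial>lborel) \<longlonglongrightarrow> (\<integral>x. u x * partial_deriv i \<eta> x \<partial>lborel)"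
    by (rule integral_mult_tendsto[OF weakd_locint(1)[OF UG] u test_functionsD(2)[OF test_functions_partial_deriv[OF \<eta>]]
       supp_ball_partial_deriv[OF R(2)] U])
  have eq: "(\<lambda>n. \<integral>x. G n x * \<eta> x \<partial>lborel) = (\<lambda>n. - (\<integral>x. U n x * partial_deriv i \<eta> x \<partial>lborel))"
    using UG \<eta> by (auto simp: weakd_def)
  show "(\<integral>x. g x * \<eta> x \<partial>lborel) = - (\<integral>x. u x * partial_deriv i \<eta> x \<partial>lborel)"
    by (rule LIMSEQ_unique[OF 1[unfolded eq] tendsto_minus[OF 2]])
qed

lemma locint_tendsto_dominated:
  fixes U :: "nat \<Rightarrow> 'a::euclidean_space \<Rightarrow> real"
  assumes [measurable]: "\<And>n. U n \<in> borel_measurable borel" "u \<in> borel_measurable borel" and A: "locint A"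
    and lim: "AE x in lborel. (\<lambda>n. U n x) \<longlonglongrightarrow> u x" and bd: "\<And>n. AE x in lborel. \<bar>U n x\<bar> \<le> \<bar>A x\<bar>"
  shows "locint u" "(\<lambda>n. pint 1 (\<lambda>x. indicator (cball 0 R) x * (U n x - u x))) \<longlonglongrightarrow> 0"
proof -
  note [measurable] = locint_measurable[OF A]
  have "AE x in lborel. \<forall>n. \<bar>U n x\<bar> \<le> \<bar>A x\<bar>" using bd by (simp add: AE_all_countable)
  with lim have ub: "AE x in lborel. \<bar>u x\<bar> \<le> \<bar>A x\<bar>"
  proof eventually_elim
    case (elim x)
    then have "(\<lambda>n. \<bar>U n x\<bar>) \<longlonglongrightarrow> \<bar>u x\<bar>" by (intro tendsto_rabs)
    then show ?case by (rule LIMSEQ_le_const2) (use elim in auto)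
  qed
  show "locint u" by (rule locint_bound[OF A _ ub]) simp
  show "(\<lambda>n. pint 1 (\<lambda>x. indicator (cball 0 R) x * (U n x - u x))) \<longlonglongrightarrow> 0"
  proof (rule pint_tendsto_0_dominated[where W = "\<lambda>x. indicator (cball 0 R) x * (2 * A x)"])
    show "AE x in lborel. (\<lambda>n. indicator (cball 0 R) x * (U n x - u x)) \<longlonglongrightarrow> 0"
      using lim
    proof eventually_elim
      case (elim x)
      have "(\<lambda>n. indicator (cball 0 R) x * (U n x - u x)) \<longlonglongrightarrow> indicator (cball 0 R) x * (u x - u x)"
        by (intro tendsto_intros elim)
      then show ?case by simp
    qed
    show "AE x in lborel. \<bar>indicator (cball 0 R) x * (U n x - u x)\<bar> \<le> \<bar>indicator (cball 0 R) x * (2 * A x)\<bar>" for n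
      using bd[of n] ub by eventually_elim (auto simp: indicator_def)
    show "pint 1 (\<lambda>x. indicator (cball 0 R) x * (2 * A x)) < \<infinity>"
      by (rule locint_pint_finite[OF locint_cmult[OF A]])
  qed auto
qed

lemma weakd_limit_dominated:
  fixes U G :: "nat \<Rightarrow> real ^ 'n::finite \<Rightarrow> real"
  assumes w: "\<And>n. weakd i (U n) (G n)"
    and um: "u \<in> borel_measurable borel" and gm: "g \<in> borel_measurable borel" and A: "locint A" and B: "locint B"
    and U: "AE x in lborel. (\<lambda>n. U n x) \<longlonglongrightarrow> u x" "\<And>n. AE x in lborel. \<bar>U n x\<bar> \<le> \<bar>A x\<bar>"
    and G: "AE x in lborel. (\<lambda>n. G n x) \<longlonglongrightarrow> g x" "\<And>n. AE x in lborel. \<bar>G n x\<bar> \<le> \<bar>B x\<bar>"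
  shows "weakd i u g"
proof (rule weakd_limitI)
  show "locint u" by (rule locint_tendsto_dominated(1)[OF weakd_measurable(1)[OF w] um A U])
  show "locint g" by (rule locint_tendsto_dominated(1)[OF weakd_measurable(2)[OF w] gm B G])
  fix R :: real
  show "\<exists>U G. (\<forall>n::nat. weakd i (U n) (G n)) \<and>
       (\<lambda>n. pint 1 (\<lambda>x. indicator (cball 0 R) x * (U n x - u x))) \<longlonglongrightarrow> 0 \<and>
       (\<lambda>n. pint 1 (\<lambda>x. indicator (cball 0 R) x * (G n x - g x))) \<longlonglongrightarrow> 0"
    by (intro exI[of _ U] exI[of _ G] conjI allI w
        locint_tendsto_dominated(2)[OF weakd_measurable(1)[OF w] um A U]
        locint_tendsto_dominated(2)[OF weakd_measurable(2)[OF w] gm B G])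
qed

text \<open>The constant is stated for the sum norm on the plane.\<close>

lemma Lipschitz_two_variables:
  fixes F Fa Fb :: "real \<times> real \<Rightarrow> real"
  assumes d: "\<And>z. (F has_derivative (\<lambda>h. Fa z * fst h + Fb z * snd h)) (at z)"
    and b: "\<And>z. \<bar>Fa z\<bar> \<le> C" "\<And>z. \<bar>Fb z\<bar> \<le> C"
  shows "\<bar>F (a, b) - F (a', b')\<bar> \<le> C * (\<bar>a - a'\<bar> + \<bar>b - b'\<bar>)"
proof -
  have 1: "\<bar>G t - G s\<bar> \<le> C * \<bar>t - s\<bar>" if "\<And>t. (G has_real_derivative G' t) (at t)" "\<And>t. \<bar>G' t\<bar> \<le> C"
    for G G' and s t :: real
    using field_differentiable_bound[of UNIV G G' C t s] that by auto
  have "((\<lambda>t. F (t, b)) has_real_derivative Fa (t, b)) (at t)" for t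
  proof -
    have "((\<lambda>t. (t, b)) has_derivative (\<lambda>h. (h, 0))) (at t)" by (auto intro!: derivative_eq_intros)
    from has_derivative_compose[OF this d] show ?thesis by (simp add: has_field_derivative_def)
  qed
  from 1[OF this b(1)] have A: "\<bar>F (a, b) - F (a', b)\<bar> \<le> C * \<bar>a - a'\<bar>" .
  have "((\<lambda>t. F (a', t)) has_real_derivative Fb (a', t)) (at t)" for t
  proof -
    have "((\<lambda>t. (a', t)) has_derivative (\<lambda>h. (0, h))) (at t)" by (auto intro!: derivative_eq_intros)
    from has_derivative_compose[OF this d] show ?thesis by (simp add: has_field_derivative_def)
  qed
  from 1[OF this b(2)] have B: "\<bar>F (a', b) - F (a', b')\<bar> \<le> C * \<bar>b - b'\<bar>" .
  show ?thesis using A B by (simp add: distrib_left)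
qed

lemma C1_compose:
  fixes F Fa Fb :: "real \<times> real \<Rightarrow> real" and U V :: "real ^ 'n::finite \<Rightarrow> real"
  assumes d: "\<And>z. (F has_derivative (\<lambda>h. Fa z * fst h + Fb z * snd h)) (at z)"
    and c: "continuous_on UNIV Fa" "continuous_on UNIV Fb"
    and U: "Ck (Suc 0) U" and V: "Ck (Suc 0) V"
  shows "Ck (Suc 0) (\<lambda>x. F (U x, V x))"
    and "partial_deriv i (\<lambda>x. F (U x, V x)) = (\<lambda>x. Fa (U x, V x) * partial_deriv i U x + Fb (U x, V x) * partial_deriv i V x)"
proof -
  have dd: "((\<lambda>x. F (U x, V x)) has_derivative (\<lambda>h. Fa (U x, V x) * frechet_derivative U (at x) h +
     Fb (U x, V x) * frechet_derivative V (at x) h)) (at x)" for x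
  proof -
    have "(U has_derivative frechet_derivative U (at x)) (at x)" "(V has_derivative frechet_derivative V (at x)) (at x)"
      using U V frechet_derivative_works[of U] frechet_derivative_works[of V] by auto
    then have "((\<lambda>x. (U x, V x)) has_derivative (\<lambda>h. (frechet_derivative U (at x) h, frechet_derivative V (at x) h))) (at x)"
      by (rule has_derivative_Pair)
    from has_derivative_compose[OF this d] show ?thesis by simp
  qed
  show p: "partial_deriv i (\<lambda>x. F (U x, V x)) = (\<lambda>x. Fa (U x, V x) * partial_deriv i U x + Fb (U x, V x) * partial_deriv i V x)" for i
    by (rule ext, rule partial_deriv_eq[THEN trans, OF dd]) (simp add: partial_deriv_def)
  have cUV: "continuous_on UNIV (\<lambda>x. (U x, V x))"
    using Ck_continuous[OF U] Ck_continuous[OF V] by (intro continuous_intros)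
  have "continuous_on UNIV (\<lambda>x. Fa (U x, V x))" "continuous_on UNIV (\<lambda>x. Fb (U x, V x))"
    using continuous_on_compose2[OF c(1) cUV] continuous_on_compose2[OF c(2) cUV] by auto
  then show "Ck (Suc 0) (\<lambda>x. F (U x, V x))"
    using U V differentiableI[OF dd] by (auto simp: p intro!: continuous_intros)
qed

text \<open>Chain rule for a \<open>C\<^sup>1\<close> function of two variables with bounded partial derivatives. It is clear for the mollified
  functions; in the limit the values converge almost everywhere along a subsequence and the derivatives in \<open>L\<^sup>1\<^sub>l\<^sub>o\<^sub>c\<close>.\<close>

lemma weakd_chain_rule:
  fixes F Fa Fb :: "real \<times> real \<Rightarrow> real" and u v g h :: "real ^ 'n::finite \<Rightarrow> real"
  assumes d: "\<And>z. (F has_derivative (\<lambda>h. Fa z * fst h + Fb z * snd h)) (at z)"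
    and c: "continuous_on UNIV Fa" "continuous_on UNIV Fb"
    and b: "\<And>z. \<bar>Fa z\<bar> \<le> C" "\<And>z. \<bar>Fb z\<bar> \<le> C"
    and u: "weakd i u g" and v: "weakd i v h"
  shows "weakd i (\<lambda>x. F (u x, v x)) (\<lambda>x. Fa (u x, v x) * g x + Fb (u x, v x) * h x)"
proof (rule weakd_limitI)
  have cF: "continuous_on UNIV F" using d by (meson continuous_at_imp_continuous_on has_derivative_continuous)
  note [measurable] = weakd_measurable[OF u] weakd_measurable[OF v]
    borel_measurable_continuous_onI[OF cF] borel_measurable_continuous_onI[OF c(1)] borel_measurable_continuous_onI[OF c(2)]
  have C: "0 \<le> C" using b(1)[of undefined] by linarith
  have "\<bar>F (u x, v x)\<bar> \<le> \<bar>C * (\<bar>u x\<bar> + \<bar>v x\<bar>) + \<bar>F (0, 0)\<bar>\<bar>" for x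
    using Lipschitz_two_variables[of F Fa Fb C "u x" "v x" 0 0, OF d b] by simp
  then show "locint (\<lambda>x. F (u x, v x))"
    by (intro locint_bound[OF locint_add[OF locint_cmult[OF locint_add[OF locint_abs[OF weakd_locint(1)[OF u]]
          locint_abs[OF weakd_locint(1)[OF v]]], of C] locint_continuous[OF continuous_on_const[of _ "\<bar>F (0,0)\<bar>"]]]]) auto
  show "locint (\<lambda>x. Fa (u x, v x) * g x + Fb (u x, v x) * h x)"
    using b by (intro locint_add locint_mult_bounded[of _ _ C] weakd_locint(2)[OF u] weakd_locint(2)[OF v]) auto
  fix R :: real assume "0 < R"
  define D where "D f n = (\<lambda>x. indicator (cball 0 R) x * (conv f (mo n) x - f x))" for f :: "real ^ 'n \<Rightarrow> real" and n
  have D: "(\<lambda>n. pint 1 (D f n)) \<longlonglongrightarrow> 0" if "locint f" for f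
    unfolding D_def using that locint_measurable[OF that]
    by (intro Lp_mollify_local locint_pint_finite) auto
  have cm[measurable]: "conv f (mo n) \<in> borel_measurable borel" if "locint f" for f :: "real ^ 'n \<Rightarrow> real" and n
    by (rule borel_measurable_continuous[OF Ck_continuous[OF Ck_mollify[OF that]]])
  have Dm[measurable]: "D f n \<in> borel_measurable borel" if "locint f" for f n
    using cm[OF that] locint_measurable[OF that] unfolding D_def by measurable
  note lu = weakd_locint[OF u] and lv = weakd_locint[OF v]
  obtain r where r: "strict_mono r" "AE x in lborel. (\<lambda>n. D u (r n) x) \<longlonglongrightarrow> 0"
    using pint_AE_subseq[OF Dm[OF lu(1)] _ D[OF lu(1)]] by auto
  have "(\<lambda>n. pint 1 (D v (r n))) \<longlonglongrightarrow> 0" using LIMSEQ_subseq_LIMSEQ[OF D[OF lv(1)] r(1)] by (simp add: o_def)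
  from pint_AE_subseq[OF Dm[OF lv(1)] _ this]
  obtain s where s: "strict_mono s" "AE x in lborel. (\<lambda>n. D v (r (s n)) x) \<longlonglongrightarrow> 0" by auto
  define q where "q n = r (s n)" for n
  have q: "strict_mono q" using r(1) s(1) by (simp add: q_def strict_mono_def)
  have lim0: "AE x in lborel. (\<lambda>n. D u (q n) x) \<longlonglongrightarrow> 0 \<and> (\<lambda>n. D v (q n) x) \<longlonglongrightarrow> 0"
    using r(2) s(2)
  proof eventually_elim
    case (elim x)
    then show ?case using LIMSEQ_subseq_LIMSEQ[OF elim(1) s(1)] by (simp add: o_def q_def)
  qed
  define U V where "U n = conv u (mo (q n))" and "V n = conv v (mo (q n))" for n
  define G H where "G n = conv g (mo (q n))" and "H n = conv h (mo (q n))" for n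
  have UV: "Ck (Suc 0) (U n)" "Ck (Suc 0) (V n)" for n
    unfolding U_def V_def by (intro Ck_mollify lu lv)+
  have GH: "partial_deriv i (U n) = G n" "partial_deriv i (V n) = H n" for n
    unfolding U_def V_def G_def H_def
    by (intro partial_deriv_conv_weakd[OF u molf_test] partial_deriv_conv_weakd[OF v molf_test], simp)+
  have [measurable]: "U n \<in> borel_measurable borel" "V n \<in> borel_measurable borel"
    "G n \<in> borel_measurable borel" "H n \<in> borel_measurable borel" for n
    unfolding U_def V_def G_def H_def by (rule cm[OF lu(1)] cm[OF lv(1)] cm[OF lu(2)] cm[OF lv(2)])+
  let ?I = "\<lambda>x. indicator (cball 0 R) x :: real"
  have Dq: "(\<lambda>n. pint 1 (D f (q n))) \<longlonglongrightarrow> 0" if "locint f" for f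
    using LIMSEQ_subseq_LIMSEQ[OF D[OF that] q] by (simp add: o_def)
  have limF: "(\<lambda>n. pint 1 (\<lambda>x. ?I x * (F (U n x, V n x) - F (u x, v x)))) \<longlonglongrightarrow> 0"
  proof (rule pint_tendsto_0_bound[OF _ C])
    show "(\<lambda>n. pint 1 (\<lambda>x. \<bar>D u (q n) x\<bar> + \<bar>D v (q n) x\<bar>)) \<longlonglongrightarrow> 0"
      by (rule pint_tendsto_0_add) (use Dq[OF lu(1)] Dq[OF lv(1)] Dm[OF lu(1)] Dm[OF lv(1)] in \<open>auto simp: pint_1\<close>)
    show "(\<lambda>x. \<bar>D u (q n) x\<bar> + \<bar>D v (q n) x\<bar>) \<in> borel_measurable borel" for n
      using Dm[OF lu(1)] Dm[OF lv(1)] by measurable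
    show "\<bar>?I x * (F (U n x, V n x) - F (u x, v x))\<bar> \<le> C * \<bar>\<bar>D u (q n) x\<bar> + \<bar>D v (q n) x\<bar>\<bar>" for n x
      using Lipschitz_two_variables[OF d b, of "U n x" "V n x" "u x" "v x"] C
      by (auto simp: D_def U_def V_def indicator_def)
  qed simp
  have part: "(\<lambda>n. pint 1 (\<lambda>x. ?I x * (A (U n x, V n x) * conv f (mo (q n)) x - A (u x, v x) * f x))) \<longlonglongrightarrow> 0"
    if A: "continuous_on UNIV A" "\<And>z. \<bar>A z\<bar> \<le> C" and f: "locint f" for A :: "real \<times> real \<Rightarrow> real" and f
  proof -
    note [measurable] = borel_measurable_continuous_onI[OF A(1)] locint_measurable[OF f] cm[OF f] Dm[OF f]
    have 1: "(\<lambda>n. pint 1 (\<lambda>x. A (U n x, V n x) * D f (q n) x)) \<longlonglongrightarrow> 0"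
      by (rule pint_tendsto_0_bound[OF _ C Dm[OF f] _ Dq[OF f]])
        (auto simp: abs_mult intro!: mult_right_mono A(2))
    have 2: "(\<lambda>n. pint 1 (\<lambda>x. ?I x * ((A (U n x, V n x) - A (u x, v x)) * f x))) \<longlonglongrightarrow> 0"
    proof (rule pint_tendsto_0_dominated[where W = "\<lambda>x. ?I x * (2 * C * f x)"])
      show "AE x in lborel. (\<lambda>n. ?I x * ((A (U n x, V n x) - A (u x, v x)) * f x)) \<longlonglongrightarrow> 0"
        using lim0
      proof eventually_elim
        case (elim x)
        show ?case
        proof (cases "norm x \<le> R")
          case True
          then have "(\<lambda>n. U n x - u x) \<longlonglongrightarrow> 0" "(\<lambda>n. V n x - v x) \<longlonglongrightarrow> 0"
            using elim by (auto simp: D_def U_def V_def)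
          then have "(\<lambda>n. (U n x, V n x)) \<longlonglongrightarrow> (u x, v x)"
            by (intro tendsto_Pair) (auto dest: LIM_zero_cancel)
          then have "(\<lambda>n. A (U n x, V n x)) \<longlonglongrightarrow> A (u x, v x)"
            by (rule continuous_on_tendsto_compose[OF A(1)]) auto
          then have "(\<lambda>n. ?I x * ((A (U n x, V n x) - A (u x, v x)) * f x)) \<longlonglongrightarrow> ?I x * ((A (u x, v x) - A (u x, v x)) * f x)"
            by (intro tendsto_intros)
          then show ?thesis by simp
        qed simp
      qed
      show "AE x in lborel. \<bar>?I x * ((A (U n x, V n x) - A (u x, v x)) * f x)\<bar> \<le> \<bar>?I x * (2 * C * f x)\<bar>" for n
      proof (rule AE_I2)
        fix x
        have "\<bar>A (U n x, V n x) - A (u x, v x)\<bar> \<le> \<bar>2 * C\<bar>"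
          using A(2)[of "(U n x, V n x)"] A(2)[of "(u x, v x)"] C by simp
        then show "\<bar>?I x * ((A (U n x, V n x) - A (u x, v x)) * f x)\<bar> \<le> \<bar>?I x * (2 * C * f x)\<bar>"
          unfolding abs_mult by (intro mult_left_mono mult_right_mono) (auto simp: abs_mult)
      qed
      show "pint 1 (\<lambda>x. ?I x * (2 * C * f x)) < \<infinity>"
        by (rule locint_pint_finite[OF locint_cmult[OF f]])
    qed auto
    have "(\<lambda>n. pint 1 (\<lambda>x. A (U n x, V n x) * D f (q n) x + ?I x * ((A (U n x, V n x) - A (u x, v x)) * f x))) \<longlonglongrightarrow> 0"
      by (rule pint_tendsto_0_add[OF _ _ _ 1 2]) auto
    then show ?thesis by (simp add: D_def algebra_simps)
  qed
  have limG: "(\<lambda>n. pint 1 (\<lambda>x. ?I x * ((Fa (U n x, V n x) * G n x + Fb (U n x, V n x) * H n x) - (Fa (u x, v x) * g x + Fb (u x, v x) * h x)))) \<longlonglongrightarrow> 0"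
  proof -
    have "(\<lambda>n. pint 1 (\<lambda>x. ?I x * (Fa (U n x, V n x) * G n x - Fa (u x, v x) * g x) + ?I x * (Fb (U n x, V n x) * H n x - Fb (u x, v x) * h x))) \<longlonglongrightarrow> 0"
    proof (rule pint_tendsto_0_add)
      show "(\<lambda>x. ?I x * (Fa (U n x, V n x) * G n x - Fa (u x, v x) * g x)) \<in> borel_measurable borel"
        "(\<lambda>x. ?I x * (Fb (U n x, V n x) * H n x - Fb (u x, v x) * h x)) \<in> borel_measurable borel" for n
        by measurable
    qed (use part[OF c(1) b(1) lu(2)] part[OF c(2) b(2) lv(2)] in \<open>simp_all add: G_def H_def\<close>)
    then show ?thesis by (simp add: algebra_simps)
  qed
  have "weakd i (\<lambda>x. F (U n x, V n x)) (\<lambda>x. Fa (U n x, V n x) * G n x + Fb (U n x, V n x) * H n x)" for n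
    using weakd_C1[OF C1_compose(1)[OF d c UV(1)[of n] UV(2)[of n]], of i] C1_compose(2)[OF d c UV(1)[of n] UV(2)[of n], of i]
    by (simp add: GH)
  then show "\<exists>U' G'. (\<forall>n::nat. weakd i (U' n) (G' n)) \<and>
       (\<lambda>n. pint 1 (\<lambda>x. ?I x * (U' n x - F (u x, v x)))) \<longlonglongrightarrow> 0 \<and>
       (\<lambda>n. pint 1 (\<lambda>x. ?I x * (G' n x - (Fa (u x, v x) * g x + Fb (u x, v x) * h x)))) \<longlonglongrightarrow> 0"
    using limF limG
    by (intro exI[of _ "\<lambda>n x. F (U n x, V n x)"]
        exI[of _ "\<lambda>n x. Fa (U n x, V n x) * G n x + Fb (U n x, V n x) * H n x"] conjI allI)
qed

lemma weakd_diff: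
  assumes u: "weakd i u g" and v: "weakd i v h"
  shows "weakd i (\<lambda>x. u x - v x) (\<lambda>x. g x - h x)"
proof -
  have "weakd i (\<lambda>x. (\<lambda>z. fst z - snd z) (u x, v x)) (\<lambda>x. (\<lambda>_. 1) (u x, v x) * g x + (\<lambda>_. -1) (u x, v x) * h x)"
    by (rule weakd_chain_rule[OF _ _ _ _ _ u v, where C = 1])
      (auto intro!: has_derivative_diff has_derivative_fst has_derivative_snd)
  then show ?thesis by simp
qed

text \<open>The smooth truncation \<open>T\<^sub>k(t) = (k + 1) arctan (t / (k + 1))\<close> and its derivative. It is bounded, is dominated by \<open>|t|\<close>
  and converges to the identity; moreover \<open>T\<^sub>k' \<le> 1\<close> and \<open>T\<^sub>k'(t) t\<close> is bounded for each \<open>k\<close>.\<close>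

definition trunc :: "nat \<Rightarrow> real \<Rightarrow> real" where
  "trunc k t = real (Suc k) * arctan (t / real (Suc k))"

definition trunc' :: "nat \<Rightarrow> real \<Rightarrow> real" where
  "trunc' k t = 1 / (1 + (t / real (Suc k))\<^sup>2)"

lemma DERIV_trunc: "(trunc k has_real_derivative trunc' k t) (at t)"
proof -
  have "real (Suc k) \<noteq> 0" by simp
  then show ?thesis unfolding trunc_def[abs_def] trunc'_def
    by (auto intro!: derivative_eq_intros simp del: of_nat_Suc simp: inverse_eq_divide)
qed

lemma trunc_bound: "\<bar>trunc k t\<bar> \<le> 2 * real (Suc k)"
proof -
  have "\<bar>arctan (t / real (Suc k))\<bar> \<le> 2"
    using arctan_bounded[of "t / real (Suc k)"] pi_half_less_two by auto
  then have "real (Suc k) * \<bar>arctan (t / real (Suc k))\<bar> \<le> real (Suc k) * 2" by (intro mult_left_mono) auto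
  then show ?thesis by (simp add: trunc_def abs_mult)
qed

lemma trunc'_pos: "0 < trunc' k t"
  by (auto simp: trunc'_def intro!: divide_pos_pos add_pos_nonneg)

lemma trunc'_le: "trunc' k t \<le> 1"
proof -
  have "0 < 1 + (t / real (Suc k))\<^sup>2" by (intro add_pos_nonneg) auto
  then show ?thesis unfolding trunc'_def by (subst divide_le_eq_1_pos) auto
qed

lemma trunc_le: "\<bar>trunc k t\<bar> \<le> \<bar>t\<bar>"
proof -
  have "\<bar>trunc k t - trunc k 0\<bar> \<le> 1 * \<bar>t - 0\<bar>"
    using field_differentiable_bound[of UNIV "trunc k" "trunc' k" 1 t 0] DERIV_trunc
      trunc'_pos[of k] trunc'_le[of k] by (auto simp: abs_of_pos)
  then show ?thesis by (simp add: trunc_def)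
qed

lemma trunc'_mult_le: "\<bar>trunc' k t * t\<bar> \<le> real (Suc k)"
proof -
  have "2 * \<bar>s\<bar> \<le> 1 + s\<^sup>2" for s :: real using zero_le_power2[of "\<bar>s\<bar> - 1"] by (simp add: power2_diff)
  then have "\<bar>s\<bar> \<le> 1 * (1 + s\<^sup>2)" for s :: real by (smt (verit))
  then have "\<bar>s\<bar> / (1 + s\<^sup>2) \<le> 1" for s :: real
    by (subst divide_le_eq) (auto intro: add_pos_nonneg)
  from this[of "t / real (Suc k)"] have "\<bar>t\<bar> / real (Suc k) / (1 + (t / real (Suc k))\<^sup>2) \<le> 1" by (simp del: of_nat_Suc)
  then have "real (Suc k) * (\<bar>t\<bar> / real (Suc k) / (1 + (t / real (Suc k))\<^sup>2)) \<le> real (Suc k) * 1"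
    by (intro mult_left_mono) auto
  then show ?thesis by (simp add: trunc'_def abs_mult del: of_nat_Suc)
qed

lemma trunc_tendsto: "(\<lambda>k. trunc k t) \<longlonglongrightarrow> t"
proof (cases "t = 0")
  case False
  have "((\<lambda>h. (arctan (0 + h) - arctan 0) / h) \<longlongrightarrow> inverse (1 + 0\<^sup>2)) (at 0)"
    using DERIV_arctan[of 0] unfolding DERIV_def .
  then have "((\<lambda>h. arctan h / h) \<longlongrightarrow> 1) (at 0)" by simp
  moreover have "filterlim (\<lambda>k. t / real (Suc k)) (at 0) sequentially"
    unfolding filterlim_at using False lim_const_over_n[of t, THEN LIMSEQ_Suc] by auto
  ultimately have "(\<lambda>k. arctan (t / real (Suc k)) / (t / real (Suc k))) \<longlonglongrightarrow> 1" by (rule filterlim_compose)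
  then have "(\<lambda>k. t * (arctan (t / real (Suc k)) / (t / real (Suc k)))) \<longlonglongrightarrow> t * 1" by (rule tendsto_mult_left)
  then show ?thesis using False by (simp add: trunc_def mult.commute)
qed (simp add: trunc_def)

lemma trunc'_tendsto: "(\<lambda>k. trunc' k t) \<longlonglongrightarrow> 1"
proof -
  have "(\<lambda>k. 1 / (1 + (t / real (Suc k))\<^sup>2)) \<longlonglongrightarrow> 1 / (1 + 0\<^sup>2)"
    by (intro tendsto_intros lim_const_over_n[of t, THEN LIMSEQ_Suc]) auto
  then show ?thesis by (simp add: trunc'_def)
qed

lemma continuous_trunc: "continuous_on A (trunc k)" "continuous_on A (trunc' k)"
  unfolding trunc_def[abs_def] trunc'_def[abs_def]
  by (auto intro!: continuous_intros simp: add_nonneg_eq_0_iff)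

lemma continuous_trunc_compose:
  "continuous_on A f \<Longrightarrow> continuous_on A (\<lambda>x. trunc k (f x))"
  "continuous_on A f \<Longrightarrow> continuous_on A (\<lambda>x. trunc' k (f x))"
  by (auto intro: continuous_on_compose2[OF continuous_trunc(1)] continuous_on_compose2[OF continuous_trunc(2)])

lemma borel_measurable_trunc [measurable]:
  "trunc k \<in> borel_measurable borel" "trunc' k \<in> borel_measurable borel"
  using continuous_trunc by (auto intro: borel_measurable_continuous_onI)

lemma has_derivative_trunc:
  assumes "(f has_derivative f') (at z)"
  shows "((\<lambda>z. trunc k (f z)) has_derivative (\<lambda>h. trunc' k (f z) * f' h)) (at z)"
  using has_derivative_compose[OF assms DERIV_trunc[unfolded has_field_derivative_def]] .

lemma weakd_trunc:
  assumes "weakd i u g"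
  shows "weakd i (\<lambda>x. trunc k (u x)) (\<lambda>x. trunc' k (u x) * g x)"
proof -
  have "weakd i (\<lambda>x. (\<lambda>z. trunc k (fst z)) (u x, u x)) (\<lambda>x. (\<lambda>z. trunc' k (fst z)) (u x, u x) * g x + (\<lambda>_. 0) (u x, u x) * g x)"
  proof (rule weakd_chain_rule[OF _ _ _ _ _ assms assms, where C = 1])
    fix z :: "real \<times> real"
    have "((\<lambda>z. trunc k (fst z)) has_derivative (\<lambda>h. trunc' k (fst z) * fst h)) (at z)"
      by (intro has_derivative_trunc derivative_intros)
    then show "((\<lambda>z. trunc k (fst z)) has_derivative (\<lambda>h. trunc' k (fst z) * fst h + 0 * snd h)) (at z)" by simp
    show "\<bar>trunc' k (fst z)\<bar> \<le> 1"
      using trunc'_pos[of k "fst z"] trunc'_le[of k "fst z"] by simp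
  qed (auto intro!: continuous_intros continuous_trunc_compose)
  then show ?thesis by simp
qed

text \<open>Product rule, assuming only that the products involved are locally integrable. Both factors are truncated, so that the chain rule applies.\<close>

lemma weakd_mult:
  assumes u: "weakd i u g" and v: "weakd i v h"
    and uv: "locint (\<lambda>x. u x * v x)" and gv: "locint (\<lambda>x. g x * v x)" and uh: "locint (\<lambda>x. u x * h x)"
  shows "weakd i (\<lambda>x. u x * v x) (\<lambda>x. g x * v x + u x * h x)"
proof (rule weakd_limit_dominated[where U = "\<lambda>k x. trunc k (u x) * trunc k (v x)"
      and G = "\<lambda>k x. trunc' k (u x) * trunc k (v x) * g x + trunc k (u x) * trunc' k (v x) * h x"
      and A = "\<lambda>x. u x * v x" and B = "\<lambda>x. \<bar>g x * v x\<bar> + \<bar>u x * h x\<bar>"])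
  note [measurable] = weakd_measurable[OF u] weakd_measurable[OF v]
  show "(\<lambda>x. u x * v x) \<in> borel_measurable borel" "(\<lambda>x. g x * v x + u x * h x) \<in> borel_measurable borel"
    by measurable
  show "locint (\<lambda>x. u x * v x)" by fact
  show "locint (\<lambda>x. \<bar>g x * v x\<bar> + \<bar>u x * h x\<bar>)" by (intro locint_add locint_abs gv uh)
  show "AE x in lborel. (\<lambda>k. trunc k (u x) * trunc k (v x)) \<longlonglongrightarrow> u x * v x"
    by (intro AE_I2 tendsto_mult trunc_tendsto)
  show "AE x in lborel. \<bar>trunc k (u x) * trunc k (v x)\<bar> \<le> \<bar>u x * v x\<bar>" for k
    by (auto simp: abs_mult intro!: mult_mono trunc_le)
  have "(\<lambda>k. trunc' k (u x) * trunc k (v x) * g x + trunc k (u x) * trunc' k (v x) * h x) \<longlonglongrightarrow> 1 * v x * g x + u x * 1 * h x" for x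
    by (intro tendsto_intros trunc_tendsto trunc'_tendsto)
  then show "AE x in lborel. (\<lambda>k. trunc' k (u x) * trunc k (v x) * g x + trunc k (u x) * trunc' k (v x) * h x) \<longlonglongrightarrow> g x * v x + u x * h x"
    by (simp add: mult.commute)
  have "\<bar>trunc' k (u x) * trunc k (v x) * g x + trunc k (u x) * trunc' k (v x) * h x\<bar> \<le> \<bar>g x * v x\<bar> + \<bar>u x * h x\<bar>" for k x
  proof -
    have "\<bar>trunc' k (u x) * trunc k (v x) * g x\<bar> \<le> 1 * \<bar>v x\<bar> * \<bar>g x\<bar>"
      unfolding abs_mult using trunc'_pos[of k "u x"] trunc'_le[of k "u x"] by (intro mult_mono trunc_le) auto
    moreover have "\<bar>trunc k (u x) * trunc' k (v x) * h x\<bar> \<le> \<bar>u x\<bar> * 1 * \<bar>h x\<bar>"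
      unfolding abs_mult using trunc'_pos[of k "v x"] trunc'_le[of k "v x"] by (intro mult_mono trunc_le) auto
    ultimately show ?thesis
      using abs_triangle_ineq[of "trunc' k (u x) * trunc k (v x) * g x" "trunc k (u x) * trunc' k (v x) * h x"]
      by (simp add: abs_mult mult.commute)
  qed
  then show "AE x in lborel. \<bar>trunc' k (u x) * trunc k (v x) * g x + trunc k (u x) * trunc' k (v x) * h x\<bar> \<le> \<bar>\<bar>g x * v x\<bar> + \<bar>u x * h x\<bar>\<bar>" for k
    by auto
  show "weakd i (\<lambda>x. trunc k (u x) * trunc k (v x)) (\<lambda>x. trunc' k (u x) * trunc k (v x) * g x + trunc k (u x) * trunc' k (v x) * h x)" for k
  proof -
    have "weakd i (\<lambda>x. (\<lambda>z. trunc k (fst z) * trunc k (snd z)) (u x, v x))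
      (\<lambda>x. (\<lambda>z. trunc' k (fst z) * trunc k (snd z)) (u x, v x) * g x + (\<lambda>z. trunc k (fst z) * trunc' k (snd z)) (u x, v x) * h x)"
    proof (rule weakd_chain_rule[OF _ _ _ _ _ u v, where C = "2 * real (Suc k)"])
      fix z :: "real \<times> real"
      have "((\<lambda>z. trunc k (fst z) * trunc k (snd z)) has_derivative
         (\<lambda>h. trunc k (fst z) * (trunc' k (snd z) * snd h) + (trunc' k (fst z) * fst h) * trunc k (snd z))) (at z)"
        by (intro has_derivative_mult has_derivative_trunc derivative_intros)
      then show "((\<lambda>z. trunc k (fst z) * trunc k (snd z)) has_derivative
         (\<lambda>h. trunc' k (fst z) * trunc k (snd z) * fst h + trunc k (fst z) * trunc' k (snd z) * snd h)) (at z)"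
        by (rule has_derivative_eq_rhs) (auto simp: fun_eq_iff)
      have "\<bar>trunc' k (fst z)\<bar> * \<bar>trunc k (snd z)\<bar> \<le> 1 * (2 * real (Suc k))"
        using trunc'_pos[of k "fst z"] trunc'_le[of k "fst z"] by (intro mult_mono trunc_bound) auto
      then show "\<bar>trunc' k (fst z) * trunc k (snd z)\<bar> \<le> 2 * real (Suc k)" by (simp add: abs_mult)
      have "\<bar>trunc k (fst z)\<bar> * \<bar>trunc' k (snd z)\<bar> \<le> (2 * real (Suc k)) * 1"
        using trunc'_pos[of k "snd z"] trunc'_le[of k "snd z"] by (intro mult_mono trunc_bound) auto
      then show "\<bar>trunc k (fst z) * trunc' k (snd z)\<bar> \<le> 2 * real (Suc k)" by (simp add: abs_mult)
    qed (auto intro!: continuous_intros continuous_trunc_compose)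
    then show ?thesis by simp
  qed
qed

lemma weakd_cutoff:
  assumes u: "weakd i u g" and \<zeta>: "\<zeta> \<in> test_functions"
  shows "weakd i (\<lambda>x. \<zeta> x * u x) (\<lambda>x. \<zeta> x * g x + partial_deriv i \<zeta> x * u x)"
proof -
  obtain R where R: "supp_ball R \<zeta>" using test_functionsD(4)[OF \<zeta>] by blast
  note c = test_functionsD(2)[OF \<zeta>] test_functionsD(2)[OF test_functions_partial_deriv[OF \<zeta>]]
  obtain M where M: "\<And>x. \<bar>\<zeta> x\<bar> \<le> M" using supp_ball_bounded[OF c(1) R] by blast
  obtain M' where M': "\<And>x. \<bar>partial_deriv i \<zeta> x\<bar> \<le> M'"
    using supp_ball_bounded[OF c(2) supp_ball_partial_deriv[OF R]] by blast
  note [measurable] = c[THEN borel_measurable_continuous]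
  have "weakd i (\<lambda>x. \<zeta> x * u x) (\<lambda>x. partial_deriv i \<zeta> x * u x + \<zeta> x * g x)"
    by (rule weakd_mult[OF weakd_C1[OF test_functionsD(1)[OF \<zeta>]] u])
      (rule locint_mult_bounded[OF weakd_locint(1)[OF u] _ AE_I2[OF M]]
        locint_mult_bounded[OF weakd_locint(1)[OF u] _ AE_I2[OF M']]
        locint_mult_bounded[OF weakd_locint(2)[OF u] _ AE_I2[OF M]], measurable)+
  then show ?thesis by (simp add: add.commute)
qed

section \<open>Translations and the commutator of multiplication and mollification\<close>

lemma AE_lborel_shift:
  fixes y :: "'a::euclidean_space"
  assumes "AE x in lborel. P x"
  shows "AE x in lborel. P (x - y)"
proof -
  obtain N where N0: "{x \<in> space lborel. \<not> P x} \<subseteq> N" "emeasure lborel N = 0" "N \<in> sets lborel"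
    by (rule AE_E[OF assms])
  then have N: "N \<in> null_sets lborel" "{x. \<not> P x} \<subseteq> N" by auto
  then have [measurable]: "N \<in> sets borel" by auto
  have "(\<integral>\<^sup>+x. indicator N (x - y) \<partial>lborel) = (\<integral>\<^sup>+x. indicator N x \<partial>(lborel :: 'a measure))"
    by (rule nn_integral_lborel_shift) measurable
  also have "\<dots> = 0" using N by auto
  finally have "AE x in lborel. indicator N (x - y) = (0::ennreal)"
    by (subst (asm) nn_integral_0_iff_AE) auto
  then show ?thesis
    by (rule eventually_mono) (use N(2) in \<open>auto simp: indicator_def split: if_splits\<close>)
qed

lemma locint_sum:
  assumes "\<And>i. i \<in> A \<Longrightarrow> locint (f i)"
  shows "locint (\<lambda>x. \<Sum>i\<in>A. f i x)"
  using assms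
proof (induction A rule: infinite_finite_induct)
  case (insert i A)
  then show ?case using locint_add[of "f i" "\<lambda>x. \<Sum>i\<in>A. f i x"] by simp
qed (auto simp: locint_def)

lemma pint_fatou:
  fixes f :: "nat \<Rightarrow> 'a::euclidean_space \<Rightarrow> real"
  assumes [measurable]: "\<And>n. f n \<in> borel_measurable borel" "g \<in> borel_measurable borel" and p: "0 < p"
    and lim: "AE x in lborel. (\<lambda>n. f n x) \<longlonglongrightarrow> g x" and B: "\<And>n. pint p (f n) \<le> B"
  shows "pint p g \<le> B"
proof -
  have "pint p g = (\<integral>\<^sup>+x. liminf (\<lambda>n. ennreal (\<bar>f n x\<bar> powr p)) \<partial>lborel)"
    unfolding pint_def
  proof (rule nn_integral_cong_AE)
    show "AE x in lborel. ennreal (\<bar>g x\<bar> powr p) = liminf (\<lambda>n. ennreal (\<bar>f n x\<bar> powr p))"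
      using lim
    proof eventually_elim
      case (elim x)
      have "(\<lambda>n. \<bar>f n x\<bar> powr p) \<longlonglongrightarrow> \<bar>g x\<bar> powr p"
        using elim p by (intro tendsto_powr' tendsto_rabs tendsto_const) auto
      then have "(\<lambda>n. ennreal (\<bar>f n x\<bar> powr p)) \<longlonglongrightarrow> ennreal (\<bar>g x\<bar> powr p)" by (rule tendsto_ennrealI)
      then show ?case by (rule lim_imp_Liminf[OF sequentially_bot, symmetric])
    qed
  qed
  also have "\<dots> \<le> liminf (\<lambda>n. \<integral>\<^sup>+x. ennreal (\<bar>f n x\<bar> powr p) \<partial>lborel)"
    by (rule nn_integral_liminf) measurable
  also have "\<dots> \<le> B"
    using B by (intro Liminf_le) (auto simp: pint_def)
  finally show ?thesis .
qed

text \<open>Translation estimate for Sobolev functions. For the mollified function, the difference is the integral of the gradient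
  along a segment; Fatou's lemma gives the general case. The gradient is measured by the sum of the absolute values of its
  components.\<close>

lemma pint_translation_le:
  fixes \<psi> :: "real ^ 'n::finite \<Rightarrow> real" and g :: "'n \<Rightarrow> real ^ 'n \<Rightarrow> real"
  assumes p: "1 \<le> p" and w: "\<And>i. weakd i \<psi> (g i)" and R: "supp_ball R \<psi>"
  shows "pint p (\<lambda>x. \<psi> x - \<psi> (x - y)) \<le> ennreal (norm y powr p) * pint p (\<lambda>x. \<Sum>i\<in>UNIV. \<bar>g i x\<bar>)"
proof -
  let ?h = "\<lambda>x. \<Sum>i\<in>UNIV. \<bar>g i x\<bar>"
  note lg = weakd_locint(2)[OF w] and l\<psi> = weakd_locint(1)[OF w]
  have lh: "locint ?h" by (intro locint_sum locint_abs lg)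
  note [measurable] = weakd_measurable[OF w]
  define K where "K n = conv ?h (mo n)" for n
  define \<Psi> where "\<Psi> n = conv \<psi> (mo n)" for n
  have cK: "continuous_on UNIV (K n)" for n unfolding K_def using Ck_continuous[OF Ck_mollify[OF lh]] .
  have C1: "Ck (Suc 0) (\<Psi> n)" for n unfolding \<Psi>_def by (rule Ck_mollify[OF l\<psi>])
  note [measurable] = borel_measurable_continuous[OF cK] borel_measurable_continuous[OF Ck_continuous[OF C1]]
  have d\<Psi>: "partial_deriv i (\<Psi> n) = conv (g i) (mo n)" for i n
    unfolding \<Psi>_def by (intro partial_deriv_conv_weakd[OF w molf_test]) simp
  have K: "(\<Sum>i\<in>UNIV. \<bar>partial_deriv i (\<Psi> n) x\<bar>) \<le> K n x" for n x
  proof -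
    have int: "integrable lborel (\<lambda>z. \<bar>g i z\<bar> * \<bar>mo n (x - z)\<bar>)" for i
      using integrable_abs[OF conv_integrable[OF lg molf_continuous[OF mo_pos] supp_ball_molf[OF mo_pos], of i n x]]
      by (simp add: abs_mult)
    have "(\<Sum>i\<in>UNIV. \<bar>conv (g i) (mo n) x\<bar>) \<le> (\<Sum>i\<in>UNIV. (\<integral>z. \<bar>g i z\<bar> * \<bar>mo n (x - z)\<bar> \<partial>lborel))"
      by (intro sum_mono conv_abs_le[OF lg molf_continuous[OF mo_pos] supp_ball_molf[OF mo_pos]])
    also have "\<dots> = (\<integral>z. (\<Sum>i\<in>UNIV. \<bar>g i z\<bar> * \<bar>mo n (x - z)\<bar>) \<partial>lborel)"
      using int by (simp add: Bochner_Integration.integral_sum)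
    also have "\<dots> = K n x"
      using molf_nonneg[OF mo_pos[of n], where 'a = 'n]
      by (simp add: K_def conv_def sum_distrib_right abs_of_nonneg)
    finally show ?thesis by (simp add: d\<Psi>)
  qed
  have K0: "0 \<le> K n x" for n x by (rule order_trans[OF sum_nonneg K]) auto
  have pt: "ennreal (\<bar>\<Psi> n x - \<Psi> n (x - y)\<bar> powr p) \<le>
     (\<integral>\<^sup>+t. ennreal ((norm y * K n (x - t *\<^sub>R y)) powr p * indicator {0..1} t) \<partial>lborel)" for n x
  proof -
    let ?D = "\<lambda>t. \<Sum>i\<in>UNIV. (- y) $ i * partial_deriv i (\<Psi> n) (x + t *\<^sub>R (- y))"
    have diff: "\<And>x. \<Psi> n differentiable (at x)" and cp: "\<And>i. continuous_on UNIV (partial_deriv i (\<Psi> n))"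
      using C1 by auto
    have cl: "continuous_on UNIV (\<lambda>t. f (x + t *\<^sub>R (- y)))" if "continuous_on UNIV f" for f :: "real ^ 'n \<Rightarrow> real"
      by (rule continuous_on_compose2[OF that]) (auto intro!: continuous_intros)
    have cD: "continuous_on UNIV ?D" by (intro continuous_on_sum continuous_on_mult continuous_on_const cl[OF cp])
    have "(\<integral>t. ?D t * indicator {0..1} t \<partial>lborel) = \<Psi> n (x + 1 *\<^sub>R (- y)) - \<Psi> n (x + 0 *\<^sub>R (- y))"
    proof (rule integral_FTC_Icc_real)
      show "((\<lambda>t. \<Psi> n (x + t *\<^sub>R (- y))) has_real_derivative ?D t) (at t)" for t
        by (rule C1_line_derivative[OF diff])
      show "isCont ?D t" for t
        using cD continuous_on_eq_continuous_at[OF open_UNIV] by blast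
    qed simp
    then have "\<bar>\<Psi> n x - \<Psi> n (x - y)\<bar> = \<bar>\<integral>t. ?D t * indicator {0..1} t \<partial>lborel\<bar>" by simp
    also have "\<dots> \<le> (\<integral>t. (norm y * K n (x - t *\<^sub>R y)) * indicator {0..1} t \<partial>lborel)"
    proof (rule integral_abs_bound_integral)
      have *: "integrable lborel (\<lambda>t. f t * indicator {0..1} t)" if "continuous_on UNIV f" for f :: "real \<Rightarrow> real"
        using borel_integrable_atLeastAtMost'[of 0 1 f] continuous_on_subset[OF that, of "{0..1}"]
        by (simp add: set_integrable_def mult.commute)
      show "integrable lborel (\<lambda>t. ?D t * indicator {0..1} t)" by (rule *[OF cD])
      have "continuous_on UNIV (\<lambda>t. norm y * K n (x + t *\<^sub>R (- y)))" by (intro continuous_on_mult continuous_on_const cl[OF cK])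
      from *[OF this] show "integrable lborel (\<lambda>t. (norm y * K n (x - t *\<^sub>R y)) * indicator {0..1} t)" by simp
      fix t
      have "\<bar>?D t\<bar> \<le> (\<Sum>i\<in>UNIV. norm y * \<bar>partial_deriv i (\<Psi> n) (x + t *\<^sub>R (- y))\<bar>)"
        by (rule order_trans[OF sum_abs], rule sum_mono)
          (auto simp: abs_mult intro!: mult_right_mono component_le_norm_cart)
      also have "\<dots> \<le> norm y * K n (x - t *\<^sub>R y)"
        using K[where x = "x - t *\<^sub>R y" and n = n] by (simp add: sum_distrib_left[symmetric] mult_left_mono)
      finally show "\<bar>?D t * indicator {0..1} t\<bar> \<le> (norm y * K n (x - t *\<^sub>R y)) * indicator {0..1} t"
        by (auto simp: indicator_def)
    qed
    finally have "ennreal (\<bar>\<Psi> n x - \<Psi> n (x - y)\<bar> powr p) \<le> ennreal ((\<integral>t. (norm y * K n (x - t *\<^sub>R y)) * indicator {0..1} t \<partial>lborel) powr p)"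
      using p by (intro ennreal_leI powr_mono2) auto
    also have "\<dots> \<le> ennreal ((\<integral>t. indicator {0..1} t \<partial>(lborel :: real measure)) powr (p - 1)) *
       (\<integral>\<^sup>+t. ennreal ((norm y * K n (x - t *\<^sub>R y)) powr p * indicator {0..1} t) \<partial>lborel)"
    proof (rule jensen_kernel[OF p])
      have "continuous_on UNIV (\<lambda>t. norm y * K n (x + t *\<^sub>R (- y)))" by (intro continuous_on_mult continuous_on_const cl[OF cK])
      then show "integrable lborel (\<lambda>t. norm y * K n (x - t *\<^sub>R y) * indicator {0..1} t)"
        using borel_integrable_atLeastAtMost'[of 0 1 "\<lambda>t. norm y * K n (x - t *\<^sub>R y)"]
          continuous_on_subset[of UNIV "\<lambda>t. norm y * K n (x - t *\<^sub>R y)" "{0..1}"]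
        by (simp add: set_integrable_def mult.commute)
    qed (auto simp: K0)
    finally show ?thesis by simp
  qed
  have bd: "pint p (\<lambda>x. \<Psi> n x - \<Psi> n (x - y)) \<le> ennreal (norm y powr p) * pint p ?h" for n
  proof -
    have "pint p (\<lambda>x. \<Psi> n x - \<Psi> n (x - y)) \<le>
       (\<integral>\<^sup>+x. (\<integral>\<^sup>+t. ennreal ((norm y * K n (x - t *\<^sub>R y)) powr p * indicator {0..1} t) \<partial>lborel) \<partial>lborel)"
      unfolding pint_def using pt by (intro nn_integral_mono)
    also have "\<dots> = (\<integral>\<^sup>+t. (\<integral>\<^sup>+x. ennreal ((norm y * K n (x - t *\<^sub>R y)) powr p * indicator {0..1} t) \<partial>lborel) \<partial>lborel)"
      by (rule pair_sigma_finite.Fubini'[symmetric])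
        (auto intro!: pair_sigma_finite.intro lborel.sigma_finite_measure_axioms)
    also have "\<dots> = (\<integral>\<^sup>+t. (ennreal (norm y powr p) * pint p (K n)) * indicator {0..1::real} t \<partial>lborel)"
    proof (rule nn_integral_cong)
      fix t :: real
      have "(\<integral>\<^sup>+x. ennreal ((norm y * K n (x - t *\<^sub>R y)) powr p) \<partial>lborel) = (\<integral>\<^sup>+x. ennreal ((norm y * K n x) powr p) \<partial>lborel)"
        by (rule nn_integral_lborel_shift[where f = "\<lambda>x. ennreal ((norm y * K n x) powr p)"]) measurable
      also have "\<dots> = ennreal (norm y powr p) * pint p (K n)"
        using pint_cmult[of "K n" "norm y" p] K0 by (simp add: pint_def abs_mult)
      finally show "(\<integral>\<^sup>+x. ennreal ((norm y * K n (x - t *\<^sub>R y)) powr p * indicator {0..1} t) \<partial>lborel) =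
         (ennreal (norm y powr p) * pint p (K n)) * indicator {0..1} t"
        by (auto simp: indicator_def)
    qed
    also have "\<dots> = ennreal (norm y powr p) * pint p (K n)"
      by (subst nn_integral_cmult_indicator) auto
    also have "\<dots> \<le> ennreal (norm y powr p) * pint p ?h"
      unfolding K_def by (intro mult_left_mono pint_conv_molf[OF p lh]) auto
    finally show ?thesis .
  qed
  have p1: "pint 1 \<psi> < \<infinity>"
    using locint_integrable_supp[OF l\<psi> R] by (subst (asm) integrable_iff_pint_1) auto
  have "(\<lambda>n. pint 1 (\<lambda>x. \<Psi> n x - \<psi> x)) \<longlonglongrightarrow> 0"
    unfolding \<Psi>_def by (rule Lp_mollify[OF _ _ p1 R]) auto
  then obtain r where r: "strict_mono r" "AE x in lborel. (\<lambda>n. \<Psi> (r n) x - \<psi> x) \<longlonglongrightarrow> 0"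
    using pint_AE_subseq[of "\<lambda>n x. \<Psi> n x - \<psi> x" 1] by auto
  show ?thesis
  proof (rule pint_fatou[where f = "\<lambda>n x. \<Psi> (r n) x - \<Psi> (r n) (x - y)"])
    show "AE x in lborel. (\<lambda>n. \<Psi> (r n) x - \<Psi> (r n) (x - y)) \<longlonglongrightarrow> \<psi> x - \<psi> (x - y)"
      using r(2) AE_lborel_shift[OF r(2), of y]
      by eventually_elim (intro tendsto_diff; rule LIM_zero_cancel)
  qed (use p bd in auto)
qed

text \<open>The commutator identity. The weak derivative of \<open>u \<psi>\<close> is tested against \<open>z \<mapsto> \<rho> (x - z)\<close>, so that \<open>g\<close> no longer
  occurs on the right-hand side.\<close>

lemma commutator_eq:
  fixes u \<psi> :: "real ^ 'n::finite \<Rightarrow> real"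
  assumes u: "weakd i u g" and M: "\<And>x. \<bar>u x\<bar> \<le> M" and \<psi>: "weakd i \<psi> h" and \<psi>g: "locint (\<lambda>x. \<psi> x * g x)"
    and \<rho>: "\<rho> \<in> test_functions"
  shows "\<psi> x * conv g \<rho> x - conv (\<lambda>z. \<psi> z * g z) \<rho> x =
    conv (\<lambda>z. u z * h z) \<rho> x + (\<integral>z. (\<psi> x - \<psi> z) * u z * partial_deriv i \<rho> (x - z) \<partial>lborel)"
proof -
  obtain r where r: "supp_ball r \<rho>" using test_functionsD(4)[OF \<rho>] by blast
  note [measurable] = weakd_measurable[OF u]
  have l1: "locint (\<lambda>x. u x * \<psi> x)" and l2: "locint (\<lambda>x. u x * h x)"
    using locint_mult_bounded[OF weakd_locint(1)[OF \<psi>] _ AE_I2[OF M]] locint_mult_bounded[OF weakd_locint(2)[OF \<psi>] _ AE_I2[OF M]]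
    by auto
  have l3: "locint (\<lambda>x. g x * \<psi> x)" using \<psi>g by (simp add: mult.commute)
  have w: "weakd i (\<lambda>x. u x * \<psi> x) (\<lambda>x. g x * \<psi> x + u x * h x)"
    by (rule weakd_mult[OF u \<psi> l1 l3 l2])
  note c = test_functionsD(2)[OF \<rho>] test_functionsD(2)[OF test_functions_partial_deriv[OF \<rho>], of i]
  note rr = r supp_ball_partial_deriv[OF r, of i]
  have e1: "conv g \<rho> x = conv u (partial_deriv i \<rho>) x"
    using partial_deriv_conv_weakd[OF u \<rho>] partial_deriv_conv[OF weakd_locint(1)[OF u] test_functionsD(1)[OF \<rho>] r] by metis
  have e2: "conv (\<lambda>x. g x * \<psi> x + u x * h x) \<rho> x = conv (\<lambda>x. u x * \<psi> x) (partial_deriv i \<rho>) x"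
    using partial_deriv_conv_weakd[OF w \<rho>] partial_deriv_conv[OF weakd_locint(1)[OF w] test_functionsD(1)[OF \<rho>] r] by metis
  have e3: "conv (\<lambda>x. g x * \<psi> x + u x * h x) \<rho> x = conv (\<lambda>x. \<psi> x * g x) \<rho> x + conv (\<lambda>x. u x * h x) \<rho> x"
    unfolding conv_def using conv_integrable[OF \<psi>g c(1) rr(1), of x] conv_integrable[OF l2 c(1) rr(1), of x]
    by (simp add: distrib_right mult.commute[of "g _"])
  have "(\<integral>z. (\<psi> x - \<psi> z) * u z * partial_deriv i \<rho> (x - z) \<partial>lborel) =
     (\<integral>z. \<psi> x * (u z * partial_deriv i \<rho> (x - z)) - (u z * \<psi> z) * partial_deriv i \<rho> (x - z) \<partial>lborel)"
    by (simp add: algebra_simps)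
  also have "\<dots> = \<psi> x * conv u (partial_deriv i \<rho>) x - conv (\<lambda>x. u x * \<psi> x) (partial_deriv i \<rho>) x"
    unfolding conv_def
    using conv_integrable[OF weakd_locint(1)[OF u] c(2) rr(2), of x] conv_integrable[OF l1 c(2) rr(2), of x] by simp
  finally show ?thesis using e1 e2 e3 by simp
qed

text \<open>The commutator of multiplication by \<open>\<psi>\<close> and mollification, applied to \<open>g\<close>.\<close>

definition commut :: "(real ^ 'n::finite \<Rightarrow> real) \<Rightarrow> (real ^ 'n \<Rightarrow> real) \<Rightarrow> nat \<Rightarrow> real ^ 'n \<Rightarrow> real" where
  "commut \<psi> g n x = \<psi> x * conv g (mo n) x - conv (\<lambda>z. \<psi> z * g z) (mo n) x"

text \<open>The \<open>L\<^sup>1\<close> norm of the \<open>i\<close>-th partial derivative of the mollifier of radius one.\<close>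

definition bump_ratio :: "'n::finite \<Rightarrow> real" where
  "bump_ratio i = (\<integral>x. \<bar>partial_deriv i bump (x :: real ^ 'n)\<bar> \<partial>lborel) / (\<integral>x. bump (x :: real ^ 'n) \<partial>lborel)"

lemma bump_ratio_nonneg: "0 \<le> bump_ratio i"
  unfolding bump_ratio_def by (intro divide_nonneg_pos integral_bump_pos) (simp add: integral_nonneg_AE)

lemma integral_abs_partial_deriv_mo:
  "(\<integral>x. \<bar>partial_deriv i (mo n) (x :: real ^ 'n::finite)\<bar> \<partial>lborel) = bump_ratio i * real (Suc n)"
  using integral_abs_partial_deriv_molf[OF mo_pos[of n], of i]
  by (simp add: bump_ratio_def divide_inverse mult_ac del: of_nat_Suc)

text \<open>The commutator is bounded uniformly in \<open>n\<close> by the gradient of \<open>\<psi>\<close>.\<close>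

lemma pint_commut_le:
  fixes u \<psi> :: "real ^ 'n::finite \<Rightarrow> real" and h :: "'n \<Rightarrow> real ^ 'n \<Rightarrow> real"
  assumes p: "1 \<le> p" and u: "weakd i u g" and M: "\<And>x. \<bar>u x\<bar> \<le> M"
    and \<psi>: "\<And>j. weakd j \<psi> (h j)" and R: "supp_ball R \<psi>" and \<psi>g: "locint (\<lambda>x. \<psi> x * g x)"
  shows "pint p (commut \<psi> g n) \<le> ennreal (2 powr p * (M powr p + (bump_ratio i * M) powr p)) * pint p (\<lambda>x. \<Sum>j\<in>UNIV. \<bar>h j x\<bar>)"
proof -
  let ?H = "pint p (\<lambda>x. \<Sum>j\<in>UNIV. \<bar>h j x\<bar>)" and ?e = "inverse (real (Suc n))" and ?d = "partial_deriv i (mo n)"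
  have M0: "0 \<le> M" using M[of 0] by linarith
  note [measurable] = weakd_measurable[OF u] weakd_measurable[OF \<psi>] locint_measurable[OF \<psi>g]
  have mt: "mo n \<in> test_functions" by (rule molf_test[OF mo_pos])
  have cd: "continuous_on UNIV ?d" by (rule test_functionsD(2)[OF test_functions_partial_deriv[OF mt]])
  have rd: "supp_ball ?e ?d" by (rule supp_ball_partial_deriv[OF supp_ball_molf[OF mo_pos]])
  note [measurable] = borel_measurable_continuous[OF cd]
  have luh: "locint (\<lambda>x. u x * h i x)"
    using locint_mult_bounded[OF weakd_locint(2)[OF \<psi>] _ AE_I2[OF M]] by simp
  have lu\<psi>: "locint (\<lambda>x. u x * \<psi> x)"
    using locint_mult_bounded[OF weakd_locint(1)[OF \<psi>] _ AE_I2[OF M]] by simp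
  define A where "A = conv (\<lambda>z. u z * h i z) (mo n)"
  define B where "B x = (\<integral>z. (\<psi> x - \<psi> z) * u z * ?d (x - z) \<partial>lborel)" for x
  have [measurable]: "A \<in> borel_measurable borel"
    unfolding A_def by (rule borel_measurable_continuous[OF Ck_continuous[OF Ck_mollify[OF luh]]])
  have [measurable]: "B \<in> borel_measurable borel" unfolding B_def by measurable
  have eq: "commut \<psi> g n = (\<lambda>x. A x + B x)"
    unfolding commut_def A_def B_def using commutator_eq[OF u M \<psi> \<psi>g mt] by (intro ext) blast
  have "pint p A \<le> pint p (\<lambda>x. u x * h i x)" unfolding A_def by (rule pint_conv_molf[OF p luh mo_pos])
  also have "\<dots> \<le> pint p (\<lambda>x. M * (\<Sum>j\<in>UNIV. \<bar>h j x\<bar>))"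
  proof (rule pint_mono)
    have "\<bar>u x * h i x\<bar> \<le> M * (\<Sum>j\<in>UNIV. \<bar>h j x\<bar>)" for x
      unfolding abs_mult using M M0 by (intro mult_mono member_le_sum) (auto simp: sum_nonneg)
    then show "AE x in lborel. \<bar>u x * h i x\<bar> \<le> \<bar>M * (\<Sum>j\<in>UNIV. \<bar>h j x\<bar>)\<bar>"
      by (auto intro: order_trans[OF _ abs_ge_self])
  qed (use p in simp)
  also have "\<dots> = ennreal (M powr p) * ?H" using M0 by (intro pint_cmult) auto
  finally have A: "pint p A \<le> ennreal (M powr p) * ?H" .
  have int: "integrable lborel (\<lambda>z. (M * \<bar>\<psi> x - \<psi> z\<bar>) * \<bar>?d (x - z)\<bar>)" for x
  proof -
    have "locint (\<lambda>z. \<psi> x - \<psi> z)" by (intro locint_diff locint_continuous weakd_locint(1)[OF \<psi>]) auto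
    from integrable_abs[OF conv_integrable[OF this cd rd, of x]] have "integrable lborel (\<lambda>z. M * \<bar>(\<psi> x - \<psi> z) * ?d (x - z)\<bar>)" by simp
    then show ?thesis by (simp add: abs_mult mult.assoc)
  qed
  have "pint p B \<le> pint p (\<lambda>x. \<integral>z. (M * \<bar>\<psi> x - \<psi> z\<bar>) * \<bar>?d (x - z)\<bar> \<partial>lborel)"
  proof (rule pint_mono)
    have "\<bar>B x\<bar> \<le> (\<integral>z. (M * \<bar>\<psi> x - \<psi> z\<bar>) * \<bar>?d (x - z)\<bar> \<partial>lborel)" for x
      unfolding B_def
    proof (rule integral_abs_bound_integral[OF _ int])
      show i1: "integrable lborel (\<lambda>z. (\<psi> x - \<psi> z) * u z * ?d (x - z))"
      proof (rule Bochner_Integration.integrable_bound[OF int[of x]])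
        show "AE z in lborel. norm ((\<psi> x - \<psi> z) * u z * ?d (x - z)) \<le> norm (M * \<bar>\<psi> x - \<psi> z\<bar> * \<bar>?d (x - z)\<bar>)"
          using M M0 by (intro AE_I2) (auto simp: abs_mult mult.commute[of "\<bar>\<psi> x - \<psi> _\<bar>"] intro!: mult_right_mono)
      qed measurable
      show "\<bar>(\<psi> x - \<psi> z) * u z * ?d (x - z)\<bar> \<le> M * \<bar>\<psi> x - \<psi> z\<bar> * \<bar>?d (x - z)\<bar>" for z
        using M M0 by (auto simp: abs_mult mult.commute[of "\<bar>\<psi> x - \<psi> _\<bar>"] intro!: mult_right_mono)
    qed
    then show "AE x in lborel. \<bar>B x\<bar> \<le> \<bar>\<integral>z. (M * \<bar>\<psi> x - \<psi> z\<bar>) * \<bar>?d (x - z)\<bar> \<partial>lborel\<bar>"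
      by (auto intro: order_trans[OF _ abs_ge_self])
  qed (use p in simp)
  also have "\<dots> \<le> ennreal ((\<integral>x. \<bar>?d x\<bar> \<partial>lborel) powr p) * (ennreal ((M * ?e) powr p) * ?H)"
  proof (rule pint_kernel[OF p, where r = ?e and H = "\<lambda>x z. M * \<bar>\<psi> x - \<psi> z\<bar>" and \<kappa> = "\<lambda>x. \<bar>?d x\<bar>"])
    show "(\<lambda>(x, z). M * \<bar>\<psi> x - \<psi> z\<bar>) \<in> borel_measurable (borel \<Otimes>\<^sub>M borel)" by measurable
    show "continuous_on UNIV (\<lambda>x. \<bar>?d x\<bar>)" by (intro continuous_intros cd)
    show "supp_ball ?e (\<lambda>x. \<bar>?d x\<bar>)" using rd by (auto simp: supp_ball_def)
    fix y :: "real ^ 'n" assume y: "norm y \<le> ?e"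
    have "(\<integral>\<^sup>+x. ennreal ((M * \<bar>\<psi> x - \<psi> (x - y)\<bar>) powr p) \<partial>lborel) = pint p (\<lambda>x. M * (\<psi> x - \<psi> (x - y)))"
      using M0 by (simp add: pint_def abs_mult)
    also have "\<dots> = ennreal (M powr p) * pint p (\<lambda>x. \<psi> x - \<psi> (x - y))" using M0 by (intro pint_cmult) auto
    also have "\<dots> \<le> ennreal (M powr p) * (ennreal (norm y powr p) * ?H)"
      by (intro mult_left_mono pint_translation_le[OF p \<psi> R]) auto
    also have "\<dots> \<le> ennreal (M powr p) * (ennreal (?e powr p) * ?H)"
      using y p by (intro mult_left_mono mult_right_mono ennreal_leI powr_mono2) auto
    also have "\<dots> = ennreal ((M * ?e) powr p) * ?H"
      using M0 by (simp add: powr_mult ennreal_mult mult.assoc)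
    finally show "(\<integral>\<^sup>+x. ennreal ((M * \<bar>\<psi> x - \<psi> (x - y)\<bar>) powr p) \<partial>lborel) \<le> ennreal ((M * ?e) powr p) * ?H" .
  qed (use int M0 in auto)
  also have "\<dots> = ennreal ((bump_ratio i * M) powr p) * ?H"
  proof -
    have "(\<integral>x. \<bar>?d x\<bar> \<partial>lborel) powr p * (M * ?e) powr p = (bump_ratio i * real (Suc n) * (M * ?e)) powr p"
      unfolding integral_abs_partial_deriv_mo using M0 bump_ratio_nonneg[of i] by (intro powr_mult[symmetric])
    also have "bump_ratio i * real (Suc n) * (M * ?e) = bump_ratio i * M" by (simp del: of_nat_Suc)
    finally show ?thesis by (simp add: ennreal_mult[symmetric] mult.assoc[symmetric])
  qed
  finally have B: "pint p B \<le> ennreal ((bump_ratio i * M) powr p) * ?H" .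
  have "pint p (commut \<psi> g n) \<le> ennreal (2 powr p) * (pint p A + pint p B)"
    unfolding eq by (rule pint_add) (use p in auto)
  also have "\<dots> \<le> ennreal (2 powr p) * (ennreal (M powr p) * ?H + ennreal ((bump_ratio i * M) powr p) * ?H)"
    by (intro mult_left_mono add_mono A B) auto
  also have "\<dots> = ennreal (2 powr p * (M powr p + (bump_ratio i * M) powr p)) * ?H"
    by (simp add: ennreal_mult ennreal_plus distrib_right mult.assoc)
  finally show ?thesis .
qed

lemma test_function_Lipschitz:
  fixes \<Phi> :: "real ^ 'n::finite \<Rightarrow> real"
  assumes "\<Phi> \<in> test_functions"
  shows "\<exists>L\<ge>0. (\<forall>x y. \<bar>\<Phi> x - \<Phi> y\<bar> \<le> L * norm (x - y)) \<and> (\<forall>i x. \<bar>partial_deriv i \<Phi> x\<bar> \<le> L)"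
proof -
  obtain R where R: "supp_ball R \<Phi>" using test_functionsD(4)[OF assms] by blast
  have "\<forall>i. \<exists>M>0. \<forall>x. \<bar>partial_deriv i \<Phi> x\<bar> \<le> M"
    using supp_ball_bounded[OF test_functionsD(2)[OF test_functions_partial_deriv[OF assms]] supp_ball_partial_deriv[OF R]] by blast
  then obtain M where M: "\<And>i. M i > 0" "\<And>i x. \<bar>partial_deriv i \<Phi> x\<bar> \<le> M i" by metis
  define L where "L = (\<Sum>i\<in>UNIV. M i)"
  have M_le: "M i \<le> L" for i unfolding L_def using M(1) by (intro member_le_sum) (auto simp: less_imp_le)
  have "\<bar>\<Phi> x - \<Phi> y\<bar> \<le> L * norm (x - y)" for x y
  proof -
    obtain t where t: "\<Phi> (y + (x - y)) - \<Phi> y = (\<Sum>i\<in>UNIV. (x - y) $ i * partial_deriv i \<Phi> (y + t *\<^sub>R (x - y)))"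
      using C1_mvt[OF test_functionsD(3)[OF assms]] by blast
    have "\<bar>\<Phi> x - \<Phi> y\<bar> \<le> (\<Sum>i\<in>UNIV. norm (x - y) * M i)"
    proof -
      have "\<bar>(x - y) $ i * partial_deriv i \<Phi> (y + t *\<^sub>R (x - y))\<bar> \<le> norm (x - y) * M i" for i
        unfolding abs_mult by (intro mult_mono component_le_norm_cart M(2)) auto
      then show ?thesis using t by (auto intro!: order_trans[OF sum_abs] sum_mono simp del: vector_minus_component)
    qed
    then show ?thesis by (simp add: L_def sum_distrib_right mult.commute)
  qed
  moreover have "\<bar>partial_deriv i \<Phi> x\<bar> \<le> L" for i x using M(2) M_le order_trans by blast
  moreover have "0 \<le> L" unfolding L_def using M(1) by (intro sum_nonneg) (auto simp: less_imp_le)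
  ultimately show ?thesis by blast
qed

lemma pint_le_bounded:
  assumes p: "1 \<le> p" and [measurable]: "f \<in> borel_measurable borel" and B: "\<And>x. \<bar>f x\<bar> \<le> B"
  shows "pint p f \<le> ennreal (B powr (p - 1)) * pint 1 f"
proof -
  have B0: "0 \<le> B" using B[of undefined] by linarith
  have "\<bar>f x\<bar> powr p \<le> B powr (p - 1) * \<bar>f x\<bar>" for x
  proof -
    have "\<bar>f x\<bar> powr p = \<bar>f x\<bar> powr (p - 1) * \<bar>f x\<bar>"
      using powr_mult_base[of "\<bar>f x\<bar>" "p - 1"] by (cases "f x = 0") (auto simp: mult.commute)
    also have "\<dots> \<le> B powr (p - 1) * \<bar>f x\<bar>" using B p by (intro mult_right_mono powr_mono2) auto
    finally show ?thesis .
  qed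
  then have "pint p f \<le> (\<integral>\<^sup>+x. ennreal (B powr (p - 1) * \<bar>f x\<bar>) \<partial>lborel)"
    unfolding pint_def by (intro nn_integral_mono ennreal_leI)
  also have "\<dots> = ennreal (B powr (p - 1)) * pint 1 f"
    using B0 by (simp add: ennreal_mult nn_integral_cmult pint_1)
  finally show ?thesis .
qed

text \<open>The identity \<open>commutator_eq\<close> bounds the commutator uniformly, and the Lipschitz continuity of \<open>\<Phi>\<close> bounds it
  in \<open>L\<^sup>1\<close> by a multiple of the radius. Together this gives convergence in \<open>L\<^sup>p\<close>, although \<open>g\<close> need not be in \<open>L\<^sup>p\<close>.\<close>

lemma pint_commut_test_tendsto_0:
  fixes u \<Phi> :: "real ^ 'n::finite \<Rightarrow> real"
  assumes p: "1 \<le> p" and u: "weakd i u g" and M: "\<And>x. \<bar>u x\<bar> \<le> M" and \<Phi>: "\<Phi> \<in> test_functions" and R: "supp_ball R g"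
  shows "(\<lambda>n. pint p (commut \<Phi> g n)) \<longlonglongrightarrow> 0"
proof -
  obtain L where L: "L \<ge> 0" "\<And>x y. \<bar>\<Phi> x - \<Phi> y\<bar> \<le> L * norm (x - y)" "\<And>i x. \<bar>partial_deriv i \<Phi> x\<bar> \<le> L"
    using test_function_Lipschitz[OF \<Phi>] by blast
  obtain S where S: "supp_ball S \<Phi>" using test_functionsD(4)[OF \<Phi>] by blast
  obtain N where N: "\<And>x. \<bar>\<Phi> x\<bar> \<le> N" using supp_ball_bounded[OF test_functionsD(2)[OF \<Phi>] S] by blast
  have M0: "0 \<le> M" using M[of 0] by linarith
  note c\<Phi> = test_functionsD(2)[OF \<Phi>] test_functionsD(2)[OF test_functions_partial_deriv[OF \<Phi>]]
  note lu = weakd_locint[OF u]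
  note [measurable] = weakd_measurable[OF u] c\<Phi>[THEN borel_measurable_continuous]
  have w\<Phi>: "weakd i \<Phi> (partial_deriv i \<Phi>)" by (rule weakd_C1[OF test_functionsD(1)[OF \<Phi>]])
  have l\<Phi>g: "locint (\<lambda>x. \<Phi> x * g x)" using locint_mult_bounded[OF lu(2) _ AE_I2[OF N]] by simp
  have lud: "locint (\<lambda>x. u x * partial_deriv i \<Phi> x)"
    using locint_mult_bounded[OF weakd_locint(2)[OF w\<Phi>] _ AE_I2[OF M]] by simp
  have mt: "mo n \<in> test_functions" for n by (rule molf_test[OF mo_pos])
  note ms = molf_continuous[OF mo_pos] supp_ball_molf[OF mo_pos]
  have cm[measurable]: "commut \<Phi> g n \<in> borel_measurable borel" for n
    unfolding commut_def using Ck_continuous[OF Ck_mollify[OF lu(2)]] Ck_continuous[OF Ck_mollify[OF l\<Phi>g]]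
    by (intro borel_measurable_diff borel_measurable_times borel_measurable_continuous c\<Phi>) auto
  let ?B = "M * L + bump_ratio i * (L * M)"
  have bd: "\<bar>commut \<Phi> g n x\<bar> \<le> ?B" for n x
  proof -
    let ?d = "partial_deriv i (mo n)" and ?e = "inverse (real (Suc n))"
    have cd: "continuous_on UNIV ?d" by (rule test_functionsD(2)[OF test_functions_partial_deriv[OF mt]])
    have rd: "supp_ball ?e ?d" by (rule supp_ball_partial_deriv[OF ms(2)])
    have "\<bar>conv (\<lambda>z. u z * partial_deriv i \<Phi> z) (mo n) x - 0\<bar> \<le> M * L"
      using M L M0 by (intro conv_molf_close[OF lud mo_pos]) (auto simp: abs_mult intro!: mult_mono)
    moreover have "\<bar>\<integral>z. (\<Phi> x - \<Phi> z) * u z * ?d (x - z) \<partial>lborel\<bar> \<le> (\<integral>z. (L * ?e * M) * \<bar>?d (x - z)\<bar> \<partial>lborel)"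
    proof (rule integral_abs_bound_integral)
      have b: "\<bar>(\<Phi> x - \<Phi> z) * u z * ?d (x - z)\<bar> \<le> (L * ?e * M) * \<bar>?d (x - z)\<bar>" for z
      proof (cases "norm (x - z) \<le> ?e")
        case True
        have "\<bar>\<Phi> x - \<Phi> z\<bar> \<le> L * ?e" using order_trans[OF L(2) mult_left_mono[OF True L(1)]] .
        then show ?thesis unfolding abs_mult using M M0 L(1) by (intro mult_mono) auto
      next
        case False
        then show ?thesis using supp_ballD[OF rd, of "x - z"] by simp
      qed
      then show "\<bar>(\<Phi> x - \<Phi> z) * u z * ?d (x - z)\<bar> \<le> (L * ?e * M) * \<bar>?d (x - z)\<bar>" for z .
      show i1: "integrable lborel (\<lambda>z. (L * ?e * M) * \<bar>?d (x - z)\<bar>)"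
        by (intro integrable_mult_right integrable_abs integrable_continuous_supp[OF continuous_reflect[OF cd] supp_ball_reflect[OF rd]])
      note [measurable] = borel_measurable_continuous[OF cd]
      show "integrable lborel (\<lambda>z. (\<Phi> x - \<Phi> z) * u z * ?d (x - z))"
      proof (rule Bochner_Integration.integrable_bound[OF i1])
        show "AE z in lborel. norm ((\<Phi> x - \<Phi> z) * u z * ?d (x - z)) \<le> norm ((L * ?e * M) * \<bar>?d (x - z)\<bar>)"
          unfolding real_norm_def by (rule AE_I2, rule order_trans[OF b abs_ge_self])
      qed measurable
    qed
    moreover have "(\<integral>z. (L * ?e * M) * \<bar>?d (x - z)\<bar> \<partial>lborel) = bump_ratio i * (L * M)"
    proof -
      have "(\<integral>z. \<bar>?d (x - z)\<bar> \<partial>lborel) = bump_ratio i * real (Suc n)"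
        using integral_lborel_reflect[of "\<lambda>x. \<bar>?d x\<bar>" x] borel_measurable_continuous[OF cd] integral_abs_partial_deriv_mo[of i n] by simp
      then show ?thesis by (simp del: of_nat_Suc)
    qed
    ultimately show ?thesis
      unfolding commut_def commutator_eq[OF u M w\<Phi> l\<Phi>g mt] by linarith
  qed
  have p1: "pint 1 g < \<infinity>" using locint_integrable_supp[OF lu(2) R] by (subst (asm) integrable_iff_pint_1) auto
  have l1: "pint 1 (commut \<Phi> g n) \<le> ennreal (L * inverse (real (Suc n))) * pint 1 g" for n
  proof -
    let ?e = "inverse (real (Suc n))"
    have "\<bar>commut \<Phi> g n x\<bar> \<le> (L * ?e) * (\<integral>z. \<bar>g z\<bar> * \<bar>mo n (x - z)\<bar> \<partial>lborel)" for x
    proof -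
      have i1: "integrable lborel (\<lambda>z. \<Phi> x * (g z * mo n (x - z)))" "integrable lborel (\<lambda>z. \<Phi> z * g z * mo n (x - z))"
        "integrable lborel (\<lambda>z. (L * ?e) * (\<bar>g z\<bar> * \<bar>mo n (x - z)\<bar>))"
        using conv_integrable[OF lu(2) ms, of n x] conv_integrable[OF l\<Phi>g ms, of n x]
          integrable_abs[OF conv_integrable[OF lu(2) ms, of n x]] by (simp_all add: abs_mult)
      have "commut \<Phi> g n x = (\<integral>z. \<Phi> x * (g z * mo n (x - z)) - \<Phi> z * g z * mo n (x - z) \<partial>lborel)"
        using i1 conv_integrable[OF lu(2) ms, of n x] by (simp add: commut_def conv_def)
      also have "\<bar>\<dots>\<bar> \<le> (\<integral>z. (L * ?e) * (\<bar>g z\<bar> * \<bar>mo n (x - z)\<bar>) \<partial>lborel)"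
      proof (rule integral_abs_bound_integral)
        fix z
        have "\<bar>\<Phi> x * (g z * mo n (x - z)) - \<Phi> z * g z * mo n (x - z)\<bar> = \<bar>\<Phi> x - \<Phi> z\<bar> * (\<bar>g z\<bar> * \<bar>mo n (x - z)\<bar>)"
          by (simp add: algebra_simps flip: abs_mult)
        also have "\<dots> \<le> (L * ?e) * (\<bar>g z\<bar> * \<bar>mo n (x - z)\<bar>)"
        proof (cases "norm (x - z) \<le> ?e")
          case True
          have "\<bar>\<Phi> x - \<Phi> z\<bar> \<le> L * ?e" using order_trans[OF L(2) mult_left_mono[OF True L(1)]] .
          then show ?thesis by (intro mult_right_mono) auto
        next
          case False
          then show ?thesis using supp_ballD[OF ms(2), of n "x - z"] by simp
        qed
        finally show "\<bar>\<Phi> x * (g z * mo n (x - z)) - \<Phi> z * g z * mo n (x - z)\<bar> \<le> (L * ?e) * (\<bar>g z\<bar> * \<bar>mo n (x - z)\<bar>)" .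
      qed (use i1 in auto)
      finally show ?thesis by simp
    qed
    then have "pint 1 (commut \<Phi> g n) \<le> pint 1 (\<lambda>x. (L * ?e) * (\<integral>z. \<bar>g z\<bar> * \<bar>mo n (x - z)\<bar> \<partial>lborel))"
      by (intro pint_mono) (auto intro!: AE_I2 intro: order_trans[OF _ abs_ge_self])
    also have "\<dots> = ennreal ((L * ?e) powr 1) * pint 1 (\<lambda>x. \<integral>z. \<bar>g z\<bar> * \<bar>mo n (x - z)\<bar> \<partial>lborel)"
    proof (rule pint_cmult)
      note [measurable] = borel_measurable_continuous[OF ms(1)]
      show "(\<lambda>x. \<integral>z. \<bar>g z\<bar> * \<bar>mo n (x - z)\<bar> \<partial>lborel) \<in> borel_measurable borel" by measurable
    qed (use L in auto)
    also have "\<dots> \<le> ennreal ((L * ?e) powr 1) * pint 1 g"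
      using pint_conv_abs[OF _ lu(2) ms, of 1 n] integral_abs_molf[OF mo_pos[of n], where 'n = 'n] by (intro mult_left_mono) auto
    finally show ?thesis using L by simp
  qed
  have "(\<lambda>n. pint 1 (commut \<Phi> g n)) \<longlonglongrightarrow> 0"
  proof (rule tendsto_sandwich[OF _ _ tendsto_const])
    have "(\<lambda>n. ennreal (L * inverse (real (Suc n)))) \<longlonglongrightarrow> ennreal (L * 0)"
      by (intro tendsto_ennrealI tendsto_intros LIMSEQ_inverse_real_of_nat)
    then have "(\<lambda>n. pint 1 g * ennreal (L * inverse (real (Suc n)))) \<longlonglongrightarrow> 0"
      using p1 by (intro tendsto_0_ennreal_cmult) auto
    then show "(\<lambda>n. ennreal (L * inverse (real (Suc n))) * pint 1 g) \<longlonglongrightarrow> 0" by (simp only: mult.commute)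
  qed (use l1 in auto)
  then have "(\<lambda>n. ennreal (?B powr (p - 1)) * pint 1 (commut \<Phi> g n)) \<longlonglongrightarrow> 0"
    by (rule tendsto_0_ennreal_cmult) auto
  then show ?thesis
    by (rule tendsto_sandwich[OF _ _ tendsto_const, rotated -1]) (use pint_le_bounded[OF p cm bd] in auto)
qed

section \<open>Approximation by test functions in the weighted norm\<close>

lemma pint_tendsto_0_sum:
  fixes f :: "'i \<Rightarrow> nat \<Rightarrow> 'a::euclidean_space \<Rightarrow> real"
  assumes "finite A" and m: "\<And>i n. i \<in> A \<Longrightarrow> f i n \<in> borel_measurable borel" and p: "0 < p"
    and lim: "\<And>i. i \<in> A \<Longrightarrow> (\<lambda>n. pint p (f i n)) \<longlonglongrightarrow> 0"
  shows "(\<lambda>n. pint p (\<lambda>x. \<Sum>i\<in>A. \<bar>f i n x\<bar>)) \<longlonglongrightarrow> 0"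
  using assms(1) m lim
proof (induction A)
  case empty
  show ?case by (simp add: pint_def)
next
  case (insert i A)
  have [measurable]: "f j n \<in> borel_measurable borel" if "j \<in> insert i A" for j n using insert.prems(1) that .
  have "(\<lambda>n. pint p (\<lambda>x. \<bar>f i n x\<bar> + (\<Sum>i\<in>A. \<bar>f i n x\<bar>))) \<longlonglongrightarrow> 0"
  proof (rule pint_tendsto_0_add)
    show "(\<lambda>n. pint p (\<lambda>x. \<bar>f i n x\<bar>)) \<longlonglongrightarrow> 0" using insert.prems(2)[of i] by (simp add: pint_def)
    show "(\<lambda>n. pint p (\<lambda>x. \<Sum>i\<in>A. \<bar>f i n x\<bar>)) \<longlonglongrightarrow> 0" using insert by simp
  qed (use p in \<open>auto intro!: borel_measurable_sum borel_measurable_abs\<close>)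
  then show ?case using insert.hyps by simp
qed

lemma pint_sum_finite:
  fixes f :: "'i \<Rightarrow> 'a::euclidean_space \<Rightarrow> real"
  assumes "finite A" and p: "0 \<le> p" and m: "\<And>i. i \<in> A \<Longrightarrow> f i \<in> borel_measurable borel" and f: "\<And>i. i \<in> A \<Longrightarrow> pint p (f i) < \<infinity>"
  shows "pint p (\<lambda>x. \<Sum>i\<in>A. \<bar>f i x\<bar>) < \<infinity>"
  using assms(1) m f
proof (induction A)
  case empty
  show ?case by (simp add: pint_def)
next
  case (insert i A)
  have [measurable]: "f j \<in> borel_measurable borel" if "j \<in> insert i A" for j using insert.prems(1) that .
  have "pint p (\<lambda>x. \<bar>f i x\<bar> + (\<Sum>i\<in>A. \<bar>f i x\<bar>)) \<le> ennreal (2 powr p) * (pint p (\<lambda>x. \<bar>f i x\<bar>) + pint p (\<lambda>x. \<Sum>i\<in>A. \<bar>f i x\<bar>))"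
    by (rule pint_add) (use p in \<open>auto intro!: borel_measurable_sum borel_measurable_abs\<close>)
  also have "pint p (\<lambda>x. \<bar>f i x\<bar>) = pint p (f i)" by (simp add: pint_def)
  finally show ?case using insert by (auto simp: ennreal_mult_less_top intro: le_less_trans)
qed

text \<open>Convergence of the mollified derivative in the weighted norm, for bounded \<open>u\<close> of compact support: \<open>\<phi>\<close> is split into a test
  function \<open>\<Phi>\<close> and a remainder \<open>\<psi>\<close> with small gradient.\<close>

lemma weighted_mollify:
  fixes \<phi> u g :: "real ^ 'n::finite \<Rightarrow> real" and d\<phi> :: "'n \<Rightarrow> real ^ 'n \<Rightarrow> real"
  assumes p: "1 \<le> p" and w: "\<And>j. weakd j \<phi> (d\<phi> j)" and S: "supp_ball S \<phi>" and Sd: "\<And>j. supp_ball S (d\<phi> j)"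
    and fd: "\<And>j. pint p (d\<phi> j) < \<infinity>"
    and u: "weakd i u g" and M: "\<And>x. \<bar>u x\<bar> \<le> M" and R: "supp_ball R g" and fg: "pint p (\<lambda>x. \<phi> x * g x) < \<infinity>"
  shows "(\<lambda>n. pint p (\<lambda>x. \<phi> x * (conv g (mo n) x - g x))) \<longlonglongrightarrow> 0"
proof (rule ennreal_tendsto_0I)
  fix e :: real assume e: "0 < e"
  note [measurable] = weakd_measurable[OF w] weakd_measurable[OF u]
  note l\<phi> = weakd_locint[OF w] and lu = weakd_locint[OF u]
  define K where "K = 2 powr p * (M powr p + (bump_ratio i * M) powr p)"
  define e' where "e' = e / (3 * 4 powr p)"
  \<comment> \<open>The constant \<open>K\<close> is the one in the uniform bound for the commutator, and \<open>\<delta>\<close> bounds the gradient of the remainder.\<close>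
  define \<delta> where "\<delta> = e' / (K + 1)"
  have K0: "0 \<le> K" unfolding K_def by simp
  have e': "0 < e'" using e by (simp add: e'_def)
  have \<delta>: "0 < \<delta>" using K0 e' by (simp add: \<delta>_def)
  have cm[measurable]: "conv f (mo n) \<in> borel_measurable borel" if "locint f" for f :: "real ^ 'n \<Rightarrow> real" and n
    by (rule borel_measurable_continuous[OF Ck_continuous[OF Ck_mollify[OF that]]])
  have cmd[measurable]: "conv (d\<phi> j) (mo n) \<in> borel_measurable borel" for j n by (rule cm[OF l\<phi>(2)])
  have "(\<lambda>m. pint p (\<lambda>x. \<Sum>j\<in>UNIV. \<bar>conv (d\<phi> j) (mo m) x - d\<phi> j x\<bar>)) \<longlonglongrightarrow> 0"
  proof (rule pint_tendsto_0_sum)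
    show "(\<lambda>x. conv (d\<phi> j) (mo n) x - d\<phi> j x) \<in> borel_measurable borel" for j n by measurable
    show "(\<lambda>m. pint p (\<lambda>x. conv (d\<phi> j) (mo m) x - d\<phi> j x)) \<longlonglongrightarrow> 0" for j
      by (rule Lp_mollify[OF _ p fd Sd]) measurable
  qed (use p in auto)
  from eventually_happens[OF ennreal_tendsto_0D[OF this \<delta>]]
  obtain m where m: "pint p (\<lambda>x. \<Sum>j\<in>UNIV. \<bar>conv (d\<phi> j) (mo m) x - d\<phi> j x\<bar>) \<le> ennreal \<delta>" by auto
  define \<Phi> where "\<Phi> = conv \<phi> (mo m)"
  define \<psi> where "\<psi> x = \<phi> x - \<Phi> x" for x
  have \<Phi>: "\<Phi> \<in> test_functions" unfolding \<Phi>_def by (rule conv_test[OF l\<phi>(1) S molf_test[OF mo_pos]])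
  have w\<Phi>: "weakd j \<Phi> (conv (d\<phi> j) (mo m))" for j
    using weakd_C1[OF test_functionsD(1)[OF \<Phi>], of j] partial_deriv_conv_weakd[OF w[of j] molf_test[OF mo_pos[of m]]]
    by (simp add: \<Phi>_def)
  have w\<psi>: "weakd j \<psi> (\<lambda>x. d\<phi> j x - conv (d\<phi> j) (mo m) x)" for j
    using weakd_diff[OF w w\<Phi>, of j] by (simp add: \<psi>_def[abs_def])
  obtain S' where S': "supp_ball S' \<Phi>" using test_functionsD(4)[OF \<Phi>] by blast
  have S\<psi>: "supp_ball (max S S') \<psi>" using S S' by (auto simp: supp_ball_def \<psi>_def)
  obtain N where N: "\<And>x. \<bar>\<Phi> x\<bar> \<le> N" using supp_ball_bounded[OF test_functionsD(2)[OF \<Phi>] S'] by blast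
  note [measurable] = borel_measurable_continuous[OF test_functionsD(2)[OF \<Phi>]]
  have l\<phi>g: "locint (\<lambda>x. \<phi> x * g x)" by (rule pint_finite_locint[OF _ p fg]) measurable
  have l\<Phi>g: "locint (\<lambda>x. \<Phi> x * g x)" using locint_mult_bounded[OF lu(2) _ AE_I2[OF N]] by simp
  have l\<psi>g: "locint (\<lambda>x. \<psi> x * g x)" using locint_diff[OF l\<phi>g l\<Phi>g] by (simp add: \<psi>_def left_diff_distrib)
  have [measurable]: "\<psi> \<in> borel_measurable borel" by (rule weakd_measurable(1)[OF w\<psi>])
  note cg = cm[OF lu(2)] cm[OF l\<phi>g] cm[OF l\<Phi>g] cm[OF l\<psi>g]
  have cmm: "commut \<psi> g n \<in> borel_measurable borel" "commut \<Phi> g n \<in> borel_measurable borel" for n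
    unfolding commut_def using cg[of n] by measurable
  have c\<psi>: "pint p (commut \<psi> g n) \<le> ennreal e'" for n
  proof -
    have "pint p (commut \<psi> g n) \<le> ennreal K * pint p (\<lambda>x. \<Sum>j\<in>UNIV. \<bar>d\<phi> j x - conv (d\<phi> j) (mo m) x\<bar>)"
      unfolding K_def by (rule pint_commut_le[OF p u M w\<psi> S\<psi> l\<psi>g])
    also have "\<dots> \<le> ennreal K * ennreal \<delta>" using m by (intro mult_left_mono) (auto simp: abs_minus_commute)
    also have "\<dots> = ennreal (K * \<delta>)" using K0 \<delta> by (simp add: ennreal_mult)
    also have "\<dots> \<le> ennreal e'" using K0 e' by (intro ennreal_leI) (simp add: \<delta>_def field_simps)
    finally show ?thesis .
  qed
  have "(\<lambda>n. pint p (commut \<Phi> g n)) \<longlonglongrightarrow> 0" by (rule pint_commut_test_tendsto_0[OF p u M \<Phi> R])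
  from ennreal_tendsto_0D[OF this e'] have c\<Phi>: "\<forall>\<^sub>F n in sequentially. pint p (commut \<Phi> g n) \<le> ennreal e'" .
  have "(\<lambda>n. pint p (\<lambda>x. conv (\<lambda>x. \<phi> x * g x) (mo n) x - \<phi> x * g x)) \<longlonglongrightarrow> 0"
    by (rule Lp_mollify[OF _ p fg, of R]) (use R in \<open>auto simp: supp_ball_def\<close>)
  from ennreal_tendsto_0D[OF this e'] c\<Phi>
  show "\<forall>\<^sub>F n in sequentially. pint p (\<lambda>x. \<phi> x * (conv g (mo n) x - g x)) \<le> ennreal e"
  proof eventually_elim
    case (elim n)
    have ci: "integrable lborel (\<lambda>z. f z * mo n (x - z))" if "locint f" for f :: "real ^ 'n \<Rightarrow> real" and x
      by (rule conv_integrable[OF that molf_continuous[OF mo_pos] supp_ball_molf[OF mo_pos]])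
    have "conv (\<lambda>x. \<phi> x * g x) (mo n) x = conv (\<lambda>x. \<psi> x * g x) (mo n) x + conv (\<lambda>x. \<Phi> x * g x) (mo n) x" for x
    proof -
      have "conv (\<lambda>x. \<psi> x * g x) (mo n) x + conv (\<lambda>x. \<Phi> x * g x) (mo n) x =
        (\<integral>z. \<psi> z * g z * mo n (x - z) + \<Phi> z * g z * mo n (x - z) \<partial>lborel)"
        unfolding conv_def using ci[OF l\<psi>g, of x] ci[OF l\<Phi>g, of x] by simp
      then show ?thesis by (simp add: conv_def \<psi>_def algebra_simps)
    qed
    then have "pint p (\<lambda>x. \<phi> x * (conv g (mo n) x - g x)) =
      pint p (\<lambda>x. commut \<psi> g n x + commut \<Phi> g n x + (conv (\<lambda>x. \<phi> x * g x) (mo n) x - \<phi> x * g x))"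
      by (simp add: commut_def \<psi>_def algebra_simps)
    also have "\<dots> \<le> ennreal (4 powr p) * (pint p (commut \<psi> g n) + pint p (commut \<Phi> g n) +
        pint p (\<lambda>x. conv (\<lambda>x. \<phi> x * g x) (mo n) x - \<phi> x * g x))"
    proof (rule pint_triangle3)
      show "(\<lambda>x. conv (\<lambda>x. \<phi> x * g x) (mo n) x - \<phi> x * g x) \<in> borel_measurable borel"
        using cg(2)[of n] by measurable
    qed (use p cmm in auto)
    also have "\<dots> \<le> ennreal (4 powr p) * (ennreal e' + ennreal e' + ennreal e')"
      by (intro mult_left_mono add_mono c\<psi> elim) auto
    also have "ennreal e' + ennreal e' + ennreal e' = ennreal (3 * e')"
      using e' by (simp flip: ennreal_plus)
    also have "ennreal (4 powr p) * \<dots> = ennreal e"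
      using e' by (auto simp: ennreal_mult[symmetric] e'_def)
    finally show ?case .
  qed
qed

lemma approx_bounded_compact:
  fixes \<phi> u :: "real ^ 'n::finite \<Rightarrow> real" and d\<phi> g :: "'n \<Rightarrow> real ^ 'n \<Rightarrow> real"
  assumes p: "1 \<le> p" and w: "\<And>j. weakd j \<phi> (d\<phi> j)" and S: "supp_ball S \<phi>" and Sd: "\<And>j. supp_ball S (d\<phi> j)"
    and f: "pint p \<phi> < \<infinity>" and fd: "\<And>j. pint p (d\<phi> j) < \<infinity>"
    and u: "\<And>i. weakd i u (g i)" and M: "\<And>x. \<bar>u x\<bar> \<le> M" and Ru: "supp_ball R u" and R: "\<And>i. supp_ball R (g i)"
    and fg: "\<And>i. pint p (\<lambda>x. \<phi> x * g i x) < \<infinity>" and e: "0 < (e::real)"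
  shows "\<exists>U\<in>test_functions. supp_ball (R + 1) U \<and> pint p (\<lambda>x. \<phi> x * (U x - u x)) \<le> ennreal e \<and>
     (\<forall>i. pint p (\<lambda>x. \<phi> x * (partial_deriv i U x - g i x)) \<le> ennreal e)"
proof -
  note [measurable] = weakd_measurable[OF w] weakd_measurable[OF u]
  note lu = weakd_locint[OF u]
  have cm[measurable]: "conv u (mo n) \<in> borel_measurable borel" for n
    by (rule borel_measurable_continuous[OF Ck_continuous[OF Ck_mollify[OF lu(1)]]])
  have "pint 1 u < \<infinity>" using locint_integrable_supp[OF lu(1) Ru] by (subst (asm) integrable_iff_pint_1) auto
  then have "(\<lambda>n. pint 1 (\<lambda>x. conv u (mo n) x - u x)) \<longlonglongrightarrow> 0" by (intro Lp_mollify[OF _ _ _ Ru]) auto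
  then obtain r where r: "strict_mono r" "AE x in lborel. (\<lambda>n. conv u (mo (r n)) x - u x) \<longlonglongrightarrow> 0"
    using pint_AE_subseq[of "\<lambda>n x. conv u (mo n) x - u x" 1] cm by auto
  have M0: "0 \<le> M" using M[of 0] by linarith
  have "(\<lambda>n. pint p (\<lambda>x. \<phi> x * (conv u (mo (r n)) x - u x))) \<longlonglongrightarrow> 0"
  proof (rule pint_tendsto_0_dominated[where W = "\<lambda>x. (2 * M) * \<phi> x"])
    show "(\<lambda>x. \<phi> x * (conv u (mo (r n)) x - u x)) \<in> borel_measurable borel" for n by measurable
    show "AE x in lborel. (\<lambda>n. \<phi> x * (conv u (mo (r n)) x - u x)) \<longlonglongrightarrow> 0"
      using r(2) by eventually_elim (auto intro: tendsto_mult_right_zero)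
    show "AE x in lborel. \<bar>\<phi> x * (conv u (mo (r n)) x - u x)\<bar> \<le> \<bar>(2 * M) * \<phi> x\<bar>" for n
    proof (rule AE_I2)
      fix x
      have "\<bar>conv u (mo (r n)) x - 0\<bar> \<le> M" using M by (intro conv_molf_close[OF lu(1) mo_pos]) auto
      then have "\<bar>conv u (mo (r n)) x - u x\<bar> \<le> \<bar>2 * M\<bar>" using M[of x] by linarith
      then show "\<bar>\<phi> x * (conv u (mo (r n)) x - u x)\<bar> \<le> \<bar>(2 * M) * \<phi> x\<bar>"
        by (metis abs_ge_zero abs_mult mult.commute mult_left_mono)
    qed
    have "pint p (\<lambda>x. (2 * M) * \<phi> x) = ennreal ((2 * M) powr p) * pint p \<phi>" using M0 by (intro pint_cmult) auto
    also have "\<dots> < \<infinity>" using f by (simp add: ennreal_mult_less_top)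
    finally show "pint p (\<lambda>x. (2 * M) * \<phi> x) < \<infinity>" .
  qed (use p in auto)
  then have 1: "\<forall>\<^sub>F n in sequentially. pint p (\<lambda>x. \<phi> x * (conv u (mo (r n)) x - u x)) \<le> ennreal e"
    by (rule ennreal_tendsto_0D[OF _ e])
  have "(\<lambda>n. pint p (\<lambda>x. \<phi> x * (conv (g i) (mo (r n)) x - g i x))) \<longlonglongrightarrow> 0" for i
    using LIMSEQ_subseq_LIMSEQ[OF weighted_mollify[OF p w S Sd fd u M R fg, of i] r(1)] by (simp add: o_def)
  then have 2: "\<forall>\<^sub>F n in sequentially. pint p (\<lambda>x. \<phi> x * (conv (g i) (mo (r n)) x - g i x)) \<le> ennreal e" for i
    by (rule ennreal_tendsto_0D[OF _ e])
  then have "\<forall>\<^sub>F n in sequentially. \<forall>i. pint p (\<lambda>x. \<phi> x * (conv (g i) (mo (r n)) x - g i x)) \<le> ennreal e"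
    by (rule eventually_all_finite)
  with 1 have "\<forall>\<^sub>F n in sequentially. pint p (\<lambda>x. \<phi> x * (conv u (mo (r n)) x - u x)) \<le> ennreal e \<and>
     (\<forall>i. pint p (\<lambda>x. \<phi> x * (conv (g i) (mo (r n)) x - g i x)) \<le> ennreal e)" by (rule eventually_conj)
  from eventually_happens[OF this] obtain n where n: "pint p (\<lambda>x. \<phi> x * (conv u (mo (r n)) x - u x)) \<le> ennreal e"
     "\<And>i. pint p (\<lambda>x. \<phi> x * (conv (g i) (mo (r n)) x - g i x)) \<le> ennreal e" by auto
  show ?thesis
  proof (intro bexI[of _ "conv u (mo (r n))"] conjI allI)
    show "conv u (mo (r n)) \<in> test_functions" by (rule conv_test[OF lu(1) Ru molf_test[OF mo_pos]])
    show "supp_ball (R + 1) (conv u (mo (r n)))"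
      by (rule supp_ball_mono[OF supp_ball_conv[OF Ru supp_ball_molf[OF mo_pos]]]) (simp add: field_simps)
    show "pint p (\<lambda>x. \<phi> x * (partial_deriv i (conv u (mo (r n))) x - g i x)) \<le> ennreal e" for i
      using n(2)[of i] partial_deriv_conv_weakd[OF u[of i] molf_test[OF mo_pos[of "r n"]]] by simp
  qed (rule n(1))
qed

text \<open>A smooth function with values in the unit interval, equal to one on the ball of radius \<open>k + 1\<close> and zero outside the ball
  of radius \<open>3 (k + 1)\<close>, with gradient of order \<open>1 / (k + 1)\<close>.\<close>

definition cutoff :: "nat \<Rightarrow> real ^ 'n::finite \<Rightarrow> real" where
  "cutoff k x = conv (indicator (cball 0 2)) (molf 1) ((1 / real (Suc k)) *\<^sub>R x)"

lemma locint_indicator_cball: "locint (indicator (cball 0 r) :: 'a::euclidean_space \<Rightarrow> real)"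
  by (rule integrable_imp_locint[OF integrable_indicator_cball])

lemma supp_ball_indicator: "supp_ball r (indicator (cball 0 r) :: 'a::real_normed_vector \<Rightarrow> real)"
  by (auto simp: supp_ball_def)

lemma cutoff_test: "(cutoff k :: real ^ 'n::finite \<Rightarrow> real) \<in> test_functions"
proof -
  have "conv (indicator (cball 0 2)) (molf 1) \<in> (test_functions :: (real ^ 'n \<Rightarrow> real) set)"
    by (rule conv_test[OF locint_indicator_cball supp_ball_indicator molf_test]) simp
  from test_functions_affine[OF this, of "1 / real (Suc k)" 0] show ?thesis
    by (simp add: cutoff_def[abs_def])
qed

lemma cutoff_eq_1:
  assumes "norm x \<le> real (Suc k)" shows "cutoff k x = 1"
proof -
  have "\<bar>conv (indicator (cball 0 2)) (molf 1) ((1 / real (Suc k)) *\<^sub>R x) - 1\<bar> \<le> 0"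
  proof (rule conv_molf_close[OF locint_indicator_cball])
    fix z assume z: "norm ((1 / real (Suc k)) *\<^sub>R x - z) \<le> 1"
    have "norm ((1 / real (Suc k)) *\<^sub>R x) \<le> 1" using assms by (simp add: field_simps)
    then have "norm z \<le> 2" using z norm_triangle_sub[of z "(1 / real (Suc k)) *\<^sub>R x"] norm_minus_commute[of z "(1 / real (Suc k)) *\<^sub>R x"]
      by linarith
    then show "\<bar>indicator (cball 0 2) z - 1\<bar> \<le> (0::real)" by simp
  qed simp
  then show ?thesis by (simp add: cutoff_def)
qed

lemma cutoff_abs_le: "\<bar>cutoff k x\<bar> \<le> 1"
proof -
  have "\<bar>conv (indicator (cball 0 2)) (molf 1) ((1 / real (Suc k)) *\<^sub>R x) - 0\<bar> \<le> 1"
    by (rule conv_molf_close[OF locint_indicator_cball]) (auto simp: indicator_def)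
  then show ?thesis by (simp add: cutoff_def)
qed

lemma supp_ball_cutoff: "supp_ball (3 * real (Suc k)) (cutoff k)"
proof -
  have "supp_ball (2 + 1) (conv (indicator (cball 0 2)) (molf 1) :: real ^ 'a \<Rightarrow> real)"
    by (rule supp_ball_conv[OF _ supp_ball_molf]) (auto simp: supp_ball_def)
  then show ?thesis by (auto simp: supp_ball_def cutoff_def field_simps simp del: of_nat_Suc)
qed

lemma partial_deriv_cutoff_bound:
  "\<exists>C\<ge>0. \<forall>k (x :: real ^ 'n::finite). \<bar>partial_deriv i (cutoff k) x\<bar> \<le> C / real (Suc k)"
proof -
  let ?\<zeta> = "conv (indicator (cball 0 2)) (molf 1) :: real ^ 'n \<Rightarrow> real"
  have t: "?\<zeta> \<in> test_functions"
    by (rule conv_test[OF locint_indicator_cball supp_ball_indicator molf_test]) simp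
  obtain L where L: "L \<ge> 0" "\<And>x. \<bar>partial_deriv i ?\<zeta> x\<bar> \<le> L" using test_function_Lipschitz[OF t] by blast
  have "\<bar>partial_deriv i (cutoff k) x\<bar> \<le> L / real (Suc k)" for k x
  proof -
    have "cutoff k = (\<lambda>x. ?\<zeta> (0 + (1 / real (Suc k)) *\<^sub>R x))" by (simp add: cutoff_def[abs_def])
    then have "partial_deriv i (cutoff k) x = (1 / real (Suc k)) * partial_deriv i ?\<zeta> (0 + (1 / real (Suc k)) *\<^sub>R x)"
      using partial_deriv_affine[OF test_functionsD(3)[OF t]] by metis
    then show ?thesis using L(2)[of "0 + (1 / real (Suc k)) *\<^sub>R x"] by (simp add: abs_mult divide_right_mono)
  qed
  with L(1) show ?thesis by blast
qed

text \<open>Density of the test functions: a single test function approximates \<open>u\<close> together with all its partial derivatives.\<close>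

theorem approx_weighted:
  fixes \<phi> u :: "real ^ 'n::finite \<Rightarrow> real" and d\<phi> g :: "'n \<Rightarrow> real ^ 'n \<Rightarrow> real"
  assumes p: "1 \<le> p" and w: "\<And>j. weakd j \<phi> (d\<phi> j)"
    and f: "\<And>R. pint p (\<lambda>x. indicator (cball 0 R) x * \<phi> x) < \<infinity>"
    and fd: "\<And>j R. pint p (\<lambda>x. indicator (cball 0 R) x * d\<phi> j x) < \<infinity>"
    and u: "\<And>i. weakd i u (g i)"
    and fu: "pint p (\<lambda>x. \<phi> x * u x) < \<infinity>" and fg: "\<And>i. pint p (\<lambda>x. \<phi> x * g i x) < \<infinity>" and e: "0 < (e::real)"
  shows "\<exists>U\<in>test_functions. pint p (\<lambda>x. \<phi> x * (U x - u x)) \<le> ennreal e \<and>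
     (\<forall>i. pint p (\<lambda>x. \<phi> x * (partial_deriv i U x - g i x)) \<le> ennreal e)"
proof -
  note [measurable] = weakd_measurable[OF w] weakd_measurable[OF u]
  have p_pos: "0 \<le> p" "0 < p" using p by auto
  obtain C where C: "\<And>i. C i \<ge> 0" "\<And>i k x. \<bar>partial_deriv i (cutoff k) (x :: real ^ 'n)\<bar> \<le> C i / real (Suc k)"
    using partial_deriv_cutoff_bound[where 'n = 'n] by metis
  have cutm[measurable]: "cutoff k \<in> borel_measurable borel" "partial_deriv i (cutoff k) \<in> borel_measurable borel" for k and i :: 'n
    by (rule borel_measurable_continuous[OF test_functionsD(2)[OF cutoff_test]]
       borel_measurable_continuous[OF test_functionsD(2)[OF test_functions_partial_deriv[OF cutoff_test]]])+
  \<comment> \<open>A bounded function of compact support close to \<open>u\<close>, and its gradient.\<close>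
  define v where "v k x = cutoff k x * trunc k (u x)" for k x
  define G where "G i k x = cutoff k x * (trunc' k (u x) * g i x) + partial_deriv i (cutoff k) x * trunc k (u x)" for i k x
  have wv: "weakd i (v k) (G i k)" for i k
    unfolding v_def[abs_def] G_def[abs_def] by (rule weakd_cutoff[OF weakd_trunc[OF u] cutoff_test])
  note [measurable] = weakd_measurable[OF wv]
  have v_le: "\<bar>v k x\<bar> \<le> \<bar>u x\<bar>" for k x
    using mult_mono[OF cutoff_abs_le[of k x] trunc_le[of k "u x"]] by (simp add: v_def abs_mult)
  have G_le: "\<bar>G i k x\<bar> \<le> \<bar>g i x\<bar> + C i * \<bar>u x\<bar>" for i k x
  proof -
    have "\<bar>cutoff k x * (trunc' k (u x) * g i x)\<bar> \<le> 1 * (1 * \<bar>g i x\<bar>)"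
      unfolding abs_mult using trunc'_pos[of k "u x"] trunc'_le[of k "u x"]
      by (intro mult_mono cutoff_abs_le) auto
    moreover have "\<bar>partial_deriv i (cutoff k) x * trunc k (u x)\<bar> \<le> C i * \<bar>u x\<bar>"
    proof -
      have "C i / real (Suc k) \<le> C i" using C(1)[of i] by (simp add: field_simps)
      then show ?thesis unfolding abs_mult using C(1)[of i]
        by (intro mult_mono trunc_le order_trans[OF C(2)]) auto
    qed
    ultimately show ?thesis unfolding G_def by (auto intro: order_trans[OF abs_triangle_ineq])
  qed
  have cut_lim: "(\<lambda>k. cutoff k x) \<longlonglongrightarrow> 1" for x :: "real ^ 'n"
  proof (rule tendsto_eventually)
    show "\<forall>\<^sub>F k in sequentially. cutoff k x = 1"
      using eventually_ge_at_top[of "nat \<lceil>norm x\<rceil>"]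
      by eventually_elim (rule cutoff_eq_1, linarith)
  qed
  have pd_lim: "(\<lambda>k. partial_deriv i (cutoff k) x) \<longlonglongrightarrow> 0" for x :: "real ^ 'n" and i
    by (rule tendsto_rabs_zero_cancel, rule tendsto_sandwich[OF _ _ tendsto_const lim_const_over_n[of "C i", THEN LIMSEQ_Suc]])
      (use C(2)[of i] in auto)
  define e1 where "e1 = e / (2 * 2 powr p)"
  have e1: "0 < e1" using e by (simp add: e1_def)
  have fC: "pint p (\<lambda>x. c * (\<phi> x * u x)) < \<infinity>" if "0 \<le> c" for c
    using pint_cmult[of "\<lambda>x. \<phi> x * u x" c p] fu that by (simp add: ennreal_mult_less_top)
  have fW: "pint p (\<lambda>x. \<bar>2 * (\<phi> x * g i x)\<bar> + \<bar>C i * (\<phi> x * u x)\<bar>) < \<infinity>" for i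
  proof (rule le_less_trans[OF pint_add])
    have "pint p (\<lambda>x. \<bar>2 * (\<phi> x * g i x)\<bar>) = ennreal (2 powr p) * pint p (\<lambda>x. \<phi> x * g i x)"
      using pint_cmult[of "\<lambda>x. \<phi> x * g i x" 2 p] by (simp add: pint_def)
    moreover have "pint p (\<lambda>x. \<bar>C i * (\<phi> x * u x)\<bar>) < \<infinity>" using fC[OF C(1)[of i]] by (simp add: pint_def)
    ultimately show "ennreal (2 powr p) * (pint p (\<lambda>x. \<bar>2 * (\<phi> x * g i x)\<bar>) + pint p (\<lambda>x. \<bar>C i * (\<phi> x * u x)\<bar>)) < \<infinity>"
      using fg[of i] by (simp add: ennreal_mult_less_top)
  qed (use p_pos in auto)
  have "(\<lambda>k. pint p (\<lambda>x. \<phi> x * (v k x - u x))) \<longlonglongrightarrow> 0"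
  proof (rule pint_tendsto_0_dominated[where W = "\<lambda>x. 2 * (\<phi> x * u x)"])
    show "AE x in lborel. (\<lambda>k. \<phi> x * (v k x - u x)) \<longlonglongrightarrow> 0"
    proof (rule AE_I2)
      fix x
      have "(\<lambda>k. \<phi> x * (v k x - u x)) \<longlonglongrightarrow> \<phi> x * (1 * u x - u x)"
        unfolding v_def by (intro tendsto_intros cut_lim trunc_tendsto)
      then show "(\<lambda>k. \<phi> x * (v k x - u x)) \<longlonglongrightarrow> 0" by simp
    qed
    show "AE x in lborel. \<bar>\<phi> x * (v k x - u x)\<bar> \<le> \<bar>2 * (\<phi> x * u x)\<bar>" for k
    proof (rule AE_I2)
      fix x
      have "\<bar>\<phi> x\<bar> * \<bar>v k x - u x\<bar> \<le> \<bar>\<phi> x\<bar> * (2 * \<bar>u x\<bar>)" using v_le[of k x] by (intro mult_left_mono) auto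
      then show "\<bar>\<phi> x * (v k x - u x)\<bar> \<le> \<bar>2 * (\<phi> x * u x)\<bar>" by (simp add: abs_mult)
    qed
  qed (use p_pos fC[of 2] in auto)
  then have A: "\<forall>\<^sub>F k in sequentially. pint p (\<lambda>x. \<phi> x * (v k x - u x)) \<le> ennreal e1"
    by (rule ennreal_tendsto_0D[OF _ e1])
  have "(\<lambda>k. pint p (\<lambda>x. \<phi> x * (G i k x - g i x))) \<longlonglongrightarrow> 0" for i
  proof (rule pint_tendsto_0_dominated[where W = "\<lambda>x. \<bar>2 * (\<phi> x * g i x)\<bar> + \<bar>C i * (\<phi> x * u x)\<bar>"])
    show "AE x in lborel. (\<lambda>k. \<phi> x * (G i k x - g i x)) \<longlonglongrightarrow> 0"
    proof (rule AE_I2)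
      fix x
      have "(\<lambda>k. \<phi> x * (G i k x - g i x)) \<longlonglongrightarrow> \<phi> x * ((1 * (1 * g i x) + 0 * u x) - g i x)"
        unfolding G_def by (intro tendsto_intros cut_lim trunc_tendsto trunc'_tendsto pd_lim)
      then show "(\<lambda>k. \<phi> x * (G i k x - g i x)) \<longlonglongrightarrow> 0" by simp
    qed
    show "AE x in lborel. \<bar>\<phi> x * (G i k x - g i x)\<bar> \<le> \<bar>\<bar>2 * (\<phi> x * g i x)\<bar> + \<bar>C i * (\<phi> x * u x)\<bar>\<bar>" for k
    proof (rule AE_I2)
      fix x
      have "\<bar>\<phi> x * (G i k x - g i x)\<bar> \<le> \<bar>\<phi> x\<bar> * (2 * \<bar>g i x\<bar> + C i * \<bar>u x\<bar>)"
        unfolding abs_mult using G_le[of i k x] by (intro mult_left_mono) auto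
      also have "\<dots> = \<bar>\<bar>2 * (\<phi> x * g i x)\<bar> + \<bar>C i * (\<phi> x * u x)\<bar>\<bar>"
        using C(1)[of i] by (simp add: abs_mult algebra_simps)
      finally show "\<bar>\<phi> x * (G i k x - g i x)\<bar> \<le> \<bar>\<bar>2 * (\<phi> x * g i x)\<bar> + \<bar>C i * (\<phi> x * u x)\<bar>\<bar>" .
    qed
  qed (use p_pos fW[of i] in auto)
  then have "\<forall>\<^sub>F k in sequentially. pint p (\<lambda>x. \<phi> x * (G i k x - g i x)) \<le> ennreal e1" for i
    by (rule ennreal_tendsto_0D[OF _ e1])
  then have "\<forall>\<^sub>F k in sequentially. \<forall>i. pint p (\<lambda>x. \<phi> x * (G i k x - g i x)) \<le> ennreal e1"
    by (rule eventually_all_finite)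
  from eventually_happens[OF eventually_conj[OF A this]]
  obtain k where k: "pint p (\<lambda>x. \<phi> x * (v k x - u x)) \<le> ennreal e1"
     "\<And>i. pint p (\<lambda>x. \<phi> x * (G i k x - g i x)) \<le> ennreal e1" by auto
  define R where "R = 3 * real (Suc k)"
  have Rv: "supp_ball R (v k)" using supp_ball_cutoff[of k] by (auto simp: supp_ball_def v_def R_def)
  have RG: "supp_ball R (G i k)" for i
    using supp_ball_cutoff[of k] supp_ball_partial_deriv[OF supp_ball_cutoff[of k], of i] by (auto simp: supp_ball_def G_def R_def)
  \<comment> \<open>On the ball of radius \<open>R + 1\<close>, which contains the supports of \<open>v k\<close> and of its approximation, the second cutoff is one.\<close>
  define K where "K = nat \<lceil>R + 1\<rceil>"
  have K: "R + 1 \<le> real (Suc K)" unfolding K_def by linarith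
  define S where "S = 3 * real (Suc K)"
  define \<phi>' where "\<phi>' x = cutoff K x * \<phi> x" for x
  define d\<phi>' where "d\<phi>' j x = cutoff K x * d\<phi> j x + partial_deriv j (cutoff K) x * \<phi> x" for j x
  have w': "weakd j \<phi>' (d\<phi>' j)" for j
    unfolding \<phi>'_def[abs_def] d\<phi>'_def[abs_def] by (rule weakd_cutoff[OF w cutoff_test])
  have S': "supp_ball S \<phi>'" "supp_ball S (d\<phi>' j)" for j
    using supp_ball_cutoff[of K] supp_ball_partial_deriv[OF supp_ball_cutoff[of K], of j]
    by (auto simp: supp_ball_def \<phi>'_def d\<phi>'_def S_def)
  note [measurable] = weakd_measurable[OF w']
  have \<phi>'_le: "\<bar>\<phi>' x\<bar> \<le> \<bar>\<phi> x\<bar>" for x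
    using mult_right_mono[OF cutoff_abs_le[of K x], of "\<bar>\<phi> x\<bar>"] by (simp add: \<phi>'_def abs_mult)
  have f': "pint p \<phi>' < \<infinity>"
  proof (rule le_less_trans[OF pint_mono f[of S]])
    have "\<bar>\<phi>' x\<bar> \<le> \<bar>indicator (cball 0 S) x * \<phi> x\<bar>" for x
      using \<phi>'_le[of x] supp_ballD[OF S'(1), of x] by (cases "norm x \<le> S") auto
    then show "AE x in lborel. \<bar>\<phi>' x\<bar> \<le> \<bar>indicator (cball 0 S) x * \<phi> x\<bar>" by simp
  qed (use p_pos in auto)
  have fd': "pint p (d\<phi>' j) < \<infinity>" for j
  proof (rule le_less_trans[OF pint_mono])
    let ?W = "\<lambda>x. \<bar>indicator (cball 0 S) x * d\<phi> j x\<bar> + \<bar>C j * (indicator (cball 0 S) x * \<phi> x)\<bar>"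
    have "\<bar>d\<phi>' j x\<bar> \<le> \<bar>?W x\<bar>" for x
    proof (cases "norm x \<le> S")
      case True
      have "C j / real (Suc K) \<le> C j" using C(1)[of j] by (simp add: field_simps)
      then have "\<bar>partial_deriv j (cutoff K) x\<bar> \<le> C j" using C(2)[of j K x] by linarith
      then have "\<bar>partial_deriv j (cutoff K) x * \<phi> x\<bar> \<le> C j * \<bar>\<phi> x\<bar>" unfolding abs_mult by (intro mult_right_mono) auto
      moreover have "\<bar>cutoff K x * d\<phi> j x\<bar> \<le> 1 * \<bar>d\<phi> j x\<bar>" unfolding abs_mult by (intro mult_right_mono cutoff_abs_le) auto
      ultimately show ?thesis using True C(1)[of j] unfolding d\<phi>'_def
        by (auto simp: abs_mult intro: order_trans[OF abs_triangle_ineq])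
    qed (use supp_ballD[OF S'(2), of x j] in auto)
    then show "AE x in lborel. \<bar>d\<phi>' j x\<bar> \<le> \<bar>?W x\<bar>" by (rule AE_I2)
    have "pint p ?W \<le> ennreal (2 powr p) * (pint p (\<lambda>x. \<bar>indicator (cball 0 S) x * d\<phi> j x\<bar>) + pint p (\<lambda>x. \<bar>C j * (indicator (cball 0 S) x * \<phi> x)\<bar>))"
      by (rule pint_add) (use p_pos in auto)
    also have "pint p (\<lambda>x. \<bar>indicator (cball 0 S) x * d\<phi> j x\<bar>) = pint p (\<lambda>x. indicator (cball 0 S) x * d\<phi> j x)" by (simp add: pint_def)
    also have "pint p (\<lambda>x. \<bar>C j * (indicator (cball 0 S) x * \<phi> x)\<bar>) = ennreal (C j powr p) * pint p (\<lambda>x. indicator (cball 0 S) x * \<phi> x)"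
      using pint_cmult[of "\<lambda>x. indicator (cball 0 S) x * \<phi> x" "C j" p] C(1)[of j] by (simp add: pint_def)
    finally show "pint p ?W < \<infinity>"
      using f[of S] fd[of S j] by (auto simp: ennreal_mult_less_top intro: le_less_trans)
  qed (use p_pos in auto)
  have fg': "pint p (\<lambda>x. \<phi>' x * G i k x) < \<infinity>" for i
  proof (rule le_less_trans[OF pint_mono fW[of i]])
    have "\<bar>\<phi>' x * G i k x\<bar> \<le> \<bar>\<phi> x\<bar> * (2 * \<bar>g i x\<bar> + C i * \<bar>u x\<bar>)" for x
      unfolding abs_mult using G_le[of i k x] by (intro mult_mono \<phi>'_le) auto
    then show "AE x in lborel. \<bar>\<phi>' x * G i k x\<bar> \<le> \<bar>\<bar>2 * (\<phi> x * g i x)\<bar> + \<bar>C i * (\<phi> x * u x)\<bar>\<bar>"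
      using C(1)[of i] by (auto simp: abs_mult algebra_simps)
  qed (use p_pos in auto)
  have vb: "\<bar>v k x\<bar> \<le> 2 * real (Suc k)" for x
    using mult_mono[OF cutoff_abs_le[of k x] trunc_bound[of k "u x"]] by (simp add: v_def abs_mult)
  obtain U where U: "U \<in> test_functions" "supp_ball (R + 1) U" "pint p (\<lambda>x. \<phi>' x * (U x - v k x)) \<le> ennreal e1"
     "\<And>i. pint p (\<lambda>x. \<phi>' x * (partial_deriv i U x - G i k x)) \<le> ennreal e1"
    using approx_bounded_compact[OF p w' S' f' fd' wv vb Rv RG fg' e1] by blast
  have eq: "\<phi>' x = \<phi> x" if "norm x \<le> R + 1" for x
    using cutoff_eq_1[of x K] that K by (simp add: \<phi>'_def)
  have e1sum: "ennreal (2 powr p) * (ennreal e1 + ennreal e1) = ennreal e"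
    using e1 by (subst ennreal_plus[symmetric]) (auto simp: ennreal_mult[symmetric] e1_def)
  note [measurable] = borel_measurable_continuous[OF test_functionsD(2)[OF U(1)]]
    borel_measurable_continuous[OF test_functionsD(2)[OF test_functions_partial_deriv[OF U(1)]]]
  have "pint p (\<lambda>x. \<phi> x * (U x - u x)) \<le> ennreal e"
  proof -
    have "\<phi> x * (U x - u x) = \<phi>' x * (U x - v k x) + \<phi> x * (v k x - u x)" for x
      using eq[of x] supp_ballD[OF Rv, of x] supp_ballD[OF U(2), of x] by (cases "norm x \<le> R + 1") (auto simp: algebra_simps)
    then have "pint p (\<lambda>x. \<phi> x * (U x - u x)) \<le> ennreal (2 powr p) * (pint p (\<lambda>x. \<phi>' x * (U x - v k x)) + pint p (\<lambda>x. \<phi> x * (v k x - u x)))"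
      using pint_add[of "\<lambda>x. \<phi>' x * (U x - v k x)" "\<lambda>x. \<phi> x * (v k x - u x)" p] p_pos by simp
    also have "\<dots> \<le> ennreal (2 powr p) * (ennreal e1 + ennreal e1)"
      by (intro mult_left_mono add_mono U(3) k(1)) auto
    finally show ?thesis by (simp add: e1sum)
  qed
  moreover have "pint p (\<lambda>x. \<phi> x * (partial_deriv i U x - g i x)) \<le> ennreal e" for i
  proof -
    have "\<phi> x * (partial_deriv i U x - g i x) = \<phi>' x * (partial_deriv i U x - G i k x) + \<phi> x * (G i k x - g i x)" for x
      using eq[of x] supp_ballD[OF RG, of x i] supp_ballD[OF supp_ball_partial_deriv[OF U(2)], of x i]
      by (cases "norm x \<le> R + 1") (auto simp: algebra_simps)
    then have "pint p (\<lambda>x. \<phi> x * (partial_deriv i U x - g i x)) \<le> ennreal (2 powr p) *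
       (pint p (\<lambda>x. \<phi>' x * (partial_deriv i U x - G i k x)) + pint p (\<lambda>x. \<phi> x * (G i k x - g i x)))"
      using pint_add[of "\<lambda>x. \<phi>' x * (partial_deriv i U x - G i k x)" "\<lambda>x. \<phi> x * (G i k x - g i x)" p] p_pos by simp
    also have "\<dots> \<le> ennreal (2 powr p) * (ennreal e1 + ennreal e1)"
      by (intro mult_left_mono add_mono U(4) k(2)) auto
    finally show ?thesis by (simp add: e1sum)
  qed
  ultimately show ?thesis using U(1) by blast
qed

section \<open>Weights with a logarithmic derivative\<close>

text \<open>Borel functions in \<open>L\<^sup>p\<^sub>l\<^sub>o\<^sub>c\<close> and, for the exponent \<open>q\<close> conjugate to \<open>p\<close> (infinite if \<open>p = 1\<close>), in \<open>L\<^sup>q\<^sub>l\<^sub>o\<^sub>c\<close>.\<close>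

definition Lploc :: "real \<Rightarrow> ('a::euclidean_space \<Rightarrow> real) \<Rightarrow> bool" where
  "Lploc p f \<longleftrightarrow> f \<in> borel_measurable borel \<and> (\<forall>R. pint p (\<lambda>x. indicator (cball 0 R) x * f x) < \<infinity>)"

definition Lqloc :: "real \<Rightarrow> ('a::euclidean_space \<Rightarrow> real) \<Rightarrow> bool" where
  "Lqloc p f \<longleftrightarrow> f \<in> borel_measurable borel \<and>
     (\<forall>R. if p = 1 then \<exists>C. AE x in lborel. norm x \<le> R \<longrightarrow> \<bar>f x\<bar> \<le> C
          else pint (p / (p - 1)) (\<lambda>x. indicator (cball 0 R) x * f x) < \<infinity>)"

lemma pint_finite_Lploc:
  assumes "f \<in> borel_measurable borel" "0 \<le> p" "pint p f < \<infinity>" shows "Lploc p f"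
  unfolding Lploc_def
proof (intro conjI allI assms)
  fix R
  have "pint p (\<lambda>x. indicator (cball 0 R) x * f x) \<le> pint p f"
    by (rule pint_mono) (use assms in \<open>auto simp: indicator_def\<close>)
  then show "pint p (\<lambda>x. indicator (cball 0 R) x * f x) < \<infinity>" using assms(3) by (rule le_less_trans)
qed

lemma Lploc_mult_Lqloc_locint:
  fixes f g :: "'a::euclidean_space \<Rightarrow> real"
  assumes p: "1 \<le> p" and f: "Lploc p f" and g: "Lqloc p g"
  shows "locint (\<lambda>x. f x * g x)"
  unfolding locint_def
proof (intro conjI allI)
  have [measurable]: "f \<in> borel_measurable borel" "g \<in> borel_measurable borel"
    using f g by (auto simp: Lploc_def Lqloc_def)
  show "(\<lambda>x. f x * g x) \<in> borel_measurable borel" by measurable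
  fix R
  let ?I = "\<lambda>x. indicator (cball 0 R) x :: real"
  have fR: "pint p (\<lambda>x. ?I x * f x) < \<infinity>" using f by (simp add: Lploc_def)
  show "integrable lborel (\<lambda>x. ?I x * (f x * g x))"
  proof (cases "p = 1")
    case True
    then obtain C where C: "AE x in lborel. norm x \<le> R \<longrightarrow> \<bar>g x\<bar> \<le> C" using g by (auto simp: Lqloc_def)
    have i: "integrable lborel (\<lambda>x. C * (?I x * f x))"
      using fR True by (intro integrable_mult_right) (simp add: integrable_iff_pint_1)
    show ?thesis
    proof (rule Bochner_Integration.integrable_bound[OF i])
      show "AE x in lborel. norm (?I x * (f x * g x)) \<le> norm (C * (?I x * f x))"
        using C
      proof eventually_elim
        case (elim x)
        then show ?case
          using mult_left_mono[of "\<bar>g x\<bar>" "\<bar>C\<bar>" "\<bar>f x\<bar>"] by (auto simp: indicator_def abs_mult mult.commute)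
      qed
    qed measurable
  next
    case False
    then have p1: "p > 1" using p by simp
    define q where "q = p / (p - 1)"
    have q: "1 < q" "1 / p + 1 / q = 1" using p1 by (auto simp: q_def field_simps)
    have gR: "pint q (\<lambda>x. ?I x * g x) < \<infinity>" using g False by (simp add: Lqloc_def q_def)
    have le: "\<bar>?I x * (f x * g x)\<bar> \<le> \<bar>?I x * f x\<bar> powr p + \<bar>?I x * g x\<bar> powr q" for x
    proof -
      have "\<bar>?I x * (f x * g x)\<bar> = \<bar>?I x * f x\<bar> * \<bar>?I x * g x\<bar>" by (auto simp: indicator_def abs_mult)
      also have "\<dots> \<le> \<bar>?I x * f x\<bar> powr p / p + \<bar>?I x * g x\<bar> powr q / q"
        using p1 q by (intro Youngs_inequality) auto
      also have "\<dots> \<le> \<bar>?I x * f x\<bar> powr p + \<bar>?I x * g x\<bar> powr q"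
        using p1 q by (intro add_mono) (auto simp: divide_le_eq mult_le_cancel_left1 not_less)
      finally show ?thesis .
    qed
    have "pint 1 (\<lambda>x. ?I x * (f x * g x)) \<le> (\<integral>\<^sup>+x. ennreal (\<bar>?I x * f x\<bar> powr p) + ennreal (\<bar>?I x * g x\<bar> powr q) \<partial>lborel)"
      unfolding pint_1 using ennreal_leI[OF le] by (intro nn_integral_mono) (simp add: ennreal_plus)
    also have "\<dots> = pint p (\<lambda>x. ?I x * f x) + pint q (\<lambda>x. ?I x * g x)"
      unfolding pint_def by (rule nn_integral_add) measurable
    also have "\<dots> < \<infinity>" using fR gR by simp
    finally show ?thesis by (subst integrable_iff_pint_1) auto
  qed
qed

lemma Lploc_locint:
  assumes "1 \<le> p" "Lploc p f" shows "locint f"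
proof (rule pint_finite_imp_locint)
  show "f \<in> borel_measurable borel" using assms by (simp add: Lploc_def)
  fix R
  have "(\<integral>\<^sup>+x. indicator (cball 0 R) x * ennreal (\<bar>f x\<bar> powr p) \<partial>lborel) = pint p (\<lambda>x. indicator (cball 0 R) x * f x)"
    unfolding pint_def by (intro nn_integral_cong) (simp add: indicator_def)
  also have "\<dots> < \<infinity>" using assms by (simp add: Lploc_def)
  finally show "(\<integral>\<^sup>+x. indicator (cball 0 R) x * ennreal (\<bar>f x\<bar> powr p) \<partial>lborel) < \<infinity>" .
qed (rule assms(1))

text \<open>Completeness of \<open>L\<^sup>p\<close> in the form needed for dominated convergence: a rapidly Cauchy sequence converges almost
  everywhere below a majorant \<open>S\<close> in \<open>L\<^sup>p\<close>.\<close>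

lemma fast_Cauchy_Lp:
  fixes h :: "nat \<Rightarrow> 'a::euclidean_space \<Rightarrow> real"
  assumes p: "1 \<le> p" and [measurable]: "\<And>n. h n \<in> borel_measurable borel" and h0: "pint p (h 0) < \<infinity>"
    and fast: "\<And>n. pint p (\<lambda>x. h (Suc n) x - h n x) \<le> ennreal ((1 / 4 powr p) ^ n)"
  obtains H S where "H \<in> borel_measurable borel" "S \<in> borel_measurable borel"
    "AE x in lborel. (\<lambda>n. h n x) \<longlonglongrightarrow> H x" "AE x in lborel. \<forall>n. \<bar>h n x\<bar> \<le> S x" "pint p S < \<infinity>"
proof -
  have p_pos: "0 < p" using p by simp
  define d where "d n x = h (Suc n) x - h n x" for n x
  have [measurable]: "d n \<in> borel_measurable borel" for n unfolding d_def by measurable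
  \<comment> \<open>If \<open>E x\<close> is finite, then \<open>|d n x| \<le> E(x)\<^sup>1\<^sup>/\<^sup>p 2\<^sup>-\<^sup>n\<close>, so the increments are summable; and \<open>E\<close> is integrable.\<close>
  define E where "E x = (\<Sum>n. ennreal (\<bar>2 ^ n * d n x\<bar> powr p))" for x
  have [measurable]: "E \<in> borel_measurable borel" unfolding E_def by measurable
  have "(\<integral>\<^sup>+x. E x \<partial>lborel) = (\<Sum>n. pint p (\<lambda>x. 2 ^ n * d n x))"
    unfolding E_def pint_def by (rule nn_integral_suminf) measurable
  also have "\<dots> \<le> (\<Sum>n. ennreal ((1 / 2 powr p) ^ n))"
  proof (intro suminf_le allI)
    fix n
    have "pint p (\<lambda>x. 2 ^ n * d n x) = ennreal ((2 ^ n) powr p) * pint p (d n)" by (intro pint_cmult) auto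
    also have "\<dots> \<le> ennreal ((2 ^ n) powr p) * ennreal ((1 / 4 powr p) ^ n)"
      using fast[of n] by (intro mult_left_mono) (auto simp: d_def[abs_def])
    also have "\<dots> = ennreal ((1 / 2 powr p) ^ n)"
    proof -
      have "(2 ^ n) powr p = (2 powr p) ^ n" by (simp add: powr_powr mult.commute flip: powr_realpow)
      moreover have "2 powr p * (1 / 4 powr p) = 1 / 2 powr p"
      proof -
        have "4 powr p = 2 powr p * 2 powr p" by (simp add: powr_mult[symmetric])
        then show ?thesis by simp
      qed
      ultimately show ?thesis by (simp add: ennreal_mult[symmetric] power_mult_distrib[symmetric])
    qed
    finally show "pint p (\<lambda>x. 2 ^ n * d n x) \<le> ennreal ((1 / 2 powr p) ^ n)" .
  qed auto
  also have "\<dots> = ennreal (\<Sum>n. (1 / 2 powr p) ^ n)"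
    using p_pos by (intro suminf_ennreal2) (auto intro!: summable_geometric)
  finally have Eint: "(\<integral>\<^sup>+x. E x \<partial>lborel) < \<infinity>" by (rule le_less_trans) simp
  then have Efin: "AE x in lborel. E x \<noteq> \<infinity>" by (intro nn_integral_noteq_infinite) auto
  define a where "a x = enn2real (E x)" for x
  have [measurable]: "a \<in> borel_measurable borel" unfolding a_def by measurable
  define S where "S x = \<bar>h 0 x\<bar> + 2 * a x powr (1 / p)" for x
  have key: "AE x in lborel. (\<forall>n. \<bar>d n x\<bar> \<le> a x powr (1 / p) * (1 / 2) ^ n)"
    using Efin
  proof eventually_elim
    case (elim x)
    show ?case
    proof
      fix n
      have "(\<Sum>n\<in>{n}. ennreal (\<bar>2 ^ n * d n x\<bar> powr p)) \<le> E x"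
        unfolding E_def by (rule sum_le_suminf[OF summableI]) simp_all
      then have "ennreal (\<bar>2 ^ n * d n x\<bar> powr p) \<le> E x" by (simp only: sum.insert_remove sum.empty finite.emptyI empty_Diff add_0_right)
      also have "E x = ennreal (a x)" using elim by (simp add: a_def less_top)
      finally have "\<bar>2 ^ n * d n x\<bar> powr p \<le> a x" by (simp add: a_def)
      then have "(\<bar>2 ^ n * d n x\<bar> powr p) powr (1 / p) \<le> a x powr (1 / p)"
        using p_pos by (intro powr_mono2) auto
      then have "2 ^ n * \<bar>d n x\<bar> \<le> a x powr (1 / p)" using p_pos by (simp add: powr_powr abs_mult)
      then show "\<bar>d n x\<bar> \<le> a x powr (1 / p) * (1 / 2) ^ n" by (simp add: field_simps)
    qed
  qed
  have tel: "h n x = h 0 x + (\<Sum>k<n. d k x)" for n x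
    by (induction n) (auto simp: d_def)
  define H where "H x = lim (\<lambda>n. h n x)" for x
  show ?thesis
  proof (rule that)
    show "H \<in> borel_measurable borel" unfolding H_def by (rule borel_measurable_lim_metric) simp
    show "S \<in> borel_measurable borel" unfolding S_def by measurable
    show "AE x in lborel. (\<lambda>n. h n x) \<longlonglongrightarrow> H x"
      using key
    proof eventually_elim
      case (elim x)
      have "summable (\<lambda>n. d n x)"
        by (rule summable_comparison_test'[of "\<lambda>n. a x powr (1 / p) * (1 / 2) ^ n" 0])
          (use elim in \<open>auto intro!: summable_mult summable_geometric\<close>)
      then have "convergent (\<lambda>n. \<Sum>k<n. d k x)" by (simp add: summable_iff_convergent)
      then have "convergent (\<lambda>n. h 0 x + (\<Sum>k<n. d k x))" by (intro convergent_add convergent_const)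
      also have "(\<lambda>n. h 0 x + (\<Sum>k<n. d k x)) = (\<lambda>n. h n x)" by (rule ext, rule tel[symmetric])
      finally have "convergent (\<lambda>n. h n x)" .
      then show ?case unfolding H_def by (simp add: convergent_LIMSEQ_iff)
    qed
    show "AE x in lborel. \<forall>n. \<bar>h n x\<bar> \<le> S x"
      using key
    proof eventually_elim
      case (elim x)
      have "\<bar>h n x\<bar> \<le> S x" for n
      proof -
        have "\<bar>\<Sum>k<n. d k x\<bar> \<le> (\<Sum>k<n. a x powr (1 / p) * (1 / 2) ^ k)"
          using elim by (intro order_trans[OF sum_abs] sum_mono) auto
        also have "\<dots> = a x powr (1 / p) * (\<Sum>k<n. (1 / 2) ^ k)" by (simp add: sum_distrib_left)
        also have "\<dots> \<le> a x powr (1 / p) * 2"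
          by (intro mult_left_mono) (auto simp: sum_gp_strict)
        finally show ?thesis
          using tel[of n x] abs_triangle_ineq[of "h 0 x" "\<Sum>k<n. d k x"] by (simp add: S_def)
      qed
      then show ?case by blast
    qed
    have "pint p (\<lambda>x. \<bar>h 0 x\<bar> + 2 * a x powr (1 / p)) \<le>
       ennreal (2 powr p) * (pint p (\<lambda>x. \<bar>h 0 x\<bar>) + pint p (\<lambda>x. 2 * a x powr (1 / p)))"
      by (rule pint_add) (use p_pos in auto)
    also have "pint p (\<lambda>x. \<bar>h 0 x\<bar>) = pint p (h 0)" by (simp add: pint_def)
    also have "pint p (\<lambda>x. 2 * a x powr (1 / p)) = ennreal (2 powr p) * pint p (\<lambda>x. a x powr (1 / p))"
      by (intro pint_cmult) auto
    also have "pint p (\<lambda>x. a x powr (1 / p)) = (\<integral>\<^sup>+x. ennreal (a x) \<partial>lborel)"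
      unfolding pint_def using p_pos by (intro nn_integral_cong) (simp add: powr_powr a_def)
    also have "(\<integral>\<^sup>+x. ennreal (a x) \<partial>lborel) = (\<integral>\<^sup>+x. E x \<partial>lborel)"
      using Efin by (intro nn_integral_cong_AE) (auto simp: a_def less_top)
    finally show "pint p S < \<infinity>"
      using h0 Eint by (auto simp: S_def[abs_def] ennreal_mult_less_top intro: le_less_trans)
  qed
qed

text \<open>The root \<open>\<phi> = w\<^sup>1\<^sup>/\<^sup>p\<close> of a weight satisfying the conditions (Reg) and (Diff), given by Borel functions, with \<open>\<phi>\<close> positive
  everywhere; \<open>d\<phi>\<close> is the weak gradient of \<open>\<phi>\<close>. The condition that \<open>\<beta>\<close> is in \<open>L\<^sup>q\<^sub>l\<^sub>o\<^sub>c(\<mu>)\<close> is stated for \<open>\<beta> \<phi>\<^sup>p\<^sup>-\<^sup>1\<close> and Lebesgue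
  measure, which is equivalent since \<open>q (p - 1) = p\<close> if \<open>p > 1\<close>, and since the power is one if \<open>p = 1\<close>.\<close>

locale borel_weight =
  fixes p :: real and \<phi> :: "real ^ 'n::finite \<Rightarrow> real" and d\<phi> \<beta> :: "'n \<Rightarrow> real ^ 'n \<Rightarrow> real"
  assumes p: "1 \<le> p"
    and \<phi>_pos: "\<And>x. 0 < \<phi> x"
    and w\<phi>: "\<And>j. weakd j \<phi> (d\<phi> j)"
    and \<phi>_Lp: "Lploc p \<phi>" and d\<phi>_Lp: "\<And>j. Lploc p (d\<phi> j)"
    and \<phi>_Lq: "Lqloc p (\<lambda>x. 1 / \<phi> x)"
    and \<beta>_eq: "\<And>j x. \<beta> j x = p * d\<phi> j x / \<phi> x"
    and \<beta>_Lq: "\<And>j. Lqloc p (\<lambda>x. \<beta> j x * \<phi> x powr (p - 1))"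
begin

text \<open>The weight itself.\<close>

definition W :: "real ^ 'n \<Rightarrow> real" where "W x = \<phi> x powr p"

lemma p_pos: "0 < p" "0 \<le> p" using p by auto

lemma \<phi>_measurable [measurable]: "\<phi> \<in> borel_measurable borel" "d\<phi> j \<in> borel_measurable borel" "\<beta> j \<in> borel_measurable borel"
proof -
  show 1[measurable]: "\<phi> \<in> borel_measurable borel" "d\<phi> j \<in> borel_measurable borel" using weakd_measurable[OF w\<phi>] by auto
  show "\<beta> j \<in> borel_measurable borel" unfolding \<beta>_eq[abs_def] by measurable
qed

lemma W_measurable [measurable]: "W \<in> borel_measurable borel" unfolding W_def[abs_def] by measurable

lemma W_pos: "0 < W x" using \<phi>_pos[of x] by (simp add: W_def)

lemma W_eq: "W x = \<phi> x * \<phi> x powr (p - 1)"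
  using powr_mult_base[of "\<phi> x" "p - 1"] \<phi>_pos[of x] by (simp add: W_def)

lemma \<phi>_powr_Lq: "Lqloc p (\<lambda>x. \<phi> x powr (p - 1))"
proof (cases "p = 1")
  case True
  then show ?thesis using \<phi>_pos by (auto simp: Lqloc_def less_imp_neq[symmetric] intro!: exI[of _ 1])
next
  case False
  have "pint (p / (p - 1)) (\<lambda>x. indicator (cball 0 R) x * \<phi> x powr (p - 1)) = pint p (\<lambda>x. indicator (cball 0 R) x * \<phi> x)" for R
    unfolding pint_def
  proof (rule nn_integral_cong)
    fix x
    have "(\<phi> x powr (p - 1)) powr (p / (p - 1)) = \<phi> x powr p" using False by (simp add: powr_powr)
    then show "ennreal (\<bar>indicator (cball 0 R) x * \<phi> x powr (p - 1)\<bar> powr (p / (p - 1))) = ennreal (\<bar>indicator (cball 0 R) x * \<phi> x\<bar> powr p)"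
      using \<phi>_pos[of x] by (auto simp: indicator_def)
  qed
  then show ?thesis using False \<phi>_Lp by (simp add: Lqloc_def Lploc_def)
qed

lemma locint_W: "locint W"
  using Lploc_mult_Lqloc_locint[OF p \<phi>_Lp \<phi>_powr_Lq] by (simp add: W_eq[abs_def])

lemma \<beta>W_eq': "\<beta> j x * W x = p * \<phi> x powr (p - 1) * d\<phi> j x"
  using \<phi>_pos[of x] by (simp add: W_eq \<beta>_eq)

lemma locint_\<beta>: "locint (\<beta> j)"
proof -
  have "locint (\<lambda>x. p * (d\<phi> j x * (1 / \<phi> x)))" by (intro locint_cmult Lploc_mult_Lqloc_locint[OF p d\<phi>_Lp \<phi>_Lq])
  then show ?thesis by (simp add: \<beta>_eq[abs_def])
qed

text \<open>Consequences of Young's inequality for \<open>f\<close> in \<open>L\<^sup>p(\<mu>)\<close>.\<close>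

lemma Lp_locint:
  assumes [measurable]: "f \<in> borel_measurable borel" and f: "pint p (\<lambda>x. \<phi> x * f x) < \<infinity>"
  shows "locint f" "locint (\<lambda>x. f x * W x)" "locint (\<lambda>x. f x * \<beta> j x * W x)"
proof -
  have L: "Lploc p (\<lambda>x. \<phi> x * f x)" by (rule pint_finite_Lploc[OF _ _ f]) (use p_pos in auto)
  have "(\<lambda>x. \<phi> x * f x * (1 / \<phi> x)) = f" using \<phi>_pos by (auto simp: fun_eq_iff less_imp_neq[symmetric])
  then show "locint f" using Lploc_mult_Lqloc_locint[OF p L \<phi>_Lq] by simp
  show "locint (\<lambda>x. f x * W x)" using Lploc_mult_Lqloc_locint[OF p L \<phi>_powr_Lq] by (simp add: W_eq mult_ac)
  show "locint (\<lambda>x. f x * \<beta> j x * W x)" using Lploc_mult_Lqloc_locint[OF p L \<beta>_Lq] by (simp add: W_eq mult_ac)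
qed

text \<open>The weight is weakly differentiable with logarithmic derivative \<open>\<beta>\<close>. The function \<open>b \<mapsto> |b|\<^sup>p\<close> is regularised to
  \<open>(b\<^sup>2 + \<epsilon>\<^sup>2)\<^sup>p\<^sup>/\<^sup>2\<close>, which is smooth for every \<open>p \<ge> 1\<close>, and truncated to make its derivative bounded.\<close>

lemma weakd_W: "weakd j W (\<lambda>x. \<beta> j x * W x)"
proof -
  define \<epsilon> where "\<epsilon> m = inverse (real (Suc m))" for m
  have \<epsilon>: "0 < \<epsilon> m" "\<epsilon> m \<le> 1" for m by (auto simp: \<epsilon>_def field_simps)
  define P where "P m b = (b\<^sup>2 + (\<epsilon> m)\<^sup>2) powr (p / 2)" for m b
  define P' where "P' m b = p * b * (b\<^sup>2 + (\<epsilon> m)\<^sup>2) powr (p / 2 - 1)" for m b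
  have pos: "0 < b\<^sup>2 + (\<epsilon> m)\<^sup>2" for b m using \<epsilon>(1)[of m] by (intro add_nonneg_pos) auto
  have dP: "(P m has_real_derivative P' m b) (at b)" for m b
    unfolding P_def[abs_def] P'_def using pos[of b m] by (auto intro!: derivative_eq_intros simp: powr_diff field_simps)
  have cP: "continuous_on UNIV (P m)" "continuous_on UNIV (P' m)" for m
    unfolding P_def[abs_def] P'_def[abs_def] using pos[of _ m] by (auto intro!: continuous_intros simp: less_imp_neq[symmetric])
  note [measurable] = cP[THEN borel_measurable_continuous_onI]
  have r: "P m b = sqrt (b\<^sup>2 + (\<epsilon> m)\<^sup>2) powr p" for m b
    using pos[of b m] by (simp add: P_def powr_half_sqrt[symmetric] powr_powr)
  have rb: "sqrt (b\<^sup>2 + (\<epsilon> m)\<^sup>2) \<le> \<bar>b\<bar> + 1" for m b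
    using sqrt_sum_squares_le_sum_abs[of b "\<epsilon> m"] \<epsilon>[of m] by simp
  have P'_le: "\<bar>P' m b\<bar> \<le> p * sqrt (b\<^sup>2 + (\<epsilon> m)\<^sup>2) powr (p - 1)" for m b
  proof -
    let ?r = "sqrt (b\<^sup>2 + (\<epsilon> m)\<^sup>2)"
    have "?r > 0" using pos by simp
    have e: "(b\<^sup>2 + (\<epsilon> m)\<^sup>2) powr (p / 2 - 1) = ?r powr (p - 2)"
      using pos[of b m] by (simp add: powr_half_sqrt[symmetric] powr_powr diff_divide_distrib)
    have "\<bar>b\<bar> \<le> ?r" by (rule real_le_rsqrt) simp
    then have "\<bar>P' m b\<bar> \<le> p * ?r * ?r powr (p - 2)"
      unfolding P'_def e abs_mult using p_pos by (intro mult_mono) auto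
    also have "p * ?r * ?r powr (p - 2) = p * ?r powr (p - 1)"
      using powr_mult_base[of ?r "p - 2"] \<open>?r > 0\<close> by (simp add: mult.assoc)
    finally show ?thesis .
  qed
  have P_dom: "\<bar>P m b\<bar> \<le> 2 powr p * (\<bar>b\<bar> powr p + 1)" for m b
    unfolding r using powr_mono2[OF p_pos(2) _ rb, of b m] powr_add_le[of "\<bar>b\<bar>" 1 p] p_pos by simp
  have P'_dom: "\<bar>P' m b\<bar> \<le> p * (2 powr (p - 1) * (\<bar>b\<bar> powr (p - 1) + 1))" for m b
  proof (rule order_trans[OF P'_le mult_left_mono])
    show "sqrt (b\<^sup>2 + (\<epsilon> m)\<^sup>2) powr (p - 1) \<le> 2 powr (p - 1) * (\<bar>b\<bar> powr (p - 1) + 1)"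
      using powr_mono2[of "p - 1", OF _ _ rb, of b m] powr_add_le[of "\<bar>b\<bar>" 1 "p - 1"] p by simp
  qed (use p_pos in simp)
  have A: "locint (\<lambda>x. 2 powr p * (\<bar>\<phi> x\<bar> powr p + 1))"
    using locint_cmult[OF locint_add[OF locint_W locint_continuous[OF continuous_on_const[of _ 1]]], of "2 powr p"] \<phi>_pos
    by (simp add: W_def abs_of_pos)
  have B: "locint (\<lambda>x. p * (2 powr (p - 1) * (\<bar>\<phi> x\<bar> powr (p - 1) + 1)) * d\<phi> j x)"
  proof -
    have "locint (\<lambda>x. d\<phi> j x * \<phi> x powr (p - 1) + d\<phi> j x)"
      by (intro locint_add Lploc_mult_Lqloc_locint[OF p d\<phi>_Lp \<phi>_powr_Lq] Lploc_locint[OF p d\<phi>_Lp])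
    from locint_cmult[OF this, of "p * 2 powr (p - 1)"] show ?thesis
      using \<phi>_pos by (simp add: abs_of_pos algebra_simps)
  qed
  have 1: "weakd j (\<lambda>x. P m (\<phi> x)) (\<lambda>x. P' m (\<phi> x) * d\<phi> j x)" for m
  proof (rule weakd_limit_dominated[where U = "\<lambda>k x. trunc k (P m (\<phi> x))" and G = "\<lambda>k x. trunc' k (P m (\<phi> x)) * P' m (\<phi> x) * d\<phi> j x", OF _ _ _ A B])
    show "weakd j (\<lambda>x. trunc k (P m (\<phi> x))) (\<lambda>x. trunc' k (P m (\<phi> x)) * P' m (\<phi> x) * d\<phi> j x)" for k
    proof -
      have b: "\<bar>trunc' k (P m b) * P' m b\<bar> \<le> p * (1 + real (Suc k))" for b
      proof -
        let ?r = "sqrt (b\<^sup>2 + (\<epsilon> m)\<^sup>2)"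
        have r1: "?r powr (p - 1) \<le> 1 + ?r powr p"
        proof (cases "?r \<le> 1")
          case True
          then have "?r powr (p - 1) \<le> 1 powr (p - 1)" using p by (intro powr_mono2) auto
          then show ?thesis by (simp add: add_increasing2)
        next
          case False
          then have "?r powr (p - 1) \<le> ?r powr p" by (intro powr_mono) auto
          then show ?thesis by simp
        qed
        have "\<bar>trunc' k (P m b) * P' m b\<bar> \<le> trunc' k (P m b) * (p * (1 + P m b))"
          unfolding abs_mult using trunc'_pos[of k "P m b"] p_pos r1
          by (auto intro!: mult_left_mono order_trans[OF P'_le] simp: r)
        also have "\<dots> = p * (trunc' k (P m b) + trunc' k (P m b) * P m b)" by (simp add: algebra_simps)
        also have "\<dots> \<le> p * (1 + real (Suc k))"
          using trunc'_le[of k "P m b"] trunc'_mult_le[of k "P m b"] p_pos by (intro mult_left_mono add_mono) auto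
        finally show ?thesis .
      qed
      have "weakd j (\<lambda>x. (\<lambda>z. trunc k (P m (fst z))) (\<phi> x, \<phi> x))
         (\<lambda>x. (\<lambda>z. trunc' k (P m (fst z)) * P' m (fst z)) (\<phi> x, \<phi> x) * d\<phi> j x + (\<lambda>_. 0) (\<phi> x, \<phi> x) * d\<phi> j x)"
      proof (rule weakd_chain_rule[OF _ _ _ _ _ w\<phi> w\<phi>, where C = "p * (1 + real (Suc k))"])
        fix z :: "real \<times> real"
        have "((\<lambda>z. P m (fst z)) has_derivative (\<lambda>h. P' m (fst z) * fst h)) (at z)"
          by (rule has_derivative_compose[OF has_derivative_fst[OF has_derivative_ident] dP[unfolded has_field_derivative_def]])
        from has_derivative_trunc[OF this, of k]
        show "((\<lambda>z. trunc k (P m (fst z))) has_derivative (\<lambda>h. trunc' k (P m (fst z)) * P' m (fst z) * fst h + 0 * snd h)) (at z)"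
          by (simp add: mult.assoc)
        show "\<bar>trunc' k (P m (fst z)) * P' m (fst z)\<bar> \<le> p * (1 + real (Suc k))" by (rule b)
      qed (use p_pos in \<open>auto intro!: continuous_intros continuous_trunc_compose continuous_on_compose2[OF cP(1)] continuous_on_compose2[OF cP(2)]\<close>)
      then show ?thesis by simp
    qed
    show "AE x in lborel. \<bar>trunc k (P m (\<phi> x))\<bar> \<le> \<bar>2 powr p * (\<bar>\<phi> x\<bar> powr p + 1)\<bar>" for k
      by (intro AE_I2 order_trans[OF trunc_le] order_trans[OF P_dom]) simp
    show "AE x in lborel. \<bar>trunc' k (P m (\<phi> x)) * P' m (\<phi> x) * d\<phi> j x\<bar> \<le> \<bar>p * (2 powr (p - 1) * (\<bar>\<phi> x\<bar> powr (p - 1) + 1)) * d\<phi> j x\<bar>" for k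
    proof (rule AE_I2)
      fix x
      have "\<bar>trunc' k (P m (\<phi> x))\<bar> * \<bar>P' m (\<phi> x)\<bar> \<le> 1 * \<bar>p * (2 powr (p - 1) * (\<bar>\<phi> x\<bar> powr (p - 1) + 1))\<bar>"
        using trunc'_pos[of k "P m (\<phi> x)"] trunc'_le[of k "P m (\<phi> x)"]
        by (intro mult_mono order_trans[OF P'_dom abs_ge_self]) auto
      then show "\<bar>trunc' k (P m (\<phi> x)) * P' m (\<phi> x) * d\<phi> j x\<bar> \<le> \<bar>p * (2 powr (p - 1) * (\<bar>\<phi> x\<bar> powr (p - 1) + 1)) * d\<phi> j x\<bar>"
        unfolding abs_mult[of _ "d\<phi> j x"] by (intro mult_right_mono) (simp_all only: abs_mult mult_1 abs_ge_zero)
    qed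
    have "(\<lambda>k. trunc' k (P m (\<phi> x)) * P' m (\<phi> x) * d\<phi> j x) \<longlonglongrightarrow> 1 * P' m (\<phi> x) * d\<phi> j x" for x
      by (intro tendsto_intros trunc'_tendsto)
    then show "AE x in lborel. (\<lambda>k. trunc' k (P m (\<phi> x)) * P' m (\<phi> x) * d\<phi> j x) \<longlonglongrightarrow> P' m (\<phi> x) * d\<phi> j x" by simp
  qed (use trunc_tendsto in auto)
  show ?thesis
  proof (rule weakd_limit_dominated[where U = "\<lambda>m x. P m (\<phi> x)" and G = "\<lambda>m x. P' m (\<phi> x) * d\<phi> j x", OF 1 _ _ A B])
    have b: "(\<lambda>m. (\<phi> x)\<^sup>2 + (\<epsilon> m)\<^sup>2) \<longlonglongrightarrow> (\<phi> x)\<^sup>2" for x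
    proof -
      have "(\<lambda>m. (\<phi> x)\<^sup>2 + (\<epsilon> m)\<^sup>2) \<longlonglongrightarrow> (\<phi> x)\<^sup>2 + 0\<^sup>2"
        unfolding \<epsilon>_def by (intro tendsto_intros LIMSEQ_inverse_real_of_nat)
      then show ?thesis by simp
    qed
    have sq: "((\<phi> x)\<^sup>2) powr s = \<phi> x powr (2 * s)" for x s
      using \<phi>_pos[of x] by (simp add: powr_powr flip: powr_numeral)
    have nz: "(\<phi> x)\<^sup>2 \<noteq> 0" for x using \<phi>_pos[of x] by simp
    have "(\<lambda>m. P m (\<phi> x)) \<longlonglongrightarrow> ((\<phi> x)\<^sup>2) powr (p / 2)" for x
      unfolding P_def by (rule tendsto_powr[OF b tendsto_const nz])
    then show "AE x in lborel. (\<lambda>m. P m (\<phi> x)) \<longlonglongrightarrow> W x" by (simp add: W_def sq)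
    have "(\<lambda>m. P' m (\<phi> x) * d\<phi> j x) \<longlonglongrightarrow> p * \<phi> x * ((\<phi> x)\<^sup>2) powr (p / 2 - 1) * d\<phi> j x" for x
      unfolding P'_def by (intro tendsto_mult tendsto_const tendsto_powr[OF b tendsto_const nz])
    moreover have "p * \<phi> x * ((\<phi> x)\<^sup>2) powr (p / 2 - 1) * d\<phi> j x = \<beta> j x * W x" for x
      using powr_mult_base[of "\<phi> x" "p - 2"] \<phi>_pos[of x] by (simp add: \<beta>W_eq' sq algebra_simps)
    ultimately show "AE x in lborel. (\<lambda>m. P' m (\<phi> x) * d\<phi> j x) \<longlonglongrightarrow> \<beta> j x * W x" by simp
    show "AE x in lborel. \<bar>P m (\<phi> x)\<bar> \<le> \<bar>2 powr p * (\<bar>\<phi> x\<bar> powr p + 1)\<bar>" for m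
      by (intro AE_I2 order_trans[OF P_dom]) simp
    show "AE x in lborel. \<bar>P' m (\<phi> x) * d\<phi> j x\<bar> \<le> \<bar>p * (2 powr (p - 1) * (\<bar>\<phi> x\<bar> powr (p - 1) + 1)) * d\<phi> j x\<bar>" for m
      unfolding abs_mult[of _ "d\<phi> j _"] by (intro AE_I2 mult_right_mono order_trans[OF P'_dom abs_ge_self]) auto
  qed auto
qed

text \<open>A function with a weak gradient in the weighted space satisfies the identity that defines V.\<close>

lemma weakd_imp_weighted:
  assumes f: "pint p (\<lambda>x. \<phi> x * f x) < \<infinity>" and G: "pint p (\<lambda>x. \<phi> x * G x) < \<infinity>" and w: "weakd i f G"
  shows "weakd i (\<lambda>x. f x * W x) (\<lambda>x. (G x + f x * \<beta> i x) * W x)"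
proof -
  note fm = weakd_measurable[OF w]
  have "weakd i (\<lambda>x. f x * W x) (\<lambda>x. G x * W x + f x * (\<beta> i x * W x))"
    by (rule weakd_mult[OF w weakd_W Lp_locint(2)[OF fm(1) f] Lp_locint(2)[OF fm(2) G]])
      (use Lp_locint(3)[OF fm(1) f, of i] in \<open>simp add: mult.assoc\<close>)
  then show ?thesis by (simp add: algebra_simps)
qed

text \<open>Conversely, the identity that defines V determines the weak derivative with respect to Lebesgue measure.\<close>

lemma weighted_imp_weakd:
  assumes [measurable]: "f \<in> borel_measurable borel" "G \<in> borel_measurable borel"
    and f: "pint p (\<lambda>x. \<phi> x * f x) < \<infinity>" and G: "pint p (\<lambda>x. \<phi> x * G x) < \<infinity>"
    and w: "weakd i (\<lambda>x. f x * W x) (\<lambda>x. (G x + f x * \<beta> i x) * W x)"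
  shows "weakd i f G"
proof -
  note lf = Lp_locint(1)[OF assms(1) f] and lG = Lp_locint(1)[OF assms(2) G]
  define \<epsilon> where "\<epsilon> m = inverse (real (Suc m))" for m
  have \<epsilon>: "0 < \<epsilon> m" for m by (auto simp: \<epsilon>_def)
  define r where "r m b = sqrt (b\<^sup>2 + (\<epsilon> m)\<^sup>2)" for m b
  have r0: "0 < r m b" and r2: "(r m b)\<^sup>2 = b\<^sup>2 + (\<epsilon> m)\<^sup>2" and rb: "\<bar>b\<bar> \<le> r m b" and r\<epsilon>: "\<epsilon> m \<le> r m b" for m b
  proof -
    have "0 < b\<^sup>2 + (\<epsilon> m)\<^sup>2" using \<epsilon>[of m] by (intro add_nonneg_pos) auto
    then show "0 < r m b" "(r m b)\<^sup>2 = b\<^sup>2 + (\<epsilon> m)\<^sup>2" by (auto simp: r_def)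
    show "\<bar>b\<bar> \<le> r m b" "\<epsilon> m \<le> r m b" unfolding r_def by (rule real_le_rsqrt, simp)+
  qed
  have dr: "(r m has_real_derivative b / r m b) (at b)" for m b
  proof -
    have "0 < b\<^sup>2 + (\<epsilon> m)\<^sup>2" using r2[of m b] r0[of m b] by (metis zero_less_power)
    then show ?thesis unfolding r_def[abs_def] by (auto intro!: derivative_eq_intros simp: field_simps)
  qed
  have cr: "continuous_on UNIV (r m)" for m unfolding r_def[abs_def] by (intro continuous_intros)
  note [measurable] = borel_measurable_continuous_onI[OF cr]
  \<comment> \<open>This function tends to \<open>f\<close>, and it is a smooth function of \<open>f W\<close> and \<open>W\<close>.\<close>
  define s where "s m x = f x * W x / r m (W x)" for m x
  have [measurable]: "s m \<in> borel_measurable borel" for m unfolding s_def by measurable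
  have chain: "weakd i (\<lambda>x. trunc k (s m x)) (\<lambda>x. trunc' k (s m x) * (G x * (W x / r m (W x))) +
      trunc' k (s m x) * s m x * ((\<epsilon> m / r m (W x))\<^sup>2 * \<beta> i x))" for k m
  proof -
    let ?F = "\<lambda>z. trunc k (fst z / r m (snd z))"
    let ?Fa = "\<lambda>z. trunc' k (fst z / r m (snd z)) / r m (snd z)"
    let ?Fb = "\<lambda>z. - (trunc' k (fst z / r m (snd z)) * (fst z / r m (snd z)) * (snd z / (r m (snd z))\<^sup>2))"
    have "weakd i (\<lambda>x. ?F (f x * W x, W x)) (\<lambda>x. ?Fa (f x * W x, W x) * ((G x + f x * \<beta> i x) * W x) + ?Fb (f x * W x, W x) * (\<beta> i x * W x))"
    proof (rule weakd_chain_rule[OF _ _ _ _ _ w weakd_W, where C = "real (Suc (Suc k)) / \<epsilon> m"])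
      fix z :: "real \<times> real"
      note n0 = r0[of m "snd z", THEN less_imp_neq, symmetric]
      have "((\<lambda>z. r m (snd z)) has_derivative (\<lambda>h. snd z / r m (snd z) * snd h)) (at z)"
        by (rule has_derivative_compose[OF has_derivative_snd[OF has_derivative_ident] dr[unfolded has_field_derivative_def]])
      then have "((\<lambda>z. fst z / r m (snd z)) has_derivative
         (\<lambda>h. (fst h * r m (snd z) - fst z * (snd z / r m (snd z) * snd h)) / (r m (snd z) * r m (snd z)))) (at z)"
        using n0 by (intro has_derivative_divide' has_derivative_fst has_derivative_ident) auto
      from has_derivative_trunc[OF this, of k]
      show "(?F has_derivative (\<lambda>h. ?Fa z * fst h + ?Fb z * snd h)) (at z)"
        by (rule has_derivative_eq_rhs) (use n0 in \<open>auto simp: fun_eq_iff field_simps power2_eq_square\<close>)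
      have i\<epsilon>: "1 / r m (snd z) \<le> 1 / \<epsilon> m" using r\<epsilon>[of m "snd z"] \<epsilon>[of m] by (intro divide_left_mono) (auto intro: mult_pos_pos r0)
      have "\<bar>?Fa z\<bar> = trunc' k (fst z / r m (snd z)) * (1 / r m (snd z))"
        using trunc'_pos[of k "fst z / r m (snd z)"] r0[of m "snd z"] by simp
      also have "\<dots> \<le> real (Suc (Suc k)) * (1 / \<epsilon> m)"
        using trunc'_pos[of k "fst z / r m (snd z)"] trunc'_le[of k "fst z / r m (snd z)"] i\<epsilon> r0[of m "snd z"]
        by (intro mult_mono) auto
      finally show "\<bar>?Fa z\<bar> \<le> real (Suc (Suc k)) / \<epsilon> m" by simp
      have "\<bar>snd z / (r m (snd z))\<^sup>2\<bar> \<le> 1 / \<epsilon> m"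
      proof -
        have "\<bar>snd z / (r m (snd z))\<^sup>2\<bar> = (\<bar>snd z\<bar> / r m (snd z)) * (1 / r m (snd z))"
          using r0[of m "snd z"] by (simp add: power2_eq_square)
        also have "\<dots> \<le> 1 * (1 / \<epsilon> m)"
          using rb[of "snd z" m] r0[of m "snd z"] i\<epsilon> by (intro mult_mono) auto
        finally show ?thesis by simp
      qed
      then have "\<bar>trunc' k (fst z / r m (snd z)) * (fst z / r m (snd z))\<bar> * \<bar>snd z / (r m (snd z))\<^sup>2\<bar> \<le> real (Suc (Suc k)) * (1 / \<epsilon> m)"
        using trunc'_mult_le[of k "fst z / r m (snd z)"] by (intro mult_mono) auto
      then show "\<bar>?Fb z\<bar> \<le> real (Suc (Suc k)) / \<epsilon> m" by (simp add: abs_mult)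
    next
      have crs: "continuous_on UNIV (\<lambda>z::real \<times> real. r m (snd z))"
        by (rule continuous_on_compose2[OF cr]) (auto intro!: continuous_intros)
      show "continuous_on UNIV ?Fa" "continuous_on UNIV ?Fb"
        using r0[of m, THEN less_imp_neq, symmetric] by (auto intro!: continuous_intros crs continuous_trunc_compose)
    qed
    moreover have "?Fa (f x * W x, W x) * ((G x + f x * \<beta> i x) * W x) + ?Fb (f x * W x, W x) * (\<beta> i x * W x) =
       trunc' k (s m x) * (G x * (W x / r m (W x))) + trunc' k (s m x) * s m x * ((\<epsilon> m / r m (W x))\<^sup>2 * \<beta> i x)" for x
    proof -
      have "(\<epsilon> m)\<^sup>2 = (r m (W x))\<^sup>2 - (W x)\<^sup>2" using r2[of m "W x"] by simp
      then have "(\<epsilon> m / r m (W x))\<^sup>2 = 1 - (W x)\<^sup>2 / (r m (W x))\<^sup>2"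
        using r0[of m "W x"] by (simp add: power_divide diff_divide_distrib)
      \<comment> \<open>The terms containing \<open>\<beta>\<close> cancel up to the factor \<open>\<epsilon>\<^sup>2 / r\<^sup>2\<close>.\<close>
      moreover have "T / c * ((g + y * b) * a) + - (T * (y * a / c) * (a / c\<^sup>2)) * (b * a) =
         T * (g * (a / c)) + T * (y * a / c) * ((1 - a\<^sup>2 / c\<^sup>2) * b)" if "c \<noteq> 0" for T c g y b a :: real
        using that by (simp add: field_simps power2_eq_square)
      ultimately show ?thesis using r0[of m "W x"] by (simp add: s_def)
    qed
    ultimately show ?thesis by (simp add: s_def)
  qed
  have s_le: "\<bar>s m x\<bar> \<le> \<bar>f x\<bar>" for m x
  proof -
    have "W x / r m (W x) \<le> 1" using rb[of "W x" m] r0[of m "W x"] by simp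
    then have "\<bar>f x\<bar> * (W x / r m (W x)) \<le> \<bar>f x\<bar> * 1" by (intro mult_left_mono) auto
    then show ?thesis using W_pos[of x] r0[of m "W x"] by (simp add: s_def abs_mult)
  qed
  have rW: "(\<lambda>m. r m (W x)) \<longlonglongrightarrow> W x" for x
  proof -
    have "(\<lambda>m. r m (W x)) \<longlonglongrightarrow> sqrt ((W x)\<^sup>2 + 0\<^sup>2)"
      unfolding r_def \<epsilon>_def by (intro tendsto_intros LIMSEQ_inverse_real_of_nat)
    then show ?thesis using W_pos[of x] by simp
  qed
  have Wr: "(\<lambda>m. W x / r m (W x)) \<longlonglongrightarrow> 1" for x
    using tendsto_divide[OF tendsto_const[of "W x"] rW[of x]] W_pos[of x] by simp
  have s_lim: "(\<lambda>m. s m x) \<longlonglongrightarrow> f x" for x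
    using tendsto_mult_left[OF Wr[of x], of "f x"] by (simp add: s_def)
  have \<epsilon>r: "(\<lambda>m. (\<epsilon> m / r m (W x))\<^sup>2) \<longlonglongrightarrow> 0" for x
  proof -
    have "(\<lambda>m. (\<epsilon> m / r m (W x))\<^sup>2) \<longlonglongrightarrow> (0 / W x)\<^sup>2"
      using W_pos[of x] unfolding \<epsilon>_def by (intro tendsto_intros rW LIMSEQ_inverse_real_of_nat) auto
    then show ?thesis by simp
  qed
  have trunc_f: "weakd i (\<lambda>x. trunc k (f x)) (\<lambda>x. trunc' k (f x) * G x)" for k
  proof (rule weakd_limit_dominated[OF chain[of k], where A = f and B = "\<lambda>x. \<bar>G x\<bar> + real (Suc k) * \<bar>\<beta> i x\<bar>"])
    have tc: "(\<lambda>m. trunc k (s m x)) \<longlonglongrightarrow> trunc k (f x)" "(\<lambda>m. trunc' k (s m x)) \<longlonglongrightarrow> trunc' k (f x)" for x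
      by (rule continuous_on_tendsto_compose[OF continuous_trunc(1)[of UNIV] s_lim] continuous_on_tendsto_compose[OF continuous_trunc(2)[of UNIV] s_lim]; simp)+
    show "AE x in lborel. (\<lambda>m. trunc k (s m x)) \<longlonglongrightarrow> trunc k (f x)" using tc by simp
    have "(\<lambda>m. trunc' k (s m x) * (G x * (W x / r m (W x))) + trunc' k (s m x) * s m x * ((\<epsilon> m / r m (W x))\<^sup>2 * \<beta> i x))
      \<longlonglongrightarrow> trunc' k (f x) * (G x * 1) + trunc' k (f x) * f x * (0 * \<beta> i x)" for x
      by (intro tendsto_intros tc Wr s_lim \<epsilon>r)
    then show "AE x in lborel. (\<lambda>m. trunc' k (s m x) * (G x * (W x / r m (W x))) + trunc' k (s m x) * s m x * ((\<epsilon> m / r m (W x))\<^sup>2 * \<beta> i x))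
      \<longlonglongrightarrow> trunc' k (f x) * G x" by simp
    show "AE x in lborel. \<bar>trunc k (s m x)\<bar> \<le> \<bar>f x\<bar>" for m
      by (intro AE_I2 order_trans[OF trunc_le s_le])
    show "AE x in lborel. \<bar>trunc' k (s m x) * (G x * (W x / r m (W x))) + trunc' k (s m x) * s m x * ((\<epsilon> m / r m (W x))\<^sup>2 * \<beta> i x)\<bar>
       \<le> \<bar>\<bar>G x\<bar> + real (Suc k) * \<bar>\<beta> i x\<bar>\<bar>" for m
    proof (rule AE_I2)
      fix x
      have "\<bar>trunc' k (s m x)\<bar> * (\<bar>G x\<bar> * \<bar>W x / r m (W x)\<bar>) \<le> 1 * (\<bar>G x\<bar> * 1)"
        using trunc'_pos[of k "s m x"] trunc'_le[of k "s m x"] rb[of "W x" m] r0[of m "W x"] W_pos[of x]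
        by (intro mult_mono) auto
      moreover have "\<bar>trunc' k (s m x) * s m x\<bar> * (\<bar>(\<epsilon> m / r m (W x))\<^sup>2\<bar> * \<bar>\<beta> i x\<bar>) \<le> real (Suc k) * (1 * \<bar>\<beta> i x\<bar>)"
        using r\<epsilon>[of m "W x"] r0[of m "W x"] \<epsilon>[of m] by (intro mult_mono trunc'_mult_le) (auto intro!: power_le_one)
      ultimately show "\<bar>trunc' k (s m x) * (G x * (W x / r m (W x))) + trunc' k (s m x) * s m x * ((\<epsilon> m / r m (W x))\<^sup>2 * \<beta> i x)\<bar>
       \<le> \<bar>\<bar>G x\<bar> + real (Suc k) * \<bar>\<beta> i x\<bar>\<bar>"
        by (intro order_trans[OF abs_triangle_ineq]) (simp add: abs_mult)
    qed
    show "locint (\<lambda>x. \<bar>G x\<bar> + real (Suc k) * \<bar>\<beta> i x\<bar>)"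
      by (intro locint_add locint_cmult locint_abs lG locint_\<beta>)
  qed (use lf in auto)
  show ?thesis
  proof (rule weakd_limit_dominated[OF trunc_f _ _ lf lG])
    have "(\<lambda>k. trunc' k (f x) * G x) \<longlonglongrightarrow> 1 * G x" for x by (intro tendsto_intros trunc'_tendsto)
    then show "AE x in lborel. (\<lambda>k. trunc' k (f x) * G x) \<longlonglongrightarrow> G x" by simp
    show "AE x in lborel. \<bar>trunc' k (f x) * G x\<bar> \<le> \<bar>G x\<bar>" for k
      unfolding abs_mult using trunc'_pos[of k] trunc'_le[of k]
      by (intro AE_I2 mult_left_le_one_le) (auto simp: abs_of_pos less_imp_le)
  qed (use trunc_tendsto trunc_le in auto)
qed

end

section \<open>The spaces V and W\<close>

lemma AE_lebesgue_iff: "(AE x in lebesgue. P x) \<longleftrightarrow> (AE x in lborel. P x)"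
  by (rule AE_completion_iff)

lemma borel_version:
  fixes f :: "'a::euclidean_space \<Rightarrow> real"
  assumes "f \<in> borel_measurable lebesgue"
  shows "\<exists>g\<in>borel_measurable borel. AE x in lborel. f x = g x"
  using completion_ex_borel_measurable_real[OF assms] by simp

lemma lebesgue_measurable_borel: "f \<in> borel_measurable borel \<Longrightarrow> f \<in> borel_measurable lebesgue"
  by (rule measurable_completion) simp

lemma lebesgue_measurable_AE:
  fixes f g :: "'a::euclidean_space \<Rightarrow> 'b::euclidean_space"
  assumes "g \<in> borel_measurable borel" "AE x in lborel. f x = g x"
  shows "f \<in> borel_measurable lebesgue"
  by (rule borel_measurable_AE[OF lebesgue_measurable_borel[OF assms(1)]])
    (use assms(2) in \<open>auto simp: AE_lebesgue_iff elim!: eventually_mono\<close>)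

lemma measurable_vec_component:
  "G \<in> borel_measurable M \<Longrightarrow> (\<lambda>x. (G x :: real ^ 'n::finite) $ i) \<in> borel_measurable M"
  by (rule measurable_compose[OF _ borel_measurable_continuous_onI]) (auto intro!: continuous_intros)

lemma measurable_vec_lambda:
  assumes "\<And>i. g i \<in> borel_measurable M"
  shows "(\<lambda>x. (\<chi> i. g i x) :: real ^ 'n::finite) \<in> borel_measurable M"
  by (subst borel_measurable_euclidean_space) (use assms in \<open>auto simp: Basis_vec_def inner_axis\<close>)

lemma norm_vec_le:
  fixes g :: "'n::finite \<Rightarrow> 'a \<Rightarrow> real"
  shows "norm (\<chi> i. g i x) \<le> (\<Sum>i\<in>UNIV. \<bar>g i x\<bar>)"
  using norm_le_l1_cart[of "\<chi> i. g i x"] by simp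

lemma L_loc_imp_Lploc:
  fixes f :: "'a::euclidean_space \<Rightarrow> 'b::euclidean_space" and g :: "'a \<Rightarrow> real"
  assumes f: "f \<in> L_loc (ereal p) lebesgue" and g: "g \<in> borel_measurable borel" and p: "0 \<le> p"
    and le: "AE x in lborel. \<bar>g x\<bar> \<le> norm (f x)"
  shows "Lploc p g"
  unfolding Lploc_def
proof (intro conjI allI g)
  fix R
  let ?f = "\<lambda>x. indicator (cball 0 R) x *\<^sub>R f x"
  have "?f \<in> L_space (ereal p) lebesgue" using f by (simp add: L_loc_def)
  then have "integrable lebesgue (\<lambda>x. norm (?f x) powr p)" by (simp add: L_space_def)
  then have "(\<integral>\<^sup>+x. ennreal (norm (norm (?f x) powr p)) \<partial>lebesgue) < \<infinity>" by (simp add: integrable_iff_bounded)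
  then have "(\<integral>\<^sup>+x. ennreal (norm (?f x) powr p) \<partial>lborel) < \<infinity>" by (simp add: nn_integral_completion)
  moreover have "pint p (\<lambda>x. indicator (cball 0 R) x * g x) \<le> (\<integral>\<^sup>+x. ennreal (norm (?f x) powr p) \<partial>lborel)"
    unfolding pint_def
    by (rule nn_integral_mono_AE) (use le p in \<open>auto intro!: ennreal_leI powr_mono2 simp: abs_mult mult_left_mono elim!: eventually_mono\<close>)
  ultimately show "pint p (\<lambda>x. indicator (cball 0 R) x * g x) < \<infinity>" by simp
qed

lemma locint_imp_L_loc:
  fixes f :: "'a::euclidean_space \<Rightarrow> 'b::euclidean_space" and g :: "'a \<Rightarrow> real"
  assumes g: "locint g" and f: "f \<in> borel_measurable lebesgue" and le: "AE x in lborel. norm (f x) \<le> \<bar>g x\<bar>"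
  shows "f \<in> L_loc 1 lebesgue"
  unfolding L_loc_def
proof (intro CollectI allI impI)
  fix K :: "'a set" assume K: "compact K"
  obtain R where "\<forall>x\<in>K. norm x \<le> R" using compact_imp_bounded[OF K] unfolding bounded_iff by blast
  then have R: "K \<subseteq> cball 0 R" by auto
  have Ks: "K \<in> sets lebesgue" using K by (auto dest: compact_imp_closed)
  have m: "(\<lambda>x. indicator K x *\<^sub>R f x) \<in> borel_measurable lebesgue"
    using f Ks by (intro borel_measurable_scaleR borel_measurable_indicator)
  have i: "integrable lebesgue (\<lambda>x. indicator (cball 0 R) x * g x)"
    using g locint_measurable[OF g] by (subst integrable_completion) (auto simp: locint_def)
  have "integrable lebesgue (\<lambda>x. norm (indicator K x *\<^sub>R f x))"
  proof (rule Bochner_Integration.integrable_bound[OF i])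
    show "(\<lambda>x. norm (indicator K x *\<^sub>R f x)) \<in> borel_measurable lebesgue" using m by measurable
    show "AE x in lebesgue. norm (norm (indicator K x *\<^sub>R f x)) \<le> norm (indicator (cball 0 R) x * g x)"
      using le R unfolding AE_lebesgue_iff by (auto simp: indicator_def elim!: eventually_mono)
  qed
  then show "(\<lambda>x. indicator K x *\<^sub>R f x) \<in> L_space 1 lebesgue"
    using m by (simp add: L_space_def)
qed

lemma integral_lebesgue_borel:
  fixes f g :: "'a::euclidean_space \<Rightarrow> real"
  assumes g: "g \<in> borel_measurable borel" and ae: "AE x in lborel. f x = g x"
  shows "(\<integral>x. f x \<partial>lebesgue) = (\<integral>x. g x \<partial>lborel)"
proof -
  have "(\<integral>x. f x \<partial>lebesgue) = (\<integral>x. g x \<partial>lebesgue)"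
    using ae by (intro integral_cong_AE lebesgue_measurable_AE[OF g ae] lebesgue_measurable_borel[OF g]) (simp add: AE_lebesgue_iff)
  then show ?thesis using g by (simp add: integral_completion)
qed

lemma test_functions_measurable:
  assumes "\<eta> \<in> test_functions"
  shows "\<eta> \<in> borel_measurable borel" "partial_deriv i \<eta> \<in> borel_measurable borel"
  using assms test_functions_partial_deriv[OF assms]
  by (auto intro!: borel_measurable_continuous test_functionsD(2))

lemma has_weak_gradient_imp_weakd:
  fixes u u' :: "real ^ 'n::finite \<Rightarrow> real"
  assumes u: "has_weak_gradient u G" and u': "u' \<in> borel_measurable borel" "AE x in lborel. u x = u' x"
    and g: "g \<in> borel_measurable borel" "AE x in lborel. G x $ i = g x"
  shows "weakd i u' g"
  unfolding weakd_def
proof (intro conjI ballI)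
  have "Lploc 1 u'" by (rule L_loc_imp_Lploc[of u]) (use u u' in \<open>auto simp: has_weak_gradient_def one_ereal_def elim!: eventually_mono\<close>)
  then show "locint u'" by (rule Lploc_locint[OF order_refl])
  have "Lploc 1 g"
  proof (rule L_loc_imp_Lploc[of G])
    show "AE x in lborel. \<bar>g x\<bar> \<le> norm (G x)"
      using g(2) by eventually_elim (metis component_le_norm_cart)
  qed (use u g in \<open>auto simp: has_weak_gradient_def one_ereal_def\<close>)
  then show "locint g" by (rule Lploc_locint[OF order_refl])
  fix \<eta> :: "real ^ 'n \<Rightarrow> real" assume \<eta>: "\<eta> \<in> test_functions"
  note [measurable] = test_functions_measurable[OF \<eta>] u'(1) g(1)
  have "(\<integral>x. g x * \<eta> x \<partial>lborel) = (\<integral>x. G x $ i * \<eta> x \<partial>lebesgue)"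
    using g(2) by (intro integral_lebesgue_borel[symmetric]) (auto elim!: eventually_mono)
  also have "\<dots> = - (\<integral>x. u x * partial_deriv i \<eta> x \<partial>lebesgue)"
    using u \<eta> by (simp add: has_weak_gradient_def)
  also have "(\<integral>x. u x * partial_deriv i \<eta> x \<partial>lebesgue) = (\<integral>x. u' x * partial_deriv i \<eta> x \<partial>lborel)"
    using u'(2) by (intro integral_lebesgue_borel) (auto elim!: eventually_mono)
  finally show "(\<integral>x. g x * \<eta> x \<partial>lborel) = - (\<integral>x. u' x * partial_deriv i \<eta> x \<partial>lborel)" .
qed

lemma weakd_imp_has_weak_gradient:
  fixes u u' :: "real ^ 'n::finite \<Rightarrow> real"
  assumes w: "\<And>i. weakd i u' (g i)" and u': "AE x in lborel. u x = u' x"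
  shows "has_weak_gradient u (\<lambda>x. \<chi> i. g i x)"
  unfolding has_weak_gradient_def
proof (intro conjI allI ballI)
  note [measurable] = weakd_measurable[OF w]
  show "u \<in> L_loc 1 lebesgue"
    by (rule locint_imp_L_loc[OF weakd_locint(1)[OF w] lebesgue_measurable_AE[OF _ u']])
      (use u' in \<open>auto elim!: eventually_mono\<close>)
  show "(\<lambda>x. \<chi> i. g i x) \<in> L_loc 1 lebesgue"
  proof (rule locint_imp_L_loc)
    show "locint (\<lambda>x. \<Sum>i\<in>UNIV. \<bar>g i x\<bar>)" by (intro locint_sum locint_abs weakd_locint(2)[OF w])
    show "(\<lambda>x. \<chi> i. g i x) \<in> borel_measurable lebesgue"
      by (intro measurable_vec_lambda lebesgue_measurable_borel) measurable
    show "AE x in lborel. norm (\<chi> i. g i x) \<le> \<bar>\<Sum>i\<in>UNIV. \<bar>g i x\<bar>\<bar>"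
    proof (rule AE_I2)
      fix x show "norm (\<chi> i. g i x) \<le> \<bar>\<Sum>i\<in>UNIV. \<bar>g i x\<bar>\<bar>"
        using norm_le_l1_cart[of "\<chi> i. g i x"] by simp
    qed
  qed
  fix i and \<eta> :: "real ^ 'n \<Rightarrow> real" assume \<eta>: "\<eta> \<in> test_functions"
  note [measurable] = test_functions_measurable[OF \<eta>]
  have "(\<integral>x. (\<chi> i. g i x) $ i * \<eta> x \<partial>lebesgue) = (\<integral>x. g i x * \<eta> x \<partial>lborel)"
    by (intro integral_lebesgue_borel) auto
  also have "\<dots> = - (\<integral>x. u' x * partial_deriv i \<eta> x \<partial>lborel)"
    using w \<eta> by (simp add: weakd_def)
  also have "(\<integral>x. u' x * partial_deriv i \<eta> x \<partial>lborel) = (\<integral>x. u x * partial_deriv i \<eta> x \<partial>lebesgue)"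
    using u' by (intro integral_lebesgue_borel[symmetric]) (auto elim!: eventually_mono)
  finally show "(\<integral>x. (\<chi> i. g i x) $ i * \<eta> x \<partial>lebesgue) = - (\<integral>x. u x * partial_deriv i \<eta> x \<partial>lebesgue)" .
qed

lemma L_norm_eq:
  assumes "f \<in> borel_measurable M"
  shows "L_norm p M f = enn2real (\<integral>\<^sup>+x. ennreal (norm (f x) powr p) \<partial>M) powr (1 / p)"
  unfolding L_norm_def using assms by (subst integral_eq_nn_integral) auto

text \<open>A weight \<open>w\<close> whose root and logarithmic derivative have the Borel versions \<open>\<phi>\<close> and \<open>\<beta>\<close>.\<close>

locale weighted_space = borel_weight p \<phi> d\<phi> \<beta>
  for p :: real and \<phi> :: "real ^ 'n::finite \<Rightarrow> real" and d\<phi> \<beta> :: "'n \<Rightarrow> real ^ 'n \<Rightarrow> real" +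
  fixes w :: "real ^ 'n \<Rightarrow> real"
  assumes w_measurable: "w \<in> borel_measurable lebesgue"
    and w_eq: "AE x in lborel. w x = \<phi> x powr p"
    and beta_eq: "AE x in lborel. \<forall>j. beta p w x $ j = \<beta> j x"
begin

abbreviation "\<mu> \<equiv> weighted w"

lemma measurable_\<mu>: "borel_measurable \<mu> = borel_measurable lebesgue"
  unfolding weighted_def by (rule measurable_cong_sets) simp_all

lemma w_eq_W: "AE x in lebesgue. w x = W x"
  using w_eq by (simp add: AE_lebesgue_iff W_def)

lemma nn_integral_\<mu>:
  assumes "f \<in> borel_measurable lebesgue"
  shows "(\<integral>\<^sup>+x. ennreal (f x) \<partial>\<mu>) = (\<integral>\<^sup>+x. ennreal (W x * f x) \<partial>lborel)"
proof -
  have "(\<integral>\<^sup>+x. ennreal (f x) \<partial>\<mu>) = (\<integral>\<^sup>+x. ennreal (w x) * ennreal (f x) \<partial>lebesgue)"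
    unfolding weighted_def using assms w_measurable by (intro nn_integral_density) auto
  also have "\<dots> = (\<integral>\<^sup>+x. ennreal (W x * f x) \<partial>lebesgue)"
    using w_eq_W W_pos by (intro nn_integral_cong_AE) (auto simp: ennreal_mult'' less_imp_le ennreal_mult' elim!: eventually_mono)
  finally show ?thesis by (simp add: nn_integral_completion)
qed

lemma pint_\<mu>:
  fixes f :: "real ^ 'n \<Rightarrow> 'b::euclidean_space"
  assumes "f \<in> borel_measurable lebesgue" "AE x in lborel. norm (f x) = \<bar>h x\<bar>"
  shows "(\<integral>\<^sup>+x. ennreal (norm (f x) powr p) \<partial>\<mu>) = pint p (\<lambda>x. \<phi> x * h x)"
proof -
  have "(\<integral>\<^sup>+x. ennreal (norm (f x) powr p) \<partial>\<mu>) = (\<integral>\<^sup>+x. ennreal (W x * norm (f x) powr p) \<partial>lborel)"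
    using assms(1) by (intro nn_integral_\<mu>) measurable
  also have "\<dots> = pint p (\<lambda>x. \<phi> x * h x)"
    unfolding pint_def using assms(2) \<phi>_pos
    by (intro nn_integral_cong_AE) (auto simp: W_def abs_mult powr_mult abs_of_pos less_imp_le elim!: eventually_mono)
  finally show ?thesis .
qed

lemma integral_\<mu>:
  assumes h: "h \<in> borel_measurable borel" "AE x in lborel. f x = h x"
  shows "(\<integral>x. f x \<partial>\<mu>) = (\<integral>x. h x * W x \<partial>lborel)"
proof -
  have "(\<integral>x. f x \<partial>\<mu>) = (\<integral>x. w x *\<^sub>R f x \<partial>lebesgue)"
    unfolding weighted_def
  proof (rule integral_density)
    show "AE x in lebesgue. 0 \<le> w x" using w_eq_W W_pos by (auto simp: less_imp_le elim!: eventually_mono)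
  qed (use w_measurable lebesgue_measurable_AE[OF h] in auto)
  also have "\<dots> = (\<integral>x. h x * W x \<partial>lborel)"
    using w_eq_W h by (intro integral_lebesgue_borel) (auto simp: AE_lebesgue_iff)
  finally show ?thesis .
qed

lemma L_space_iff:
  fixes f :: "real ^ 'n \<Rightarrow> 'b::euclidean_space"
  shows "f \<in> L_space (ereal p) \<mu> \<longleftrightarrow> f \<in> borel_measurable lebesgue \<and> (\<integral>\<^sup>+x. ennreal (norm (f x) powr p) \<partial>\<mu>) < \<infinity>"
proof -
  have "integrable \<mu> (\<lambda>x. norm (f x) powr p) \<longleftrightarrow> (\<integral>\<^sup>+x. ennreal (norm (f x) powr p) \<partial>\<mu>) < \<infinity>"
    if "f \<in> borel_measurable lebesgue"
  proof -
    have [measurable]: "f \<in> borel_measurable \<mu>" using that by (simp add: measurable_\<mu>)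
    have "(\<lambda>x. norm (f x) powr p) \<in> borel_measurable \<mu>" by measurable
    then show ?thesis by (simp add: integrable_iff_bounded)
  qed
  then show ?thesis by (auto simp: L_space_def measurable_\<mu>)
qed

lemma L_space_real_iff:
  fixes f :: "real ^ 'n \<Rightarrow> real"
  assumes "h \<in> borel_measurable borel" "AE x in lborel. f x = h x"
  shows "f \<in> L_space (ereal p) \<mu> \<longleftrightarrow> pint p (\<lambda>x. \<phi> x * h x) < \<infinity>"
proof -
  have f: "f \<in> borel_measurable lebesgue" by (rule lebesgue_measurable_AE[OF assms])
  have "(\<integral>\<^sup>+x. ennreal (norm (f x) powr p) \<partial>\<mu>) = pint p (\<lambda>x. \<phi> x * h x)"
    by (rule pint_\<mu>[OF f]) (use assms(2) in \<open>auto elim!: eventually_mono\<close>)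
  then show ?thesis using f by (simp add: L_space_iff)
qed

lemma L_space_component:
  fixes G :: "real ^ 'n \<Rightarrow> real ^ 'n"
  assumes G: "G \<in> L_space (ereal p) \<mu>" and g: "g \<in> borel_measurable borel" "AE x in lborel. G x $ i = g x"
  shows "pint p (\<lambda>x. \<phi> x * g x) < \<infinity>"
proof -
  have Gm: "G \<in> borel_measurable lebesgue" and Gf: "(\<integral>\<^sup>+x. ennreal (norm (G x) powr p) \<partial>\<mu>) < \<infinity>"
    using G by (auto simp: L_space_iff)
  have "(\<integral>\<^sup>+x. ennreal (norm (G x $ i) powr p) \<partial>\<mu>) \<le> (\<integral>\<^sup>+x. ennreal (norm (G x) powr p) \<partial>\<mu>)"
    using p_pos component_le_norm_cart[of _ i] by (intro nn_integral_mono ennreal_leI powr_mono2) auto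
  moreover have "(\<integral>\<^sup>+x. ennreal (norm (G x $ i) powr p) \<partial>\<mu>) = pint p (\<lambda>x. \<phi> x * g x)"
    by (rule pint_\<mu>[OF measurable_vec_component[OF Gm]]) (use g(2) in \<open>auto elim!: eventually_mono\<close>)
  ultimately show ?thesis using Gf by simp
qed

lemma nn_integral_vec_le:
  fixes g :: "'n \<Rightarrow> real ^ 'n \<Rightarrow> real"
  assumes g: "\<And>i. g i \<in> borel_measurable borel"
  shows "(\<integral>\<^sup>+x. ennreal (norm ((\<chi> i. g i x) :: real ^ 'n) powr p) \<partial>\<mu>) \<le> pint p (\<lambda>x. \<Sum>i\<in>UNIV. \<bar>\<phi> x * g i x\<bar>)"
proof -
  note [measurable] = g
  have m: "(\<lambda>x. (\<chi> i. g i x) :: real ^ 'n) \<in> borel_measurable borel" by (rule measurable_vec_lambda[OF g])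
  have "(\<integral>\<^sup>+x. ennreal (norm ((\<chi> i. g i x) :: real ^ 'n) powr p) \<partial>\<mu>) = pint p (\<lambda>x. \<phi> x * norm ((\<chi> i. g i x) :: real ^ 'n))"
    by (rule pint_\<mu>[OF lebesgue_measurable_borel[OF m]]) simp
  also have "\<dots> \<le> pint p (\<lambda>x. \<Sum>i\<in>UNIV. \<bar>\<phi> x * g i x\<bar>)"
  proof (rule pint_mono[OF p_pos(2)], rule AE_I2)
    fix x
    have "\<bar>\<phi> x * norm ((\<chi> i. g i x) :: real ^ 'n)\<bar> \<le> \<phi> x * (\<Sum>i\<in>UNIV. \<bar>g i x\<bar>)"
      using \<phi>_pos[of x] norm_vec_le[of g x] by (simp add: abs_mult mult_left_mono less_imp_le)
    also have "\<dots> = (\<Sum>i\<in>UNIV. \<bar>\<phi> x * g i x\<bar>)"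
      using \<phi>_pos[of x] by (simp add: sum_distrib_left abs_mult)
    finally show "\<bar>\<phi> x * norm ((\<chi> i. g i x) :: real ^ 'n)\<bar> \<le> \<bar>\<Sum>i\<in>UNIV. \<bar>\<phi> x * g i x\<bar>\<bar>" by simp
  qed
  finally show ?thesis .
qed

lemma L_space_vecI:
  fixes g :: "'n \<Rightarrow> real ^ 'n \<Rightarrow> real"
  assumes g: "\<And>i. g i \<in> borel_measurable borel" and f: "\<And>i. pint p (\<lambda>x. \<phi> x * g i x) < \<infinity>"
  shows "(\<lambda>x. (\<chi> i. g i x) :: real ^ 'n) \<in> L_space (ereal p) \<mu>"
proof -
  note [measurable] = g
  have "pint p (\<lambda>x. \<Sum>i\<in>UNIV. \<bar>\<phi> x * g i x\<bar>) < \<infinity>"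
    by (rule pint_sum_finite[OF _ p_pos(2)]) (use f in auto)
  with nn_integral_vec_le[of g, OF g]
  have "(\<integral>\<^sup>+x. ennreal (norm ((\<chi> i. g i x) :: real ^ 'n) powr p) \<partial>\<mu>) < \<infinity>" by (rule le_less_trans)
  then show ?thesis
    using lebesgue_measurable_borel[OF measurable_vec_lambda[OF g]] by (simp add: L_space_iff)
qed

text \<open>The common description of the three spaces, in terms of Borel versions.\<close>

definition sobolev :: "(real ^ 'n \<Rightarrow> real) \<Rightarrow> bool" where
  "sobolev u \<longleftrightarrow> (\<exists>u' g. u' \<in> borel_measurable borel \<and> (AE x in lborel. u x = u' x) \<and> pint p (\<lambda>x. \<phi> x * u' x) < \<infinity> \<and>
     (\<forall>i. weakd i u' (g i) \<and> pint p (\<lambda>x. \<phi> x * g i x) < \<infinity>))"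

lemma borel_versions_vec:
  assumes "G \<in> borel_measurable lebesgue"
  shows "\<exists>g. \<forall>i. g i \<in> borel_measurable borel \<and> (AE x in lborel. (G x :: real ^ 'n) $ i = g i x)"
  using borel_version[OF measurable_vec_component[OF assms]] by (intro choice) blast

lemma W_space_iff:
  "u \<in> L_space (ereal p) \<mu> \<and> (\<exists>G. has_weak_gradient u G \<and> G \<in> L_space (ereal p) \<mu>) \<longleftrightarrow> sobolev u"
proof
  assume "u \<in> L_space (ereal p) \<mu> \<and> (\<exists>G. has_weak_gradient u G \<and> G \<in> L_space (ereal p) \<mu>)"
  then obtain G where u: "u \<in> L_space (ereal p) \<mu>" and G: "has_weak_gradient u G" "G \<in> L_space (ereal p) \<mu>" by blast
  obtain u' where u': "u' \<in> borel_measurable borel" "AE x in lborel. u x = u' x"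
    using borel_version[of u] u by (auto simp: L_space_iff)
  obtain g where g: "\<And>i. g i \<in> borel_measurable borel" "\<And>i. AE x in lborel. G x $ i = g i x"
    using borel_versions_vec[of G] G(2) by (auto simp: L_space_iff)
  show "sobolev u"
    unfolding sobolev_def
    using u' u L_space_real_iff[OF u'] has_weak_gradient_imp_weakd[OF G(1) u' g(1) g(2)] L_space_component[OF G(2) g(1) g(2)]
    by blast
next
  assume "sobolev u"
  then obtain u' g where u': "u' \<in> borel_measurable borel" "AE x in lborel. u x = u' x" "pint p (\<lambda>x. \<phi> x * u' x) < \<infinity>"
    and g: "\<And>i. weakd i u' (g i)" "\<And>i. pint p (\<lambda>x. \<phi> x * g i x) < \<infinity>" unfolding sobolev_def by blast
  show "u \<in> L_space (ereal p) \<mu> \<and> (\<exists>G. has_weak_gradient u G \<and> G \<in> L_space (ereal p) \<mu>)"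
    using L_space_real_iff[OF u'(1,2)] u'(3) weakd_imp_has_weak_gradient[OF g(1) u'(2)]
      L_space_vecI[of g, OF weakd_measurable(2)[OF g(1)] g(2)] by blast
qed

lemma V_identity:
  assumes u': "u' \<in> borel_measurable borel" "AE x in lborel. u x = u' x" "pint p (\<lambda>x. \<phi> x * u' x) < \<infinity>"
    and g: "g \<in> borel_measurable borel" "AE x in lborel. G x $ i = g x" "pint p (\<lambda>x. \<phi> x * g x) < \<infinity>"
    and \<eta>: "\<eta> \<in> test_functions"
  shows "(\<integral>x. G x $ i * \<eta> x \<partial>\<mu>) = - (\<integral>x. u x * partial_deriv i \<eta> x \<partial>\<mu>) - (\<integral>x. u x * \<eta> x * beta p w x $ i \<partial>\<mu>) \<longleftrightarrow>
    (\<integral>x. ((g x + u' x * \<beta> i x) * W x) * \<eta> x \<partial>lborel) = - (\<integral>x. (u' x * W x) * partial_deriv i \<eta> x \<partial>lborel)"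
proof -
  note [measurable] = test_functions_measurable[OF \<eta>] u'(1) g(1)
  obtain R where R: "supp_ball R \<eta>" using test_functionsD(4)[OF \<eta>] by blast
  have 1: "(\<integral>x. G x $ i * \<eta> x \<partial>\<mu>) = (\<integral>x. g x * \<eta> x * W x \<partial>lborel)"
    by (rule integral_\<mu>) (use g(2) in \<open>auto elim!: eventually_mono\<close>)
  have 2: "(\<integral>x. u x * partial_deriv i \<eta> x \<partial>\<mu>) = (\<integral>x. u' x * partial_deriv i \<eta> x * W x \<partial>lborel)"
    by (rule integral_\<mu>) (use u'(2) in \<open>auto elim!: eventually_mono\<close>)
  have 3: "(\<integral>x. u x * \<eta> x * beta p w x $ i \<partial>\<mu>) = (\<integral>x. u' x * \<eta> x * \<beta> i x * W x \<partial>lborel)"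
  proof (rule integral_\<mu>)
    show "AE x in lborel. u x * \<eta> x * beta p w x $ i = u' x * \<eta> x * \<beta> i x"
      using u'(2) beta_eq by eventually_elim simp
  qed measurable
  have i1: "integrable lborel (\<lambda>x. (g x * W x) * \<eta> x)" "integrable lborel (\<lambda>x. (u' x * \<beta> i x * W x) * \<eta> x)"
    by (rule locint_integrable_mult_cont[OF Lp_locint(2)[OF g(1,3)] test_functionsD(2)[OF \<eta>] R]
      locint_integrable_mult_cont[OF Lp_locint(3)[OF u'(1,3)] test_functionsD(2)[OF \<eta>] R])+
  have "(\<integral>x. ((g x + u' x * \<beta> i x) * W x) * \<eta> x \<partial>lborel) = (\<integral>x. (g x * W x) * \<eta> x + (u' x * \<beta> i x * W x) * \<eta> x \<partial>lborel)"
    by (simp add: algebra_simps)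
  also have "\<dots> = (\<integral>x. (g x * W x) * \<eta> x \<partial>lborel) + (\<integral>x. (u' x * \<beta> i x * W x) * \<eta> x \<partial>lborel)"
    using i1 by simp
  finally show ?thesis unfolding 1 2 3 by (auto simp: mult_ac)
qed

lemma V_space_iff:
  "u \<in> L_space (ereal p) \<mu> \<and> (\<exists>G :: real ^ 'n \<Rightarrow> real ^ 'n. G \<in> L_space (ereal p) \<mu> \<and>
       (\<forall>i. \<forall>\<eta>\<in>test_functions.
          (\<integral>x. G x $ i * \<eta> x \<partial>\<mu>) = - (\<integral>x. u x * partial_deriv i \<eta> x \<partial>\<mu>) - (\<integral>x. u x * \<eta> x * beta p w x $ i \<partial>\<mu>)))
   \<longleftrightarrow> sobolev u" (is "?V \<longleftrightarrow> _")
proof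
  assume ?V
  then obtain G :: "real ^ 'n \<Rightarrow> real ^ 'n" where u: "u \<in> L_space (ereal p) \<mu>" and G: "G \<in> L_space (ereal p) \<mu>"
    and id: "\<And>i \<eta>. \<eta> \<in> test_functions \<Longrightarrow> (\<integral>x. G x $ i * \<eta> x \<partial>\<mu>) =
      - (\<integral>x. u x * partial_deriv i \<eta> x \<partial>\<mu>) - (\<integral>x. u x * \<eta> x * beta p w x $ i \<partial>\<mu>)" by blast
  obtain u' where u': "u' \<in> borel_measurable borel" "AE x in lborel. u x = u' x"
    using borel_version[of u] u by (auto simp: L_space_iff)
  have fu: "pint p (\<lambda>x. \<phi> x * u' x) < \<infinity>" using L_space_real_iff[OF u'] u by blast
  obtain g where g: "\<And>i. g i \<in> borel_measurable borel" "\<And>i. AE x in lborel. G x $ i = g i x"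
    using borel_versions_vec[of G] G by (auto simp: L_space_iff)
  have fg: "pint p (\<lambda>x. \<phi> x * g i x) < \<infinity>" for i by (rule L_space_component[OF G g])
  have "weakd i (\<lambda>x. u' x * W x) (\<lambda>x. (g i x + u' x * \<beta> i x) * W x)" for i
    unfolding weakd_def
  proof (intro conjI ballI)
    show "locint (\<lambda>x. u' x * W x)" by (rule Lp_locint(2)[OF u'(1) fu])
    show "locint (\<lambda>x. (g i x + u' x * \<beta> i x) * W x)"
      using locint_add[OF Lp_locint(2)[OF g(1) fg] Lp_locint(3)[OF u'(1) fu]] by (simp add: distrib_right)
  qed (use id V_identity[OF u' fu g fg] in blast)
  then have "weakd i u' (g i)" for i by (rule weighted_imp_weakd[OF u'(1) g(1) fu fg])
  then show "sobolev u" unfolding sobolev_def using u' fu fg by blast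
next
  assume "sobolev u"
  then obtain u' g where u': "u' \<in> borel_measurable borel" "AE x in lborel. u x = u' x" "pint p (\<lambda>x. \<phi> x * u' x) < \<infinity>"
    and g: "\<And>i. weakd i u' (g i)" "\<And>i. pint p (\<lambda>x. \<phi> x * g i x) < \<infinity>" unfolding sobolev_def by blast
  let ?G = "\<lambda>x. (\<chi> i. g i x) :: real ^ 'n"
  have "(\<integral>x. ?G x $ i * \<eta> x \<partial>\<mu>) = - (\<integral>x. u x * partial_deriv i \<eta> x \<partial>\<mu>) - (\<integral>x. u x * \<eta> x * beta p w x $ i \<partial>\<mu>)"
    if \<eta>: "\<eta> \<in> test_functions" for i \<eta>
  proof (subst V_identity[OF u' weakd_measurable(2)[OF g(1)] _ g(2) \<eta>])
    show "(\<integral>x. ((g i x + u' x * \<beta> i x) * W x) * \<eta> x \<partial>lborel) = - (\<integral>x. (u' x * W x) * partial_deriv i \<eta> x \<partial>lborel)"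
      using weakd_imp_weighted[OF u'(3) g(2) g(1), of i] \<eta> by (simp add: weakd_def)
  qed simp
  then show ?V
    using L_space_real_iff[OF u'(1,2)] u'(3) L_space_vecI[of g, OF weakd_measurable(2)[OF g(1)] g(2)] by blast
qed

end

section \<open>The space H and the equality of the three spaces\<close>

context weighted_space
begin

lemma pint_test_finite:
  assumes "U \<in> test_functions"
  shows "pint p (\<lambda>x. \<phi> x * U x) < \<infinity>"
proof -
  obtain R where R: "supp_ball R U" using test_functionsD(4)[OF assms] by blast
  obtain M where M: "M > 0" "\<And>x. \<bar>U x\<bar> \<le> M" using supp_ball_bounded[OF test_functionsD(2)[OF assms] R] by blast
  have "pint p (\<lambda>x. \<phi> x * U x) \<le> pint p (\<lambda>x. M * (indicator (cball 0 R) x * \<phi> x))"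
  proof (rule pint_mono[OF p_pos(2)], rule AE_I2)
    fix x
    show "\<bar>\<phi> x * U x\<bar> \<le> \<bar>M * (indicator (cball 0 R) x * \<phi> x)\<bar>"
      using mult_right_mono[OF M(2)[of x], of "\<bar>\<phi> x\<bar>"] M(1) supp_ballD[OF R, of x]
      by (cases "norm x \<le> R") (auto simp: abs_mult mult.commute)
  qed
  also have "\<dots> = ennreal (M powr p) * pint p (\<lambda>x. indicator (cball 0 R) x * \<phi> x)"
    using M(1) by (intro pint_cmult) auto
  also have "\<dots> < \<infinity>" using \<phi>_Lp by (simp add: Lploc_def ennreal_mult_less_top)
  finally show ?thesis .
qed

lemma L_norm_le:
  fixes f :: "real ^ 'n \<Rightarrow> 'b::euclidean_space"
  assumes "f \<in> borel_measurable lebesgue" "(\<integral>\<^sup>+x. ennreal (norm (f x) powr p) \<partial>\<mu>) \<le> ennreal e" "0 \<le> e"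
  shows "L_norm p \<mu> f \<le> e powr (1 / p)"
proof -
  have "enn2real (\<integral>\<^sup>+x. ennreal (norm (f x) powr p) \<partial>\<mu>) \<le> e" using assms(2,3) by (rule enn2real_leI[rotated])
  then show ?thesis using assms(1) p_pos by (subst L_norm_eq) (auto simp: measurable_\<mu> intro!: powr_mono2)
qed

lemma nn_integral_eq_L_norm:
  fixes f :: "real ^ 'n \<Rightarrow> 'b::euclidean_space"
  assumes "f \<in> borel_measurable lebesgue" "(\<integral>\<^sup>+x. ennreal (norm (f x) powr p) \<partial>\<mu>) < \<infinity>"
  shows "(\<integral>\<^sup>+x. ennreal (norm (f x) powr p) \<partial>\<mu>) = ennreal (L_norm p \<mu> f powr p)"
  using assms p_pos by (subst L_norm_eq) (auto simp: measurable_\<mu> powr_powr less_top)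

lemma grad_diff:
  "grad U x - grad V x = (\<chi> i. partial_deriv i U x - partial_deriv i V x)"
  by (simp add: grad_def vec_eq_iff)

lemma sobolev_imp_H:
  assumes "sobolev u"
  shows "u \<in> L_space (ereal p) \<mu> \<and> (\<exists>U :: nat \<Rightarrow> real ^ 'n \<Rightarrow> real. (\<forall>n. U n \<in> test_functions) \<and>
       (\<lambda>n. L_norm p \<mu> (\<lambda>x. U n x - u x)) \<longlonglongrightarrow> 0 \<and>
       (\<forall>\<epsilon>>0. \<exists>N. \<forall>m\<ge>N. \<forall>n\<ge>N. L_norm p \<mu> (\<lambda>x. grad (U m) x - grad (U n) x) < \<epsilon>))"
proof -
  obtain u' g where u': "u' \<in> borel_measurable borel" "AE x in lborel. u x = u' x" "pint p (\<lambda>x. \<phi> x * u' x) < \<infinity>"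
    and g: "\<And>i. weakd i u' (g i)" "\<And>i. pint p (\<lambda>x. \<phi> x * g i x) < \<infinity>" using assms unfolding sobolev_def by blast
  note [measurable] = u'(1) weakd_measurable(2)[OF g(1)]
  have "\<exists>U\<in>test_functions. pint p (\<lambda>x. \<phi> x * (U x - u' x)) \<le> ennreal (inverse (real (Suc n))) \<and>
     (\<forall>i. pint p (\<lambda>x. \<phi> x * (partial_deriv i U x - g i x)) \<le> ennreal (inverse (real (Suc n))))" for n
  proof (rule approx_weighted[OF p w\<phi> _ _ g(1) u'(3) g(2)])
    show "pint p (\<lambda>x. indicator (cball 0 R) x * \<phi> x) < \<infinity>" "pint p (\<lambda>x. indicator (cball 0 R) x * d\<phi> j x) < \<infinity>" for R j
      using \<phi>_Lp d\<phi>_Lp[of j] unfolding Lploc_def by blast+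
  qed simp
  then have "\<exists>U. \<forall>n. U n \<in> test_functions \<and> pint p (\<lambda>x. \<phi> x * (U n x - u' x)) \<le> ennreal (inverse (real (Suc n))) \<and>
     (\<forall>i. pint p (\<lambda>x. \<phi> x * (partial_deriv i (U n) x - g i x)) \<le> ennreal (inverse (real (Suc n))))"
    unfolding Bex_def by (intro choice allI)
  then obtain U where U: "\<And>n. U n \<in> test_functions"
    and Uu: "\<And>n. pint p (\<lambda>x. \<phi> x * (U n x - u' x)) \<le> ennreal (inverse (real (Suc n)))"
    and Ug: "\<And>n i. pint p (\<lambda>x. \<phi> x * (partial_deriv i (U n) x - g i x)) \<le> ennreal (inverse (real (Suc n)))"
    by blast
  note [measurable] = test_functions_measurable[OF U]
  have inv0: "(\<lambda>n. inverse (real (Suc n))) \<longlonglongrightarrow> 0" by (rule LIMSEQ_inverse_real_of_nat)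
  have le: "L_norm p \<mu> (\<lambda>x. U n x - u x) \<le> inverse (real (Suc n)) powr (1 / p)" for n
  proof (rule L_norm_le)
    have ae: "AE x in lborel. U n x - u x = U n x - u' x" using u'(2) by eventually_elim simp
    show m: "(\<lambda>x. U n x - u x) \<in> borel_measurable lebesgue" by (rule lebesgue_measurable_AE[OF _ ae]) measurable
    have "(\<integral>\<^sup>+x. ennreal (norm (U n x - u x) powr p) \<partial>\<mu>) = pint p (\<lambda>x. \<phi> x * (U n x - u' x))"
      by (rule pint_\<mu>[OF m]) (use ae in \<open>auto elim!: eventually_mono\<close>)
    then show "(\<integral>\<^sup>+x. ennreal (norm (U n x - u x) powr p) \<partial>\<mu>) \<le> ennreal (inverse (real (Suc n)))" using Uu[of n] by simp
  qed simp
  have L0: "(\<lambda>n. L_norm p \<mu> (\<lambda>x. U n x - u x)) \<longlonglongrightarrow> 0"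
  proof (rule tendsto_sandwich[OF _ _ tendsto_const])
    show "(\<lambda>n. inverse (real (Suc n)) powr (1 / p)) \<longlonglongrightarrow> 0"
      using tendsto_powr'[OF inv0 tendsto_const[of "1 / p"]] p_pos by simp
  qed (use le in \<open>auto simp: L_norm_def\<close>)
  define X where "X n = pint p (\<lambda>x. \<Sum>i\<in>UNIV. \<bar>\<phi> x * (partial_deriv i (U n) x - g i x)\<bar>)" for n
  have X0: "X \<longlonglongrightarrow> 0"
    unfolding X_def
  proof (rule pint_tendsto_0_sum)
    show "(\<lambda>n. pint p (\<lambda>x. \<phi> x * (partial_deriv i (U n) x - g i x))) \<longlonglongrightarrow> 0" for i
    proof (rule tendsto_sandwich[OF _ _ tendsto_const])
      show "(\<lambda>n. ennreal (inverse (real (Suc n)))) \<longlonglongrightarrow> 0" using tendsto_ennrealI[OF inv0] by simp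
    qed (use Ug in auto)
  qed (use p_pos in auto)
  have gd: "(\<integral>\<^sup>+x. ennreal (norm (grad (U m) x - grad (U n) x) powr p) \<partial>\<mu>) \<le> ennreal (2 powr p) * (X m + X n)" for m n
  proof -
    have "(\<integral>\<^sup>+x. ennreal (norm (grad (U m) x - grad (U n) x) powr p) \<partial>\<mu>) \<le>
       pint p (\<lambda>x. \<Sum>i\<in>UNIV. \<bar>\<phi> x * (partial_deriv i (U m) x - partial_deriv i (U n) x)\<bar>)"
      unfolding grad_diff by (rule nn_integral_vec_le) measurable
    also have "\<dots> \<le> pint p (\<lambda>x. (\<Sum>i\<in>UNIV. \<bar>\<phi> x * (partial_deriv i (U m) x - g i x)\<bar>) + (\<Sum>i\<in>UNIV. \<bar>\<phi> x * (partial_deriv i (U n) x - g i x)\<bar>))"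
    proof (rule pint_mono[OF p_pos(2)], rule AE_I2)
      fix x
      have "(\<Sum>i\<in>UNIV. \<bar>\<phi> x * (partial_deriv i (U m) x - partial_deriv i (U n) x)\<bar>) \<le>
        (\<Sum>i\<in>UNIV. \<bar>\<phi> x * (partial_deriv i (U m) x - g i x)\<bar> + \<bar>\<phi> x * (partial_deriv i (U n) x - g i x)\<bar>)"
        by (intro sum_mono) (auto simp: abs_mult distrib_left[symmetric] intro!: mult_left_mono)
      then show "\<bar>\<Sum>i\<in>UNIV. \<bar>\<phi> x * (partial_deriv i (U m) x - partial_deriv i (U n) x)\<bar>\<bar> \<le>
        \<bar>(\<Sum>i\<in>UNIV. \<bar>\<phi> x * (partial_deriv i (U m) x - g i x)\<bar>) + (\<Sum>i\<in>UNIV. \<bar>\<phi> x * (partial_deriv i (U n) x - g i x)\<bar>)\<bar>"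
        by (simp add: sum.distrib sum_nonneg)
    qed
    also have "\<dots> \<le> ennreal (2 powr p) * (X m + X n)"
      unfolding X_def by (rule pint_add) (use p_pos in auto)
    finally show ?thesis .
  qed
  have cau: "\<exists>N. \<forall>m\<ge>N. \<forall>n\<ge>N. L_norm p \<mu> (\<lambda>x. grad (U m) x - grad (U n) x) < \<epsilon>" if \<epsilon>: "0 < \<epsilon>" for \<epsilon>
  proof -
    define \<delta> where "\<delta> = (\<epsilon> / 2) powr p"
    have \<delta>: "0 < \<delta>" using \<epsilon> by (simp add: \<delta>_def)
    define e where "e = \<delta> / (2 * 2 powr p)"
    have e: "0 < e" using \<delta> by (simp add: e_def)
    obtain N where N: "\<And>n. n \<ge> N \<Longrightarrow> X n \<le> ennreal e"
      using ennreal_tendsto_0D[OF X0 e] by (auto simp: eventually_sequentially)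
    have "L_norm p \<mu> (\<lambda>x. grad (U m) x - grad (U n) x) < \<epsilon>" if "m \<ge> N" "n \<ge> N" for m n
    proof -
      have m: "(\<lambda>x. grad (U m) x - grad (U n) x) \<in> borel_measurable lebesgue"
        unfolding grad_diff by (intro lebesgue_measurable_borel measurable_vec_lambda) measurable
      have "(\<integral>\<^sup>+x. ennreal (norm (grad (U m) x - grad (U n) x) powr p) \<partial>\<mu>) \<le> ennreal (2 powr p) * (ennreal e + ennreal e)"
        by (rule order_trans[OF gd]) (intro mult_left_mono add_mono N that; simp)
      also have "\<dots> = ennreal \<delta>"
        using e by (subst ennreal_plus[symmetric]) (auto simp: ennreal_mult[symmetric] e_def)
      finally have "L_norm p \<mu> (\<lambda>x. grad (U m) x - grad (U n) x) \<le> \<delta> powr (1 / p)"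
        using m \<delta> by (intro L_norm_le) auto
      also have "\<dots> = \<epsilon> / 2" using \<epsilon> p_pos by (simp add: \<delta>_def powr_powr)
      finally show ?thesis using \<epsilon> by simp
    qed
    then show ?thesis by blast
  qed
  have "u \<in> L_space (ereal p) \<mu>" using L_space_real_iff[OF u'(1,2)] u'(3) by blast
  then show ?thesis using U L0 cau by blast
qed

text \<open>Limits of test functions. A subsequence is chosen along which the functions and all partial derivatives are rapidly Cauchy.\<close>

lemma H_imp_sobolev:
  assumes u: "u \<in> L_space (ereal p) \<mu>" and U: "\<And>n. U n \<in> test_functions"
    and lim: "(\<lambda>n. L_norm p \<mu> (\<lambda>x. U n x - u x)) \<longlonglongrightarrow> 0"
    and cau: "\<And>\<epsilon>. \<epsilon> > 0 \<Longrightarrow> \<exists>N. \<forall>m\<ge>N. \<forall>n\<ge>N. L_norm p \<mu> (\<lambda>x. grad (U m) x - grad (U n) x) < \<epsilon>"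
  shows "sobolev u"
proof -
  obtain u' where u': "u' \<in> borel_measurable borel" "AE x in lborel. u x = u' x"
    using borel_version[of u] u by (auto simp: L_space_iff)
  have fu: "pint p (\<lambda>x. \<phi> x * u' x) < \<infinity>" using L_space_real_iff[OF u'] u by blast
  note [measurable] = test_functions_measurable[OF U] u'(1)
  define A where "A n = pint p (\<lambda>x. \<phi> x * (U n x - u' x))" for n
  have dfin: "pint p (\<lambda>x. \<phi> x * (a x - b x)) < \<infinity>"
    if "a \<in> borel_measurable borel" "b \<in> borel_measurable borel" "pint p (\<lambda>x. \<phi> x * a x) < \<infinity>" "pint p (\<lambda>x. \<phi> x * b x) < \<infinity>" for a b
  proof -
    note [measurable] = that(1,2)
    have "pint p (\<lambda>x. \<phi> x * a x - \<phi> x * b x) \<le> ennreal (2 powr p) * (pint p (\<lambda>x. \<phi> x * a x) + pint p (\<lambda>x. \<phi> x * b x))"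
      by (rule pint_diff) (use p_pos in auto)
    also have "\<dots> < \<infinity>" using that by (simp add: ennreal_mult_less_top)
    finally show ?thesis by (simp add: right_diff_distrib)
  qed
  have A0: "A \<longlonglongrightarrow> 0"
  proof -
    have eq: "A n = ennreal (L_norm p \<mu> (\<lambda>x. U n x - u x) powr p)" for n
    proof -
      have ae: "AE x in lborel. U n x - u x = U n x - u' x" using u'(2) by eventually_elim simp
      have m: "(\<lambda>x. U n x - u x) \<in> borel_measurable lebesgue" by (rule lebesgue_measurable_AE[OF _ ae]) measurable
      have e: "(\<integral>\<^sup>+x. ennreal (norm (U n x - u x) powr p) \<partial>\<mu>) = A n"
        unfolding A_def by (rule pint_\<mu>[OF m]) (use ae in \<open>auto elim!: eventually_mono\<close>)
      have "A n < \<infinity>" unfolding A_def by (rule dfin[OF _ _ pint_test_finite[OF U] fu]) measurable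
      then show ?thesis using nn_integral_eq_L_norm[OF m] e by simp
    qed
    have "(\<lambda>n. L_norm p \<mu> (\<lambda>x. U n x - u x) powr p) \<longlonglongrightarrow> 0"
      using tendsto_powr'[OF lim tendsto_const[of p]] p_pos by (simp add: L_norm_def)
    from tendsto_ennrealI[OF this] show ?thesis by (simp add: eq[abs_def])
  qed
  have B: "\<exists>N. \<forall>m\<ge>N. \<forall>n\<ge>N. \<forall>i. pint p (\<lambda>x. \<phi> x * (partial_deriv i (U m) x - partial_deriv i (U n) x)) \<le> ennreal e"
    if e: "0 < e" for e
  proof -
    obtain N where N: "\<And>m n. m \<ge> N \<Longrightarrow> n \<ge> N \<Longrightarrow> L_norm p \<mu> (\<lambda>x. grad (U m) x - grad (U n) x) < e powr (1 / p)"
      using cau[of "e powr (1 / p)"] e by auto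
    have "pint p (\<lambda>x. \<phi> x * (partial_deriv i (U m) x - partial_deriv i (U n) x)) \<le> ennreal e"
      if mn: "m \<ge> N" "n \<ge> N" for m n i
    proof -
      let ?G = "\<lambda>x. grad (U m) x - grad (U n) x"
      have L: "?G \<in> L_space (ereal p) \<mu>"
        unfolding grad_diff
      proof (rule L_space_vecI)
        show "pint p (\<lambda>x. \<phi> x * (partial_deriv j (U m) x - partial_deriv j (U n) x)) < \<infinity>" for j
          by (rule dfin[OF _ _ pint_test_finite[OF test_functions_partial_deriv[OF U]]
                pint_test_finite[OF test_functions_partial_deriv[OF U]]]) measurable
      qed measurable
      then have m: "?G \<in> borel_measurable lebesgue" and f: "(\<integral>\<^sup>+x. ennreal (norm (?G x) powr p) \<partial>\<mu>) < \<infinity>"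
        by (auto simp: L_space_iff)
      have "pint p (\<lambda>x. \<phi> x * (partial_deriv i (U m) x - partial_deriv i (U n) x)) = (\<integral>\<^sup>+x. ennreal (norm (?G x $ i) powr p) \<partial>\<mu>)"
        by (rule pint_\<mu>[OF measurable_vec_component[OF m], symmetric]) (simp add: grad_diff)
      also have "\<dots> \<le> (\<integral>\<^sup>+x. ennreal (norm (?G x) powr p) \<partial>\<mu>)"
        using p_pos component_le_norm_cart[of "?G _" i] by (intro nn_integral_mono ennreal_leI powr_mono2) (auto simp del: vector_minus_component)
      also have "\<dots> = ennreal (L_norm p \<mu> ?G powr p)" by (rule nn_integral_eq_L_norm[OF m f])
      also have "\<dots> \<le> ennreal ((e powr (1 / p)) powr p)"
        using N[OF mn] p_pos by (intro ennreal_leI powr_mono2) (auto simp: L_norm_def)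
      also have "\<dots> = ennreal e" using e p_pos by (simp add: powr_powr)
      finally show ?thesis .
    qed
    then show ?thesis by blast
  qed
  define \<delta> where "\<delta> k = (1 / 4 powr p) ^ k" for k :: nat
  have \<delta>: "0 < \<delta> k" for k by (simp add: \<delta>_def)
  have "\<exists>N. \<forall>m\<ge>N. \<forall>n\<ge>N. pint p (\<lambda>x. \<phi> x * (U m x - U n x)) \<le> ennreal (\<delta> k) \<and>
     (\<forall>i. pint p (\<lambda>x. \<phi> x * (partial_deriv i (U m) x - partial_deriv i (U n) x)) \<le> ennreal (\<delta> k))" for k
  proof -
    obtain N1 where N1: "\<forall>m\<ge>N1. \<forall>n\<ge>N1. \<forall>i. pint p (\<lambda>x. \<phi> x * (partial_deriv i (U m) x - partial_deriv i (U n) x)) \<le> ennreal (\<delta> k)"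
      using B[OF \<delta>] by blast
    define e where "e = \<delta> k / (2 * 2 powr p)"
    have e: "0 < e" using \<delta> by (simp add: e_def)
    obtain N2 where N2: "\<And>n. n \<ge> N2 \<Longrightarrow> A n \<le> ennreal e"
      using ennreal_tendsto_0D[OF A0 e] by (auto simp: eventually_sequentially)
    have "pint p (\<lambda>x. \<phi> x * (U m x - U n x)) \<le> ennreal (\<delta> k)" if "m \<ge> N2" "n \<ge> N2" for m n
    proof -
      have "pint p (\<lambda>x. \<phi> x * (U m x - U n x)) = pint p (\<lambda>x. \<phi> x * (U m x - u' x) - \<phi> x * (U n x - u' x))"
        by (simp add: algebra_simps)
      also have "\<dots> \<le> ennreal (2 powr p) * (A m + A n)" unfolding A_def by (rule pint_diff) (use p_pos in auto)
      also have "\<dots> \<le> ennreal (2 powr p) * (ennreal e + ennreal e)" by (intro mult_left_mono add_mono N2 that) simp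
      also have "\<dots> = ennreal (\<delta> k)"
        using e by (subst ennreal_plus[symmetric]) (auto simp: ennreal_mult[symmetric] e_def)
      finally show ?thesis .
    qed
    then show ?thesis using N1 by (intro exI[of _ "max N1 N2"]) auto
  qed
  then have "\<exists>N. \<forall>k. \<forall>m\<ge>N k. \<forall>n\<ge>N k. pint p (\<lambda>x. \<phi> x * (U m x - U n x)) \<le> ennreal (\<delta> k) \<and>
     (\<forall>i. pint p (\<lambda>x. \<phi> x * (partial_deriv i (U m) x - partial_deriv i (U n) x)) \<le> ennreal (\<delta> k))"
    by (intro choice allI)
  then obtain N where N: "\<And>k m n. m \<ge> N k \<Longrightarrow> n \<ge> N k \<Longrightarrow> pint p (\<lambda>x. \<phi> x * (U m x - U n x)) \<le> ennreal (\<delta> k)"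
    "\<And>k m n i. m \<ge> N k \<Longrightarrow> n \<ge> N k \<Longrightarrow> pint p (\<lambda>x. \<phi> x * (partial_deriv i (U m) x - partial_deriv i (U n) x)) \<le> ennreal (\<delta> k)"
    by blast
  \<comment> \<open>The summand \<open>k\<close> makes \<open>r\<close> strictly increasing.\<close>
  define r where "r k = k + (\<Sum>j\<le>k. N j)" for k
  have rN: "r k \<ge> N k" "r (Suc k) \<ge> N k" for k
    using member_le_sum[of k "{..k}" N] by (auto simp: r_def)
  have r_mono: "strict_mono r" by (rule strict_monoI_Suc) (simp add: r_def)
  have [measurable]: "partial_deriv i (U n) \<in> borel_measurable borel" for i n by (rule test_functions_measurable[OF U])
  obtain H S where H: "H \<in> borel_measurable borel" "S \<in> borel_measurable borel"
    "AE x in lborel. (\<lambda>n. \<phi> x * U (r n) x) \<longlonglongrightarrow> H x" "AE x in lborel. \<forall>n. \<bar>\<phi> x * U (r n) x\<bar> \<le> S x" "pint p S < \<infinity>"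
  proof (rule fast_Cauchy_Lp[OF p, of "\<lambda>n x. \<phi> x * U (r n) x"])
    show "pint p (\<lambda>x. \<phi> x * U (r (Suc n)) x - \<phi> x * U (r n) x) \<le> ennreal ((1 / 4 powr p) ^ n)" for n
      using N(1)[OF rN(2) rN(1), of n] by (simp add: \<delta>_def right_diff_distrib)
  qed (use pint_test_finite[OF U] in auto)
  have "\<exists>H S. H \<in> borel_measurable borel \<and> S \<in> borel_measurable borel \<and>
    (AE x in lborel. (\<lambda>n. \<phi> x * partial_deriv i (U (r n)) x) \<longlonglongrightarrow> H x) \<and>
    (AE x in lborel. \<forall>n. \<bar>\<phi> x * partial_deriv i (U (r n)) x\<bar> \<le> S x) \<and> pint p S < \<infinity>" for i
  proof (rule fast_Cauchy_Lp[OF p, of "\<lambda>n x. \<phi> x * partial_deriv i (U (r n)) x"])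
    show "pint p (\<lambda>x. \<phi> x * partial_deriv i (U (r (Suc n))) x - \<phi> x * partial_deriv i (U (r n)) x) \<le> ennreal ((1 / 4 powr p) ^ n)" for n
      using N(2)[OF rN(2) rN(1), of i n] by (simp add: \<delta>_def right_diff_distrib)
  qed (use pint_test_finite[OF test_functions_partial_deriv[OF U]] in auto)
  then have "\<exists>K. \<forall>i. \<exists>S. K i \<in> borel_measurable borel \<and> S \<in> borel_measurable borel \<and>
    (AE x in lborel. (\<lambda>n. \<phi> x * partial_deriv i (U (r n)) x) \<longlonglongrightarrow> K i x) \<and>
    (AE x in lborel. \<forall>n. \<bar>\<phi> x * partial_deriv i (U (r n)) x\<bar> \<le> S x) \<and> pint p S < \<infinity>"
    by (intro choice allI)
  then obtain K where "\<forall>i. \<exists>S. K i \<in> borel_measurable borel \<and> S \<in> borel_measurable borel \<and>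
    (AE x in lborel. (\<lambda>n. \<phi> x * partial_deriv i (U (r n)) x) \<longlonglongrightarrow> K i x) \<and>
    (AE x in lborel. \<forall>n. \<bar>\<phi> x * partial_deriv i (U (r n)) x\<bar> \<le> S x) \<and> pint p S < \<infinity>"
    by blast
  from choice[OF this] obtain T where K: "\<And>i. K i \<in> borel_measurable borel" "\<And>i. T i \<in> borel_measurable borel"
    "\<And>i. AE x in lborel. (\<lambda>n. \<phi> x * partial_deriv i (U (r n)) x) \<longlonglongrightarrow> K i x"
    "\<And>i. AE x in lborel. \<forall>n. \<bar>\<phi> x * partial_deriv i (U (r n)) x\<bar> \<le> T i x" "\<And>i. pint p (T i) < \<infinity>" by blast
  note [measurable] = H(1,2) K(1,2)
  have "(\<lambda>n. pint p (\<lambda>x. \<phi> x * (U (r n) x - u' x))) \<longlonglongrightarrow> 0"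
    using LIMSEQ_subseq_LIMSEQ[OF A0 r_mono] by (simp add: A_def o_def)
  then obtain s where s: "strict_mono s" "AE x in lborel. (\<lambda>n. \<phi> x * (U (r (s n)) x - u' x)) \<longlonglongrightarrow> 0"
    using pint_AE_subseq[of "\<lambda>n x. \<phi> x * (U (r n) x - u' x)" p] p_pos by auto
  have Hu: "AE x in lborel. (\<lambda>n. U (r n) x) \<longlonglongrightarrow> u' x"
    using s(2) H(3)
  proof eventually_elim
    case (elim x)
    have "(\<lambda>n. \<phi> x * U (r (s n)) x) \<longlonglongrightarrow> H x" using LIMSEQ_subseq_LIMSEQ[OF elim(2) s(1)] by (simp add: o_def)
    moreover have "(\<lambda>n. \<phi> x * U (r (s n)) x - \<phi> x * u' x) \<longlonglongrightarrow> 0" using elim(1) by (simp add: right_diff_distrib)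
    then have "(\<lambda>n. \<phi> x * U (r (s n)) x) \<longlonglongrightarrow> \<phi> x * u' x" by (rule LIM_zero_cancel)
    ultimately have "H x = \<phi> x * u' x" by (rule LIMSEQ_unique)
    then have "(\<lambda>n. \<phi> x * U (r n) x / \<phi> x) \<longlonglongrightarrow> \<phi> x * u' x / \<phi> x"
      using elim(2) \<phi>_pos[of x] by (intro tendsto_divide tendsto_const) auto
    then show ?case using \<phi>_pos[of x] by simp
  qed
  define g where "g i x = K i x / \<phi> x" for i x
  have [measurable]: "g i \<in> borel_measurable borel" for i unfolding g_def by measurable
  have \<phi>0: "\<phi> x \<noteq> 0" for x using \<phi>_pos[of x] by simp
  have fS: "pint p (\<lambda>x. \<phi> x * (S x / \<phi> x)) < \<infinity>" and fT: "pint p (\<lambda>x. \<phi> x * (T i x / \<phi> x)) < \<infinity>" for i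
    using H(5) K(5) \<phi>0 by simp_all
  have w: "weakd i u' (g i)" for i
  proof (rule weakd_limit_dominated[where U = "\<lambda>n. U (r n)" and G = "\<lambda>n. partial_deriv i (U (r n))"])
    show "weakd i (U (r n)) (partial_deriv i (U (r n)))" for n by (rule weakd_C1[OF test_functionsD(1)[OF U]])
    show "locint (\<lambda>x. S x / \<phi> x)" "locint (\<lambda>x. T i x / \<phi> x)" by (rule Lp_locint(1)[OF _ fS] Lp_locint(1)[OF _ fT]; measurable)+
    show "AE x in lborel. \<bar>U (r n) x\<bar> \<le> \<bar>S x / \<phi> x\<bar>" for n
      using H(4)
    proof eventually_elim
      case (elim x)
      then have "\<phi> x * \<bar>U (r n) x\<bar> \<le> S x" using \<phi>_pos[of x] by (simp add: abs_mult)
      then have "\<bar>U (r n) x\<bar> \<le> S x / \<phi> x" using \<phi>_pos[of x] by (simp add: field_simps)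
      then show ?case by (rule order_trans[OF _ abs_ge_self])
    qed
    show "AE x in lborel. \<bar>partial_deriv i (U (r n)) x\<bar> \<le> \<bar>T i x / \<phi> x\<bar>" for n
      using K(4)[of i]
    proof eventually_elim
      case (elim x)
      then have "\<phi> x * \<bar>partial_deriv i (U (r n)) x\<bar> \<le> T i x" using \<phi>_pos[of x] by (simp add: abs_mult)
      then have "\<bar>partial_deriv i (U (r n)) x\<bar> \<le> T i x / \<phi> x" using \<phi>_pos[of x] by (simp add: field_simps)
      then show ?case by (rule order_trans[OF _ abs_ge_self])
    qed
    show "AE x in lborel. (\<lambda>n. partial_deriv i (U (r n)) x) \<longlonglongrightarrow> g i x"
      using K(3)[of i]
    proof eventually_elim
      case (elim x)
      have "(\<lambda>n. \<phi> x * partial_deriv i (U (r n)) x / \<phi> x) \<longlonglongrightarrow> K i x / \<phi> x"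
        using elim \<phi>0 by (intro tendsto_divide tendsto_const)
      then show ?case using \<phi>0[of x] by (simp add: g_def)
    qed
  qed (use Hu in auto)
  have fg: "pint p (\<lambda>x. \<phi> x * g i x) < \<infinity>" for i
  proof (rule le_less_trans[OF pint_mono[OF p_pos(2)] K(5)])
    show "AE x in lborel. \<bar>\<phi> x * g i x\<bar> \<le> \<bar>T i x\<bar>"
      using K(3)[of i] K(4)[of i]
    proof eventually_elim
      case (elim x)
      have "\<bar>K i x\<bar> \<le> T i x" by (rule LIMSEQ_le_const2[OF tendsto_rabs[OF elim(1)]]) (use elim(2) in auto)
      then show ?case using \<phi>0[of x] by (simp add: g_def)
    qed
  qed
  show ?thesis unfolding sobolev_def using u' fu w fg by blast
qed

lemma spaces_eq: "H_space p w = V_space p w \<and> V_space p w = W_space p w"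
proof -
  have "H_space p w = ae_class \<mu> ` Collect sobolev"
    unfolding H_space_def using sobolev_imp_H H_imp_sobolev by (intro arg_cong[where f = "(`) (ae_class \<mu>)"]) blast
  moreover have "V_space p w = ae_class \<mu> ` Collect sobolev"
    unfolding V_space_def using V_space_iff by (intro arg_cong[where f = "(`) (ae_class \<mu>)"]) blast
  moreover have "W_space p w = ae_class \<mu> ` Collect sobolev"
    unfolding W_space_def using W_space_iff by (intro arg_cong[where f = "(`) (ae_class \<mu>)"]) blast
  ultimately show ?thesis by simp
qed

end

lemma Reg_1D:
  "Reg p w \<Longrightarrow> p = 1 \<Longrightarrow> compact K \<Longrightarrow> \<exists>C. AE x in lebesgue. x \<in> K \<longrightarrow> inverse (ennreal (phi p w x)) \<le> ennreal C"
  by (simp add: Reg_def)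

lemma Reg_pD:
  "Reg p w \<Longrightarrow> p \<noteq> 1 \<Longrightarrow> compact K \<Longrightarrow>
    (\<integral>\<^sup>+x\<in>K. (if phi p w x = 0 then \<infinity> else ennreal (phi p w x powr - (p / (p - 1)))) \<partial>lebesgue) < \<infinity>"
  by (simp add: Reg_def)

text \<open>The regularity condition forces \<open>\<phi>\<close> to be nonzero almost everywhere, since the negative power of \<open>\<phi>\<close> is infinite on the
  zero set.\<close>

lemma Reg_imp_phi_nonzero:
  fixes w :: "real ^ 'n::finite \<Rightarrow> real"
  assumes p: "1 \<le> p" and w: "w \<in> borel_measurable lebesgue" and reg: "Reg p w"
  shows "AE x in lborel. phi p w x \<noteq> 0"
proof -
  have m: "phi p w \<in> borel_measurable lebesgue" unfolding phi_def[abs_def] using w by measurable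
  have "AE x in lborel. x \<in> cball 0 (real n) \<longrightarrow> phi p w x \<noteq> 0" for n
  proof (cases "p = 1")
    case True
    then obtain C where "AE x in lebesgue. x \<in> cball 0 (real n) \<longrightarrow> inverse (ennreal (phi p w x)) \<le> ennreal C"
      using Reg_1D[OF reg True compact_cball] by blast
    then have "AE x in lborel. x \<in> cball 0 (real n) \<longrightarrow> inverse (ennreal (phi p w x)) \<le> ennreal C"
      by (simp only: AE_lebesgue_iff)
    then show ?thesis by eventually_elim (auto simp: top_unique)
  next
    case False
    let ?f = "\<lambda>x. (if phi p w x = 0 then \<infinity> else ennreal (phi p w x powr - (p / (p - 1)))) * indicator (cball 0 (real n)) x"
    have "(\<integral>\<^sup>+x. ?f x \<partial>lebesgue) < \<infinity>"
      by (rule Reg_pD[OF reg False compact_cball])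
    then have "(\<integral>\<^sup>+x. ?f x \<partial>lebesgue) \<noteq> \<infinity>" by simp
    moreover have "?f \<in> borel_measurable lebesgue"
      using m by (intro borel_measurable_times_ennreal borel_measurable_indicator) (auto intro!: measurable_If)
    ultimately have "AE x in lebesgue. ?f x \<noteq> \<infinity>" by (rule nn_integral_noteq_infinite[rotated])
    then have "AE x in lborel. ?f x \<noteq> \<infinity>" by (simp only: AE_lebesgue_iff)
    then show ?thesis by eventually_elim (auto simp: ennreal_mult_eq_top_iff)
  qed
  then have "AE x in lborel. \<forall>n. x \<in> cball 0 (real n) \<longrightarrow> phi p w x \<noteq> 0"
    unfolding AE_all_countable by blast
  then show ?thesis
  proof eventually_elim
    case (elim x)
    obtain n :: nat where "norm x \<le> real n" using real_arch_simple by blast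
    then show ?case using elim by auto
  qed
qed

theorem corollary1p2:
  fixes p :: real and w :: "real ^ 'n::finite \<Rightarrow> real"
  assumes "1 \<le> p"
    and "weight w"
    and "Reg p w"
    and "Diff p w"
    and "p = 1 \<Longrightarrow> weak_gradient (phi p w) \<in> L_loc \<infinity> lebesgue"
  shows "H_space p w = V_space p w \<and> V_space p w = W_space p w"
proof -
  note p = assms(1)
  have wm: "w \<in> borel_measurable lebesgue" and w0: "AE x in lborel. 0 \<le> w x"
    using assms(2) by (auto simp: weight_def AE_lebesgue_iff)
  have fm: "phi p w \<in> borel_measurable lebesgue" unfolding phi_def[abs_def] using wm by measurable
  obtain f0 where f0: "f0 \<in> borel_measurable borel" "AE x in lborel. phi p w x = f0 x" using borel_version[OF fm] by blast
  \<comment> \<open>A Borel version of \<open>phi p w\<close>, changed on a null set to be positive everywhere.\<close>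
  define \<phi> where "\<phi> x = (if 0 < f0 x then f0 x else 1)" for x
  have \<phi>m[measurable]: "\<phi> \<in> borel_measurable borel" unfolding \<phi>_def using f0(1) by measurable
  have \<phi>_pos: "0 < \<phi> x" for x by (simp add: \<phi>_def)
  have \<phi>_eq: "AE x in lborel. phi p w x = \<phi> x"
    using f0(2) Reg_imp_phi_nonzero[OF p wm assms(3)]
  proof eventually_elim
    case (elim x)
    have "0 \<le> phi p w x" by (simp add: phi_def)
    then show ?case using elim by (auto simp: \<phi>_def)
  qed
  have w_eq: "AE x in lborel. w x = \<phi> x powr p"
    using w0 \<phi>_eq
  proof eventually_elim
    case (elim x)
    have "phi p w x powr p = w x" using elim(1) p by (simp add: phi_def powr_powr)
    then show ?case using elim by simp
  qed
  define D where "D = weak_gradient (phi p w)"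
  have "\<exists>G. has_weak_gradient (phi p w) G" using assms(4) by (simp add: Diff_def W_loc_def)
  then have D: "has_weak_gradient (phi p w) D" unfolding D_def weak_gradient_def by (rule someI_ex)
  have fL: "phi p w \<in> L_loc (ereal p) lebesgue" and DL: "D \<in> L_loc (ereal p) lebesgue"
    and bL: "beta p w \<in> L_loc (conj_exponent p) (weighted w)"
    using assms(4) by (auto simp: Diff_def W_loc_def D_def)
  have Dm: "D \<in> borel_measurable lebesgue"
  proof -
    define E where "E n x = indicator (cball 0 (real n)) x *\<^sub>R D x" for n :: nat and x
    have "E n \<in> borel_measurable lebesgue" for n
      using DL by (auto simp: L_loc_def L_space_def E_def[abs_def])
    moreover have "(\<lambda>n. E n x) \<longlonglongrightarrow> D x" for x
    proof (rule tendsto_eventually)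
      show "\<forall>\<^sub>F n in sequentially. E n x = D x"
        using eventually_ge_at_top[of "nat \<lceil>norm x\<rceil>"]
      proof eventually_elim
        case (elim n)
        then have "norm x \<le> real n" by linarith
        then show ?case by (simp add: E_def)
      qed
    qed
    ultimately show ?thesis by (rule borel_measurable_LIMSEQ_metric)
  qed
  have "\<forall>j. \<exists>g\<in>borel_measurable borel. AE x in lborel. D x $ j = g x"
    using borel_version[OF measurable_vec_component[OF Dm]] by blast
  then obtain d where d: "\<And>j. d j \<in> borel_measurable borel" "\<And>j. AE x in lborel. D x $ j = d j x" by metis
  note [measurable] = d(1)
  define \<beta> where "\<beta> j x = p * d j x / \<phi> x" for j x
  have \<beta>m[measurable]: "\<beta> j \<in> borel_measurable borel" for j unfolding \<beta>_def by measurable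
  have "AE x in lborel. beta p w x $ j = \<beta> j x" for j
    using \<phi>_eq d(2)[of j]
  proof eventually_elim
    case (elim x)
    then show ?case using \<phi>_pos[of x] by (simp add: beta_def \<beta>_def D_def)
  qed
  then have "AE x in lborel. \<forall>j\<in>UNIV. beta p w x $ j = \<beta> j x" by (intro AE_finite_allI) auto
  then have beta_eq: "AE x in lborel. \<forall>j. beta p w x $ j = \<beta> j x" by simp
  have q\<phi>: "Lqloc p (\<lambda>x. 1 / \<phi> x)"
    unfolding Lqloc_def
  proof (intro conjI allI)
    fix R
    show "if p = 1 then \<exists>C. AE x in lborel. norm x \<le> R \<longrightarrow> \<bar>1 / \<phi> x\<bar> \<le> C
          else pint (p / (p - 1)) (\<lambda>x. indicator (cball 0 R) x * (1 / \<phi> x)) < \<infinity>"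
    proof (cases "p = 1")
      case True
      then obtain C where "AE x in lebesgue. x \<in> cball 0 R \<longrightarrow> inverse (ennreal (phi p w x)) \<le> ennreal C"
        using Reg_1D[OF assms(3) True compact_cball] by blast
      then have "AE x in lborel. x \<in> cball 0 R \<longrightarrow> inverse (ennreal (phi p w x)) \<le> ennreal C"
        by (simp only: AE_lebesgue_iff)
      with \<phi>_eq have "AE x in lborel. norm x \<le> R \<longrightarrow> \<bar>1 / \<phi> x\<bar> \<le> max C 0"
      proof eventually_elim
        case (elim x)
        then show ?case using \<phi>_pos[of x]
          by (auto simp: inverse_ennreal ennreal_le_iff2 inverse_eq_divide)
      qed
      then show ?thesis using True by auto
    next
      case False
      let ?q = "p / (p - 1)"
      have "(\<integral>\<^sup>+x\<in>cball 0 R. (if phi p w x = 0 then \<infinity> else ennreal (phi p w x powr - ?q)) \<partial>lebesgue) < \<infinity>"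
        by (rule Reg_pD[OF assms(3) False compact_cball])
      then have "(\<integral>\<^sup>+x\<in>cball 0 R. (if phi p w x = 0 then \<infinity> else ennreal (phi p w x powr - ?q)) \<partial>lborel) < \<infinity>"
        by (simp add: nn_integral_completion)
      moreover have "pint ?q (\<lambda>x. indicator (cball 0 R) x * (1 / \<phi> x)) =
        (\<integral>\<^sup>+x\<in>cball 0 R. (if phi p w x = 0 then \<infinity> else ennreal (phi p w x powr - ?q)) \<partial>lborel)"
        unfolding pint_def
      proof (rule nn_integral_cong_AE)
        show "AE x in lborel. ennreal (\<bar>indicator (cball 0 R) x * (1 / \<phi> x)\<bar> powr ?q) =
          (if phi p w x = 0 then \<infinity> else ennreal (phi p w x powr - ?q)) * indicator (cball 0 R) x"
          using \<phi>_eq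
        proof eventually_elim
          case (elim x)
          have "(1 / \<phi> x) powr ?q = \<phi> x powr - ?q"
            using \<phi>_pos[of x] by (simp add: powr_divide powr_minus_divide)
          then show ?case using elim \<phi>_pos[of x] by (auto simp: indicator_def)
        qed
      qed
      ultimately show ?thesis using False by simp
    qed
  qed measurable
  have q\<beta>: "Lqloc p (\<lambda>x. \<beta> j x * \<phi> x powr (p - 1))" for j
    unfolding Lqloc_def
  proof (intro conjI allI)
    fix R
    let ?b = "\<lambda>x. indicator (cball 0 R) x *\<^sub>R beta p w x"
    have bR: "?b \<in> L_space (conj_exponent p) (weighted w)" using bL by (simp add: L_loc_def)
    have jle: "AE x in lborel. \<bar>\<beta> j x\<bar> \<le> norm (beta p w x)"
      using beta_eq by eventually_elim (metis component_le_norm_cart)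
    show "if p = 1 then \<exists>C. AE x in lborel. norm x \<le> R \<longrightarrow> \<bar>\<beta> j x * \<phi> x powr (p - 1)\<bar> \<le> C
          else pint (p / (p - 1)) (\<lambda>x. indicator (cball 0 R) x * (\<beta> j x * \<phi> x powr (p - 1))) < \<infinity>"
    proof (cases "p = 1")
      case True
      then obtain C where "AE x in weighted w. norm (?b x) \<le> C" using bR by (auto simp: L_space_def conj_exponent_def)
      then have "AE x in lebesgue. 0 < ennreal (w x) \<longrightarrow> norm (?b x) \<le> C"
        unfolding weighted_def using wm by (subst (asm) AE_density) auto
      then have "AE x in lborel. 0 < ennreal (w x) \<longrightarrow> norm (?b x) \<le> C" by (simp only: AE_lebesgue_iff)
      with w_eq jle have "AE x in lborel. norm x \<le> R \<longrightarrow> \<bar>\<beta> j x * \<phi> x powr (p - 1)\<bar> \<le> C"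
      proof eventually_elim
        case (elim x)
        then show ?case using \<phi>_pos[of x] True by auto
      qed
      then show ?thesis unfolding if_P[OF True] by (rule exI)
    next
      case False
      let ?q = "p / (p - 1)"
      have "integrable (weighted w) (\<lambda>x. norm (?b x) powr ?q)"
        using bR False by (simp add: L_space_def conj_exponent_def)
      then have fin: "(\<integral>\<^sup>+x. ennreal (norm (?b x) powr ?q) \<partial>weighted w) < \<infinity>" and
        m: "(\<lambda>x. norm (?b x) powr ?q) \<in> borel_measurable (weighted w)" by (auto simp: integrable_iff_bounded)
      have m': "(\<lambda>x. norm (?b x) powr ?q) \<in> borel_measurable lebesgue" using m by (simp add: weighted_def)
      have "pint ?q (\<lambda>x. indicator (cball 0 R) x * (\<beta> j x * \<phi> x powr (p - 1))) \<le>
        (\<integral>\<^sup>+x. ennreal (w x) * ennreal (norm (?b x) powr ?q) \<partial>lborel)"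
        unfolding pint_def
      proof (rule nn_integral_mono_AE)
        show "AE x in lborel. ennreal (\<bar>indicator (cball 0 R) x * (\<beta> j x * \<phi> x powr (p - 1))\<bar> powr ?q)
           \<le> ennreal (w x) * ennreal (norm (?b x) powr ?q)"
          using w_eq jle
        proof eventually_elim
          case (elim x)
          have "(\<phi> x powr (p - 1)) powr ?q = \<phi> x powr p" using False by (simp add: powr_powr)
          then have "\<bar>\<beta> j x * \<phi> x powr (p - 1)\<bar> powr ?q = w x * \<bar>\<beta> j x\<bar> powr ?q"
            using elim(1) by (simp add: abs_mult powr_mult)
          also have "\<dots> \<le> w x * norm (beta p w x) powr ?q"
            using elim p by (intro mult_left_mono powr_mono2) auto
          finally show ?case
            using elim(1) by (auto simp: indicator_def ennreal_mult[symmetric] intro!: ennreal_leI)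
        qed
      qed
      also have "\<dots> = (\<integral>\<^sup>+x. ennreal (w x) * ennreal (norm (?b x) powr ?q) \<partial>lebesgue)"
        by (simp add: nn_integral_completion)
      also have "\<dots> = (\<integral>\<^sup>+x. ennreal (norm (?b x) powr ?q) \<partial>weighted w)"
        unfolding weighted_def using wm m' by (intro nn_integral_density[symmetric]) auto
      finally show ?thesis using fin False by (auto intro: le_less_trans)
    qed
  qed measurable
  interpret weighted_space p \<phi> d \<beta> w
  proof
    show "weakd j \<phi> (d j)" for j by (rule has_weak_gradient_imp_weakd[OF D \<phi>m \<phi>_eq d])
    show "Lploc p \<phi>" by (rule L_loc_imp_Lploc[OF fL \<phi>m]) (use p \<phi>_eq in \<open>auto elim!: eventually_mono\<close>)
    show "Lploc p (d j)" for j
    proof (rule L_loc_imp_Lploc[OF DL d(1)])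
      show "AE x in lborel. \<bar>d j x\<bar> \<le> norm (D x)" using d(2)[of j] by eventually_elim (metis component_le_norm_cart)
    qed (use p in simp)
  qed (use p \<phi>_pos q\<phi> q\<beta> wm w_eq beta_eq in \<open>auto simp: \<beta>_def\<close>)
  show ?thesis by (rule spaces_eq)
qed

end
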